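(* Let $A$ be a commutative associative algebra over $\mathbb{C}$ and $U$ an $A$-module, equipped with a bilinear form on $A$, a bilinear form on $U$, and a bilinear map $\circ:U\times U\to A$ satisfying the compatibility conditions (1)–(3) of the context, and let $\ell\in\mathbb{C}$. Then there exists a vertex superalgebra structure on $V_{\mathcal{L}(A,U)}(\ell,0)$ which is uniquely determined by the condition that $\mathbf 1$ is the vacuum vector and $$Y(v,x)=v(x)=\sum_{n\in\mathbb{Z}}v(n)x^{-n-1}\quad\text{for }v\in A\oplus U.$$
   Context: Compatibility conditions: (1) the form $\langle\cdot,\cdot\rangle$ on $A$ is symmetric and associative ($\langle ab,c\rangle=\langle a,bc\rangle$); (2) the form $\langle\cdot,\cdot\rangle$ on $U$ and the map $\circ$ are symmetric; (3) for $a\in A$, $u,v,w\in U$: $\langle v,au\rangle=\langle u,av\rangle=\frac43\langle a,u\circ v\rangle$, $a(u\circ v)=v\circ au=u\circ av$, $(u\circ v)w=(v\circ w)u=(w\circ u)v$. ($A$ need not be unital.) Lie superalgebra: $\mathcal{L}(A,U)=A\otimes\mathbb{C}[t,t^{-1}]\oplus U\otimes\mathbb{C}[t,t^{-1}]\oplus\mathbb{C}K$, even part $A\otimes\mathbb{C}[t,t^{-1}]+\mathbb{C}K$, odd part $U\otimes\mathbb{C}[t,t^{-1}]$, $K$ central, writing $v(n)=v\otimes t^n$, with $[a(m),b(n)]=\frac12(m-n)(ab)(m+n-1)+\binom m3\langle a,b\rangle\delta_{m+n-2,0}K$, $[a(m),u(n)]=\frac14(m-2n)(au)(m+n-1)$,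 $[u(m),v(n)]_+=(u\circ v)(m+n)+\frac12m(m-1)\langle u,v\rangle\delta_{m+n-1,0}K$ for $a,b\in A$, $u,v\in U$. It is $\frac12\mathbb{Z}$-graded by $\deg K=0$, $\deg a(n)=1-n$, $\deg u(n)=\frac12-n$. Let $\mathbb{C}_\ell=\mathbb{C}$ be the module for the subalgebra $\mathcal{L}(A,U)^+=(A\oplus U)\otimes\mathbb{C}[t]\oplus\mathbb{C}K$ on which $K$ acts as $\ell$ and $(A\oplus U)\otimes\mathbb{C}[t]$ acts as $0$; $V_{\mathcal{L}(A,U)}(\ell,0)=U(\mathcal{L}(A,U))\otimes_{U(\mathcal{L}(A,U)^+)}\mathbb{C}_\ell$ ($U(\cdot)$ the universal enveloping algebra), $\mathbf 1=1\otimes1$, $\frac12\mathbb{Z}$-graded by $\deg\mathbf 1=0$; the even (odd) part is the sum of the homogeneous subspaces of integral (half-odd-integral) degree. $A\oplus U$ is identified with a subspace via $v\mapsto v(-1)\mathbf 1$. A vertex superalgebra is a $\mathbb{Z}_2$-graded vector space $V$ with a linear map $Y(v,x)=\sum_nv_nx^{-n-1}\in(\mathrm{End}\,V)[[x,x^{-1}]]$ and an even vacuum vector $\mathbf 1$ such that: $u_nv\in V^{\alpha+\beta}$ for $u\in V^\alpha,v\in V^\beta$ and $u_nv=0$ for $n$ large; for homogeneous $u,v$ and $m,n,k\in\mathbb{Z}$, $\sum_{i\ge0}(-1)^i\binom mi(u_{m+k-i}v_{n+i}-(-1)^{|u||v|}(-1)^mv_{m+n-i}u_{k+i})=\sum_{i\ge0}\binom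 ki(u_{m+i}v)_{n+k-i}$; $\mathbf 1_mv=\delta_{m,-1}v$, $v_{-1}\mathbf 1=v$, $v_n\mathbf 1=0$ for $n\ge0$. *)

theory Defs
  imports
    Complex_Main
    "HOL-Library.Poly_Mapping"
    "HOL-Library.Product_Plus"
    "HOL-Library.Z2"
    "HOL-Algebra.Module"
    "HOL-Algebra.QuotRing"
    "HOL-Algebra.Generated_Groups"
    "HOL-Algebra.Free_Abelian_Groups"
begin

section \<open>The data \<open>(A, U)\<close>\<close>

definition bilinear_map ::
  "(complex \<Rightarrow> 'x::ab_group_add \<Rightarrow> 'x) \<Rightarrow> (complex \<Rightarrow> 'y::ab_group_add \<Rightarrow> 'y) \<Rightarrow>
   (complex \<Rightarrow> 'z::ab_group_add \<Rightarrow> 'z) \<Rightarrow> ('x \<Rightarrow> 'y \<Rightarrow> 'z) \<Rightarrow> bool"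
  where "bilinear_map sx sy sz f \<longleftrightarrow>
    (\<forall>x. Vector_Spaces.linear sy sz (f x)) \<and>
    (\<forall>y. Vector_Spaces.linear sx sz (\<lambda>x. f x y))"

text \<open>The class \<open>comm_ring\<close> does not require a unit.\<close>

locale complex_comm_algebra = vector_space scaleA
  for scaleA :: "complex \<Rightarrow> 'a::comm_ring \<Rightarrow> 'a" +
  assumes scaleA_mult: "scaleA c (a * b) = scaleA c a * b"

locale complex_algebra_module =
  A: complex_comm_algebra scaleA + U: vector_space scaleU
  for scaleA :: "complex \<Rightarrow> 'a::comm_ring \<Rightarrow> 'a"
    and scaleU :: "complex \<Rightarrow> 'u::ab_group_add \<Rightarrow> 'u" +
  fixes act :: "'a \<Rightarrow> 'u \<Rightarrow> 'u"
  assumes act_bilinear: "bilinear_map scaleA scaleU scaleU act"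
    and act_mult: "act (a * b) u = act a (act b u)"

locale compatible_pair = complex_algebra_module scaleA scaleU act
  for scaleA :: "complex \<Rightarrow> 'a::comm_ring \<Rightarrow> 'a"
    and scaleU :: "complex \<Rightarrow> 'u::ab_group_add \<Rightarrow> 'u"
    and act :: "'a \<Rightarrow> 'u \<Rightarrow> 'u" +
  fixes formA :: "'a \<Rightarrow> 'a \<Rightarrow> complex"
    and formU :: "'u \<Rightarrow> 'u \<Rightarrow> complex"
    and circ :: "'u \<Rightarrow> 'u \<Rightarrow> 'a"
  assumes formA_bilinear: "bilinear_map scaleA scaleA (*) formA"
    and formU_bilinear: "bilinear_map scaleU scaleU (*) formU"
    and circ_bilinear: "bilinear_map scaleU scaleU scaleA circ"
    and formA_sym: "formA a b = formA b a"
    and formA_assoc: "formA (a * b) c = formA a (b * c)"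
    and formU_sym: "formU u v = formU v u"
    and circ_sym: "circ u v = circ v u"
    and formU_act: "formU v (act a u) = formU u (act a v)"
    and formU_act_circ: "formU u (act a v) = 4 / 3 * formA a (circ u v)"
    and mult_circ: "a * circ u v = circ v (act a u)"
    and circ_act: "circ v (act a u) = circ u (act a v)"
    and circ_cyclic: "act (circ u v) w = act (circ v w) u"
    and circ_cyclic': "act (circ v w) u = act (circ w u) v"


section \<open>Lie superalgebras and their enveloping algebras\<close>

text \<open>The degree \<open>0\<close> part of \<open>sl_part\<close> is the even part and the degree \<open>1\<close> part the odd one.
  The underlying space is their sum, which need not be the whole type, so that subalgebras are
  records over the same type.\<close>

record 'l lie_super =
  sl_part :: "bit \<Rightarrow> 'l set"
  sl_scale :: "complex \<Rightarrow> 'l \<Rightarrow> 'l"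
  sl_bracket :: "'l \<Rightarrow> 'l \<Rightarrow> 'l"

definition sl_carrier :: "'l::ab_group_add lie_super \<Rightarrow> 'l set"
  where "sl_carrier L = {x + y |x y. x \<in> sl_part L 0 \<and> y \<in> sl_part L 1}"

definition koszul_sign :: "bit \<Rightarrow> bit \<Rightarrow> complex"
  where "koszul_sign \<alpha> \<beta> = (if \<alpha> * \<beta> = 1 then - 1 else 1)"

text \<open>With concatenation as addition of exponents, \<open>'l list \<Rightarrow>\<^sub>0 complex\<close> is the free associative
  unital algebra on \<open>'l\<close>. The tensor algebra of a space is the quotient of the free algebra on
  its elements by the linearity relations, the first two families in
  \<open>enveloping_relations\<close>.\<close>

instantiation list :: (type) monoid_add
begin
definition zero_list :: "'a list" where "zero_list = []"
definition plus_list :: "'a list \<Rightarrow> 'a list \<Rightarrow> 'a list" where "plus_list = (@)"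
instance by standard (simp_all add: zero_list_def plus_list_def)
end

definition free_algebra :: "'l set \<Rightarrow> ('l list \<Rightarrow>\<^sub>0 complex) ring"
  where "free_algebra S =
    \<lparr>carrier = {p. \<forall>w\<in>Poly_Mapping.keys p. set w \<subseteq> S},
     monoid.mult = (*), one = 1, ring.zero = 0, add = (+)\<rparr>"

abbreviation mono :: "'l list \<Rightarrow> complex \<Rightarrow> ('l list \<Rightarrow>\<^sub>0 complex)"
  where "mono \<equiv> Poly_Mapping.single"

definition enveloping_relations :: "'l::ab_group_add lie_super \<Rightarrow> ('l list \<Rightarrow>\<^sub>0 complex) set"
  where "enveloping_relations L =
    {mono [x + y] 1 - mono [x] 1 - mono [y] 1 |x y. x \<in> sl_carrier L \<and> y \<in> sl_carrier L} \<union>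
    {mono [sl_scale L c x] 1 - mono [x] c |c x. x \<in> sl_carrier L} \<union>
    {mono [x, y] 1 - mono [y, x] (koszul_sign \<alpha> \<beta>) - mono [sl_bracket L x y] 1 |\<alpha> \<beta> x y.
       x \<in> sl_part L \<alpha> \<and> y \<in> sl_part L \<beta>}"

definition enveloping_ideal :: "'l::ab_group_add lie_super \<Rightarrow> ('l list \<Rightarrow>\<^sub>0 complex) set"
  where "enveloping_ideal L =
    Idl\<^bsub>free_algebra (sl_carrier L)\<^esub> (enveloping_relations L)"

type_synonym 'l env = "('l list \<Rightarrow>\<^sub>0 complex) set"

definition enveloping_algebra :: "'l::ab_group_add lie_super \<Rightarrow> 'l env ring"
  where "enveloping_algebra L = free_algebra (sl_carrier L) Quot enveloping_ideal L"

definition env_class :: "'l::ab_group_add lie_super \<Rightarrow> ('l list \<Rightarrow>\<^sub>0 complex) \<Rightarrow> 'l env"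
  where "env_class L p = enveloping_ideal L +>\<^bsub>free_algebra (sl_carrier L)\<^esub> p"

text \<open>For a subalgebra \<open>P\<close> of \<open>L\<close>, the canonical map \<open>U(P) \<rightarrow> U(L)\<close> sends a coset of the ideal of
  \<open>P\<close> to the coset of the ideal of \<open>L\<close> that contains it.\<close>

definition env_map :: "'l::ab_group_add lie_super \<Rightarrow> 'l env \<Rightarrow> 'l env"
  where "env_map L X = enveloping_ideal L <+>\<^bsub>free_algebra (sl_carrier L)\<^esub> X"

text \<open>The action of the enveloping algebra on the space \<open>complex\<close> that extends an action \<open>\<rho>\<close> of the
  Lie superalgebra. The set in \<open>env_act\<close> is a singleton because \<open>\<rho>\<close> respects the enveloping
  relations.\<close>

definition word_act :: "('l \<Rightarrow> complex \<Rightarrow> complex) \<Rightarrow> ('l list \<Rightarrow>\<^sub>0 complex) \<Rightarrow> complex \<Rightarrow> complex"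
  where "word_act \<rho> p z = (\<Sum>w\<in>Poly_Mapping.keys p. Poly_Mapping.lookup p w * foldr \<rho> w z)"

definition env_act :: "('l \<Rightarrow> complex \<Rightarrow> complex) \<Rightarrow> 'l env \<Rightarrow> complex \<Rightarrow> complex"
  where "env_act \<rho> X z = the_elem ((\<lambda>p. word_act \<rho> p z) ` X)"


section \<open>Tensor products over a ring and induced modules\<close>

definition complex_ring :: "complex ring"
  where "complex_ring = \<lparr>carrier = UNIV, monoid.mult = (*), one = 1, ring.zero = 0, add = (+)\<rparr>"

text \<open>\<open>M \<otimes>\<^bsub>R\<^esub> N\<close> for a right module \<open>M\<close> with action \<open>ma\<close> and a left module \<open>N\<close> with action \<open>na\<close>, as
  a quotient of the free abelian group on \<open>M \<times> N\<close>; of the records \<open>M\<close> and \<open>N\<close> only the additive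
  groups are used.\<close>

definition tensor_relations ::
  "('r, 'c) ring_scheme \<Rightarrow> ('m, 'd) ring_scheme \<Rightarrow> ('m \<Rightarrow> 'r \<Rightarrow> 'm) \<Rightarrow>
   ('n, 'e) ring_scheme \<Rightarrow> ('r \<Rightarrow> 'n \<Rightarrow> 'n) \<Rightarrow> ('m \<times> 'n \<Rightarrow>\<^sub>0 int) set"
  where "tensor_relations R M ma N na =
    {frag_of (x \<oplus>\<^bsub>M\<^esub> y, z) - frag_of (x, z) - frag_of (y, z) |x y z.
       x \<in> carrier M \<and> y \<in> carrier M \<and> z \<in> carrier N} \<union>
    {frag_of (x, y \<oplus>\<^bsub>N\<^esub> z) - frag_of (x, y) - frag_of (x, z) |x y z.
       x \<in> carrier M \<and> y \<in> carrier N \<and> z \<in> carrier N} \<union>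
    {frag_of (ma x r, z) - frag_of (x, na r z) |x r z.
       x \<in> carrier M \<and> r \<in> carrier R \<and> z \<in> carrier N}"

definition tensor_subgroup ::
  "('r, 'c) ring_scheme \<Rightarrow> ('m, 'd) ring_scheme \<Rightarrow> ('m \<Rightarrow> 'r \<Rightarrow> 'm) \<Rightarrow>
   ('n, 'e) ring_scheme \<Rightarrow> ('r \<Rightarrow> 'n \<Rightarrow> 'n) \<Rightarrow> ('m \<times> 'n \<Rightarrow>\<^sub>0 int) set"
  where "tensor_subgroup R M ma N na =
    generate (free_Abelian_group (carrier M \<times> carrier N)) (tensor_relations R M ma N na)"

definition tensor_product ::
  "('r, 'c) ring_scheme \<Rightarrow> ('m, 'd) ring_scheme \<Rightarrow> ('m \<Rightarrow> 'r \<Rightarrow> 'm) \<Rightarrow>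
   ('n, 'e) ring_scheme \<Rightarrow> ('r \<Rightarrow> 'n \<Rightarrow> 'n) \<Rightarrow> ('m \<times> 'n \<Rightarrow>\<^sub>0 int) set monoid"
  where "tensor_product R M ma N na =
    free_Abelian_group (carrier M \<times> carrier N) Mod tensor_subgroup R M ma N na"

text \<open>The module \<open>U(L) \<otimes>\<^bsub>U(P)\<^esub> \<complex>\<close> induced from the action \<open>\<rho>\<close> of the subalgebra \<open>P\<close> on \<open>\<complex>\<close>.\<close>

type_synonym 'l ind = "('l env \<times> complex \<Rightarrow>\<^sub>0 int) set"

definition induced_subgroup ::
  "'l::ab_group_add lie_super \<Rightarrow> 'l lie_super \<Rightarrow> ('l \<Rightarrow> complex \<Rightarrow> complex) \<Rightarrow> 'l ind"
  where "induced_subgroup L P \<rho> =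
    tensor_subgroup (enveloping_algebra P)
      (enveloping_algebra L) (\<lambda>x r. x \<otimes>\<^bsub>enveloping_algebra L\<^esub> env_map L r)
      complex_ring (env_act \<rho>)"

definition induced_group ::
  "'l::ab_group_add lie_super \<Rightarrow> 'l lie_super \<Rightarrow> ('l \<Rightarrow> complex \<Rightarrow> complex) \<Rightarrow> 'l ind monoid"
  where "induced_group L P \<rho> =
    tensor_product (enveloping_algebra P)
      (enveloping_algebra L) (\<lambda>x r. x \<otimes>\<^bsub>enveloping_algebra L\<^esub> env_map L r)
      complex_ring (env_act \<rho>)"

definition induced_tensor ::
  "'l::ab_group_add lie_super \<Rightarrow> 'l lie_super \<Rightarrow> ('l \<Rightarrow> complex \<Rightarrow> complex) \<Rightarrow>
   'l env \<Rightarrow> complex \<Rightarrow> 'l ind"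
  where "induced_tensor L P \<rho> x z =
    induced_subgroup L P \<rho>
      #>\<^bsub>free_Abelian_group (carrier (enveloping_algebra L) \<times> UNIV)\<^esub> frag_of (x, z)"

text \<open>The left action of \<open>U(L)\<close>, determined by \<open>b (x \<otimes> z) = bx \<otimes> z\<close>.\<close>

definition induced_env_act ::
  "'l::ab_group_add lie_super \<Rightarrow> 'l lie_super \<Rightarrow> ('l \<Rightarrow> complex \<Rightarrow> complex) \<Rightarrow>
   'l env \<Rightarrow> 'l ind \<Rightarrow> 'l ind"
  where "induced_env_act L P \<rho> b X =
    (\<Union>f\<in>X. induced_subgroup L P \<rho>
       #>\<^bsub>free_Abelian_group (carrier (enveloping_algebra L) \<times> UNIV)\<^esub>
         frag_extend (\<lambda>(x, z). frag_of (b \<otimes>\<^bsub>enveloping_algebra L\<^esub> x, z)) f)"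

text \<open>The fields \<open>mult\<close> and \<open>one\<close> of a \<open>module\<close> record play no role for a vector space.\<close>

definition induced_module ::
  "'l::ab_group_add lie_super \<Rightarrow> 'l lie_super \<Rightarrow> ('l \<Rightarrow> complex \<Rightarrow> complex) \<Rightarrow>
   (complex, 'l ind) module"
  where "induced_module L P \<rho> =
    \<lparr>carrier = carrier (induced_group L P \<rho>), monoid.mult = undefined, one = undefined,
     ring.zero = monoid.one (induced_group L P \<rho>), add = monoid.mult (induced_group L P \<rho>),
     smult = (\<lambda>c. induced_env_act L P \<rho> (env_class L (mono [] c)))\<rparr>"

definition induced_lie_act ::
  "'l::ab_group_add lie_super \<Rightarrow> 'l lie_super \<Rightarrow> ('l \<Rightarrow> complex \<Rightarrow> complex) \<Rightarrow>
   'l \<Rightarrow> 'l ind \<Rightarrow> 'l ind"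
  where "induced_lie_act L P \<rho> x = induced_env_act L P \<rho> (env_class L (mono [x] 1))"


section \<open>The Lie superalgebra \<open>\<L>(A, U)\<close>\<close>

text \<open>\<open>(f, g, c)\<close> stands for \<open>(\<Sum>n. f\<^sub>n \<otimes> t\<^sup>n) + (\<Sum>n. g\<^sub>n \<otimes> t\<^sup>n) + c K\<close>.\<close>

type_synonym ('a, 'u) laff = "(int \<Rightarrow>\<^sub>0 'a) \<times> (int \<Rightarrow>\<^sub>0 'u) \<times> complex"

definition mode :: "'a::zero \<Rightarrow> 'u::zero \<Rightarrow> int \<Rightarrow> ('a, 'u) laff"
  where "mode a u n = (Poly_Mapping.single n a, Poly_Mapping.single n u, 0)"

definition bi_sum ::
  "(int \<Rightarrow> int \<Rightarrow> 'x \<Rightarrow> 'y \<Rightarrow> 'z::comm_monoid_add) \<Rightarrow>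
   (int \<Rightarrow>\<^sub>0 'x::zero) \<Rightarrow> (int \<Rightarrow>\<^sub>0 'y::zero) \<Rightarrow> 'z"
  where "bi_sum h f g =
    (\<Sum>m\<in>Poly_Mapping.keys f. \<Sum>n\<in>Poly_Mapping.keys g.
       h m n (Poly_Mapping.lookup f m) (Poly_Mapping.lookup g n))"

text \<open>The bracket of an odd with an even element is given by super skew-symmetry,
  \<open>[u(n), a(m)] = - [a(m), u(n)]\<close>.\<close>

definition laff_bracket ::
  "(complex \<Rightarrow> 'a::comm_ring \<Rightarrow> 'a) \<Rightarrow> (complex \<Rightarrow> 'u::ab_group_add \<Rightarrow> 'u) \<Rightarrow>
   ('a \<Rightarrow> 'u \<Rightarrow> 'u) \<Rightarrow> ('a \<Rightarrow> 'a \<Rightarrow> complex) \<Rightarrow> ('u \<Rightarrow> 'u \<Rightarrow> complex) \<Rightarrow>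
   ('u \<Rightarrow> 'u \<Rightarrow> 'a) \<Rightarrow> ('a, 'u) laff \<Rightarrow> ('a, 'u) laff \<Rightarrow> ('a, 'u) laff"
  where "laff_bracket scaleA scaleU act formA formU circ = (\<lambda>(f, g, k) (f', g', k').
    let aa = (\<lambda>m n a b. Poly_Mapping.single (m + n - 1) (scaleA (of_int (m - n) / 2) (a * b)));
        au = (\<lambda>m n a u. Poly_Mapping.single (m + n - 1) (scaleU (of_int (m - 2 * n) / 4) (act a u)));
        uu = (\<lambda>m n u v. Poly_Mapping.single (m + n) (circ u v));
        aaK = (\<lambda>m n a b. if m + n - 2 = 0 then (of_int m gchoose 3) * formA a b else 0);
        uuK = (\<lambda>m n u v. if m + n - 1 = 0 then of_int (m * (m - 1)) / 2 * formU u v else 0)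
    in (bi_sum aa f f' + bi_sum uu g g',
        bi_sum au f g' - bi_sum au f' g,
        bi_sum aaK f f' + bi_sum uuK g g'))"

definition laff ::
  "(complex \<Rightarrow> 'a::comm_ring \<Rightarrow> 'a) \<Rightarrow> (complex \<Rightarrow> 'u::ab_group_add \<Rightarrow> 'u) \<Rightarrow>
   ('a \<Rightarrow> 'u \<Rightarrow> 'u) \<Rightarrow> ('a \<Rightarrow> 'a \<Rightarrow> complex) \<Rightarrow> ('u \<Rightarrow> 'u \<Rightarrow> complex) \<Rightarrow>
   ('u \<Rightarrow> 'u \<Rightarrow> 'a) \<Rightarrow> ('a, 'u) laff lie_super"
  where "laff scaleA scaleU act formA formU circ =
    \<lparr>sl_part = (\<lambda>\<alpha>. if \<alpha> = 0 then {(f, 0, k) |f k. True} else {(0, g, 0) |g. True}),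
     sl_scale = (\<lambda>c (f, g, k). (Poly_Mapping.map (scaleA c) f, Poly_Mapping.map (scaleU c) g, c * k)),
     sl_bracket = laff_bracket scaleA scaleU act formA formU circ\<rparr>"

definition laff_plus :: "('a::ab_group_add, 'u::ab_group_add) laff lie_super \<Rightarrow> ('a, 'u) laff lie_super"
  where "laff_plus L = L\<lparr>sl_part := (\<lambda>\<alpha>. sl_part L \<alpha> \<inter>
    {(f, g, k). Poly_Mapping.keys f \<subseteq> {0..} \<and> Poly_Mapping.keys g \<subseteq> {0..}})\<rparr>"

definition laff_deg :: "rat \<Rightarrow> ('a::zero, 'u::zero) laff set"
  where "laff_deg d =
    {(f, g, k). (\<forall>n\<in>Poly_Mapping.keys f. d = 1 - of_int n) \<and>
       (\<forall>n\<in>Poly_Mapping.keys g. d = 1 / 2 - of_int n) \<and> (k \<noteq> 0 \<longrightarrow> d = 0)}"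


section \<open>The module \<open>V(\<ell>, 0)\<close>\<close>

text \<open>Throughout, \<open>L\<close> is to be \<open>laff scaleA scaleU act formA formU circ\<close>.\<close>

definition level_act :: "complex \<Rightarrow> ('a, 'u) laff \<Rightarrow> complex \<Rightarrow> complex"
  where "level_act l = (\<lambda>(f, g, k) z. l * k * z)"

definition vac_module ::
  "('a::ab_group_add, 'u::ab_group_add) laff lie_super \<Rightarrow> complex \<Rightarrow>
   (complex, ('a, 'u) laff ind) module"
  where "vac_module L l = induced_module L (laff_plus L) (level_act l)"

definition vac_act ::
  "('a::ab_group_add, 'u::ab_group_add) laff lie_super \<Rightarrow> complex \<Rightarrow>
   ('a, 'u) laff \<Rightarrow> ('a, 'u) laff ind \<Rightarrow> ('a, 'u) laff ind"
  where "vac_act L l = induced_lie_act L (laff_plus L) (level_act l)"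

definition vac_one ::
  "('a::ab_group_add, 'u::ab_group_add) laff lie_super \<Rightarrow> complex \<Rightarrow> ('a, 'u) laff ind"
  where "vac_one L l =
    induced_tensor L (laff_plus L) (level_act l) \<one>\<^bsub>enveloping_algebra L\<^esub> 1"

definition module_span :: "(complex, 'v) module \<Rightarrow> 'v set \<Rightarrow> 'v set"
  where "module_span V S = (\<lambda>H. submodule H complex_ring V) hull S"

definition vac_deg ::
  "('a::ab_group_add, 'u::ab_group_add) laff lie_super \<Rightarrow> complex \<Rightarrow> rat \<Rightarrow> ('a, 'u) laff ind set"
  where "vac_deg L l d = module_span (vac_module L l)
    {foldr (vac_act L l) (map snd xs) (vac_one L l) |xs.
       (\<forall>(e, x)\<in>set xs. x \<in> sl_carrier L \<and> x \<in> laff_deg e) \<and> sum_list (map fst xs) = d}"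

definition vac_part ::
  "('a::ab_group_add, 'u::ab_group_add) laff lie_super \<Rightarrow> complex \<Rightarrow> bit \<Rightarrow> ('a, 'u) laff ind set"
  where "vac_part L l \<alpha> = module_span (vac_module L l)
    (\<Union>d\<in>(if \<alpha> = 0 then \<int> else {n + 1 / 2 |n. n \<in> \<int>}). vac_deg L l d)"

text \<open>The element \<open>v(-1) \<one>\<close> that \<open>v = (a, u)\<close> in \<open>A \<oplus> U\<close> is identified with.\<close>

definition vac_gen ::
  "('a::ab_group_add, 'u::ab_group_add) laff lie_super \<Rightarrow> complex \<Rightarrow> 'a \<Rightarrow> 'u \<Rightarrow> ('a, 'u) laff ind"
  where "vac_gen L l a u = vac_act L l (mode a u (- 1)) (vac_one L l)"


section \<open>Vertex superalgebras\<close>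

text \<open>The sum of a family with finite support, such as the sums over \<open>i \<ge> 0\<close> in the Jacobi
  identity, which are finite on every vector by the truncation axiom.\<close>

abbreviation nat_sum :: "(complex, 'v) module \<Rightarrow> (nat \<Rightarrow> 'v) \<Rightarrow> 'v"
  where "nat_sum V f \<equiv> gfinprod (add_monoid V) f UNIV"

text \<open>\<open>Y u n v\<close> is \<open>u\<^sub>n v\<close>; its values outside the carrier are irrelevant.\<close>

locale vertex_superalgebra = Module.module complex_ring V
  for V :: "(complex, 'v) module" (structure) +
  fixes part :: "bit \<Rightarrow> 'v set"
    and Y :: "'v \<Rightarrow> int \<Rightarrow> 'v \<Rightarrow> 'v"
    and vac :: 'v
  assumes part_submodule: "submodule (part \<alpha>) complex_ring V"
    and part_sum: "carrier V = part 0 <+>\<^bsub>V\<^esub> part 1"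
    and part_inter: "part 0 \<inter> part 1 = {\<zero>}"
    and Y_closed: "u \<in> carrier V \<Longrightarrow> v \<in> carrier V \<Longrightarrow> Y u n v \<in> carrier V"
    and Y_add_left: "u \<in> carrier V \<Longrightarrow> u' \<in> carrier V \<Longrightarrow> v \<in> carrier V \<Longrightarrow>
      Y (u \<oplus> u') n v = Y u n v \<oplus> Y u' n v"
    and Y_smult_left: "u \<in> carrier V \<Longrightarrow> v \<in> carrier V \<Longrightarrow> Y (c \<odot> u) n v = c \<odot> Y u n v"
    and Y_add_right: "u \<in> carrier V \<Longrightarrow> v \<in> carrier V \<Longrightarrow> v' \<in> carrier V \<Longrightarrow>
      Y u n (v \<oplus> v') = Y u n v \<oplus> Y u n v'"
    and Y_smult_right: "u \<in> carrier V \<Longrightarrow> v \<in> carrier V \<Longrightarrow> Y u n (c \<odot> v) = c \<odot> Y u n v"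
    and vac_even: "vac \<in> part 0"
    and Y_part: "u \<in> part \<alpha> \<Longrightarrow> v \<in> part \<beta> \<Longrightarrow> Y u n v \<in> part (\<alpha> + \<beta>)"
    and Y_truncation: "u \<in> carrier V \<Longrightarrow> v \<in> carrier V \<Longrightarrow> \<exists>N. \<forall>n\<ge>N. Y u n v = \<zero>"
    and Y_jacobi: "u \<in> part \<alpha> \<Longrightarrow> v \<in> part \<beta> \<Longrightarrow> w \<in> carrier V \<Longrightarrow>
      nat_sum V (\<lambda>i. ((- 1) ^ i * (of_int m gchoose i)) \<odot>
          (Y u (m + k - int i) (Y v (n + int i) w) \<ominus>
           (koszul_sign \<alpha> \<beta> * (- 1) powi m) \<odot> Y v (m + n - int i) (Y u (k + int i) w))) =
      nat_sum V (\<lambda>i. (of_int k gchoose i) \<odot> Y (Y u (m + int i) v) (n + k - int i) w)"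
    and Y_vac: "v \<in> carrier V \<Longrightarrow> Y vac n v = (if n = - 1 then v else \<zero>)"
    and Y_creation: "v \<in> carrier V \<Longrightarrow> Y v (- 1) vac = v"
    and Y_vacuum: "v \<in> carrier V \<Longrightarrow> n \<ge> 0 \<Longrightarrow> Y v n vac = \<zero>"

end

theory Submission
  imports Defs
begin

text \<open>
The module \<open>V\<close> is spanned by words in the operators \<open>a(n)\<close> and \<open>u(n)\<close> applied to the vacuum \<open>\<one>\<close>.
The brackets of \<open>\<L>(A, U)\<close> say that the supercommutator of two modes \<open>x(k)\<close>, \<open>y(n)\<close> is a polynomial
in \<open>k\<close> of degree at most three whose coefficients depend on \<open>k + n\<close> only. A polynomial of degree three
is annihilated by the fourth power of the difference operator that corresponds to multiplication by
\<open>x\<^sub>1 - x\<^sub>2\<close>, so the generating series of the modes are mutually local fields. Modes with \<open>n \<ge> 0\<close> kill the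
vacuum, and the derivation \<open>v \<otimes> t\<^sup>n \<mapsto> - n v \<otimes> t\<^sup>n\<^sup>-\<^sup>1\<close> of the bracket induces an operator \<open>T\<close> on \<open>V\<close> with
\<open>T \<one> = 0\<close> for which all these fields are translation covariant. The existence of the structure is then an
instance of the reconstruction theorem for vertex superalgebras, which is proved in the locale
\<open>generating_fields\<close>.

The reconstruction rests on three facts. The lemma \<open>dong\<close> shows that locality passes to the products
\<open>F\<^sub>(\<^sub>m\<^sub>) G\<close> of fields. The lemma \<open>good_eqI\<close> (Goddard) shows that a field that is local with the generating
fields and translation covariant is determined by the vector that it creates from the vacuum; so \<open>Y v\<close>
can be defined as the field that creates \<open>v\<close>, and \<open>Y (u\<^sub>m v) = (Y u)\<^sub>(\<^sub>m\<^sub>) (Y v)\<close> because both sides create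
the same vector. Finally \<open>borcherds_identity\<close> is the Jacobi identity for two mutually local fields:
both of its sides satisfy the same recursion of Pascal type in \<open>k\<close>, agree for \<open>k = 0\<close> by definition and
vanish for large \<open>m\<close> by locality.

The other half of the work relates \<open>V\<close> as a tensor product over enveloping algebras to this setting.
Every vector has the form \<open>\<Psi> p = [p] \<otimes> 1\<close> with \<open>p\<close> in the free algebra on \<open>\<L>(A, U)\<close>, and the kernel of \<open>\<Psi>\<close>
is governed by a universal property, \<open>induced_universal\<close>: operators that satisfy the relations of
\<open>\<L>(A, U)\<close>, together with a vector on which \<open>\<L>(A, U)\<^sup>+\<close> acts as on \<open>\<complex>\<^sub>\<ell>\<close>, define a linear map on \<open>V\<close>. This
gives both \<open>T\<close> and the parity operator, whose eigenspaces are the even and the odd part. The space \<open>V\<close> is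
identified with the range of a linear projection of the free algebra along the kernel of \<open>\<Psi>\<close>, where sums
and scalar multiples are those of an honest vector space.

For the uniqueness, the Jacobi identity with \<open>k = 0\<close> expresses \<open>Y (x\<^sub>m v)\<close> for a generator \<open>x\<close> through the
modes of \<open>x\<close> and \<open>Y v\<close>, and \<open>V\<close> is generated from the vacuum by such modes.
\<close>

section \<open>Differences of coefficient families\<close>

text \<open>A family \<open>c k n\<close> stands for the formal series \<open>\<Sum> c k n x\<^sub>1\<^sup>-\<^sup>k\<^sup>-\<^sup>1 x\<^sub>2\<^sup>-\<^sup>n\<^sup>-\<^sup>1\<close>; on coefficients,
multiplication by \<open>x\<^sub>1 - x\<^sub>2\<close> is the following difference operator.\<close>

definition shift_diff :: "(int \<Rightarrow> int \<Rightarrow> 'v::ab_group_add) \<Rightarrow> int \<Rightarrow> int \<Rightarrow> 'v"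
  where "shift_diff c k n = c (k + 1) n - c k (n + 1)"

text \<open>The bound on the second index is uniform in the first one. This holds for \<open>F k (G n w)\<close> when \<open>G\<close> is a
field, and it makes the expansions below finite sums.\<close>

definition truncated :: "(int \<Rightarrow> int \<Rightarrow> 'v::zero) \<Rightarrow> bool"
  where "truncated c \<longleftrightarrow> (\<exists>N. \<forall>k. \<forall>n\<ge>N. c k n = 0)"

lemma shift_diff_funpow_image:
  assumes "\<And>x y. h (x - y) = h x - h y"
  shows "(shift_diff ^^ N) (\<lambda>k n. h (c k n)) = (\<lambda>k n. h ((shift_diff ^^ N) c k n))"
  by (induction N) (auto simp: shift_diff_def[abs_def] assms fun_eq_iff)

lemma shift_diff_funpow_add:
  "(shift_diff ^^ N) (\<lambda>k n. c k n + d k n) = (\<lambda>k n. (shift_diff ^^ N) c k n + (shift_diff ^^ N) d k n)"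
  by (induction N) (auto simp: shift_diff_def[abs_def] fun_eq_iff)

lemma shift_diff_funpow_zero: "(shift_diff ^^ N) (\<lambda>k n. 0) = (\<lambda>k n. 0)"
  by (induction N) (auto simp: shift_diff_def[abs_def] fun_eq_iff)

lemma shift_diff_funpow_mono:
  assumes "(shift_diff ^^ N) c = (\<lambda>k n. 0)" and "N \<le> M"
  shows "(shift_diff ^^ M) c = (\<lambda>k n. 0)"
proof -
  have "(shift_diff ^^ M) c = (shift_diff ^^ (M - N)) ((shift_diff ^^ N) c)"
    using assms(2) by (metis comp_apply funpow_add le_add_diff_inverse2)
  then show ?thesis by (simp add: assms(1) shift_diff_funpow_zero)
qed

lemma shift_diff_funpow_flip:
  "(shift_diff ^^ N) c = (\<lambda>k n. 0) \<Longrightarrow> (shift_diff ^^ N) (\<lambda>k n. c n k) = (\<lambda>k n. 0)"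
proof (induction N arbitrary: c)
  case 0
  then show ?case by (simp add: fun_eq_iff)
next
  case (Suc N)
  have "shift_diff (\<lambda>k n. c n k) = (\<lambda>k n. - shift_diff c n k)"
    by (simp add: fun_eq_iff shift_diff_def)
  then have "(shift_diff ^^ Suc N) (\<lambda>k n. c n k) = (shift_diff ^^ N) (\<lambda>k n. - shift_diff c n k)"
    by (simp add: funpow_swap1)
  also have "\<dots> = (\<lambda>k n. - (shift_diff ^^ N) (\<lambda>k n. shift_diff c n k) k n)"
    by (rule shift_diff_funpow_image) simp
  also have "\<dots> = (\<lambda>k n. 0)"
    using Suc.IH[of "shift_diff c"] Suc.prems by (simp add: funpow_swap1)
  finally show ?case .
qed

text \<open>A truncated solution of \<open>c (k + 1) n = c k (n + 1)\<close> is constant along antidiagonals, and every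
antidiagonal ends in the region where \<open>c\<close> vanishes.\<close>

lemma shift_diff_inject:
  assumes "(shift_diff ^^ N) c = (\<lambda>k n. 0)" and "truncated c"
  shows "c k n = 0"
  using assms
proof (induction N arbitrary: c k n)
  case 0
  then show ?case by (simp add: fun_eq_iff)
next
  case (Suc N)
  obtain B where B: "\<And>k n. n \<ge> B \<Longrightarrow> c k n = 0"
    using Suc.prems(2) by (auto simp: truncated_def)
  have "truncated (shift_diff c)"
    unfolding truncated_def shift_diff_def by (rule exI[of _ B]) (simp add: B)
  moreover have "(shift_diff ^^ N) (shift_diff c) = (\<lambda>k n. 0)"
    using Suc.prems(1) by (simp add: funpow_swap1)
  ultimately have step: "c (k + 1) n = c k (n + 1)" for k n
    using Suc.IH[of "shift_diff c" k n] unfolding shift_diff_def[of c k n] by simp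
  have "c (k - int j) (n + int j) = c k n" for j
  proof (induction j)
    case (Suc j)
    have "c (k - int (Suc j)) (n + int (Suc j)) = c (k - int j) (n + int j)"
      using step[of "k - int (Suc j)" "n + int j"] by (simp add: algebra_simps)
    then show ?case using Suc by simp
  qed simp
  from this[of "nat (B - n)"] B show ?case by (metis add.commute diff_add_cancel diff_ge_0_iff_ge
      int_nat_eq linorder_le_cases add_0_right order_refl)
qed

text \<open>In three variables, multiplication by \<open>x\<^sub>1 - x\<^sub>3\<close> and by \<open>x\<^sub>2 - x\<^sub>3\<close>.\<close>

definition shift_diff13 :: "(int \<Rightarrow> int \<Rightarrow> int \<Rightarrow> 'v::ab_group_add) \<Rightarrow> int \<Rightarrow> int \<Rightarrow> int \<Rightarrow> 'v"
  where "shift_diff13 c k n p = c (k + 1) n p - c k n (p + 1)"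

definition shift_diff23 :: "(int \<Rightarrow> int \<Rightarrow> int \<Rightarrow> 'v::ab_group_add) \<Rightarrow> int \<Rightarrow> int \<Rightarrow> int \<Rightarrow> 'v"
  where "shift_diff23 c k n p = c k (n + 1) p - c k n (p + 1)"

lemma funpow_commute:
  assumes "\<And>x. f (g x) = g (f x)"
  shows "(f ^^ a) ((g ^^ b) x) = (g ^^ b) ((f ^^ a) x)"
proof -
  have 1: "f ((g ^^ b) x) = (g ^^ b) (f x)" for x by (induction b) (auto simp: assms)
  show ?thesis by (induction a) (auto simp: 1)
qed

lemma shift_diff_commute: "shift_diff13 (shift_diff23 c) = shift_diff23 (shift_diff13 c)"
  by (simp add: fun_eq_iff shift_diff13_def shift_diff23_def)

lemma shift_diff13_funpow:
  "(shift_diff13 ^^ N) c k n p = (shift_diff ^^ N) (\<lambda>k p. c k n p) k p"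
  by (induction N arbitrary: k p) (auto simp: shift_diff13_def shift_diff_def)

lemma shift_diff23_funpow:
  "(shift_diff23 ^^ N) c k = (shift_diff ^^ N) (c k)"
  by (induction N arbitrary: k) (auto simp: shift_diff23_def shift_diff_def fun_eq_iff)

lemma shift_diff23_funpow_add:
  "(shift_diff23 ^^ N) (\<lambda>k n p. c k n p + d k n p) =
    (\<lambda>k n p. (shift_diff23 ^^ N) c k n p + (shift_diff23 ^^ N) d k n p)"
  by (simp add: fun_eq_iff shift_diff23_funpow shift_diff_funpow_add)

lemma shift_diff13_funpow_add:
  "(shift_diff13 ^^ N) (\<lambda>k n p. c k n p + d k n p) =
    (\<lambda>k n p. (shift_diff13 ^^ N) c k n p + (shift_diff13 ^^ N) d k n p)"
  by (simp add: fun_eq_iff shift_diff13_funpow shift_diff_funpow_add)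

lemma shift_diff23_funpow_zero: "(shift_diff23 ^^ N) (\<lambda>k n p. 0) = (\<lambda>k n p. 0)"
  by (simp add: fun_eq_iff shift_diff23_funpow shift_diff_funpow_zero)

lemma shift_diff13_funpow_zero: "(shift_diff13 ^^ N) (\<lambda>k n p. 0) = (\<lambda>k n p. 0)"
  by (simp add: fun_eq_iff shift_diff13_funpow shift_diff_funpow_zero)

text \<open>This is the algebra behind Dong's lemma. The recursion says that \<open>E (m + 1)\<close> is \<open>x\<^sub>1 - x\<^sub>2\<close> times \<open>E m\<close>.
Once \<open>E (m + 1)\<close> has been annihilated by a power of \<open>x\<^sub>2 - x\<^sub>3\<close>, the identity
\<open>x\<^sub>1 - x\<^sub>3 = (x\<^sub>1 - x\<^sub>2) + (x\<^sub>2 - x\<^sub>3)\<close> makes \<open>x\<^sub>1 - x\<^sub>3\<close> and \<open>x\<^sub>2 - x\<^sub>3\<close> act in the same way on what is left of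
\<open>E m\<close>, so the relation \<open>both\<close> becomes one for \<open>x\<^sub>2 - x\<^sub>3\<close> alone.\<close>

lemma descending_elimination:
  fixes E :: "int \<Rightarrow> int \<Rightarrow> int \<Rightarrow> int \<Rightarrow> 'v::ab_group_add"
  assumes rec: "\<And>m k n p. E (m + 1) k n p = E m (k + 1) n p - E m k (n + 1) p"
    and top: "\<And>m. m \<ge> M0 \<Longrightarrow> E m = (\<lambda>k n p. 0)"
    and both: "\<And>m. (shift_diff13 ^^ N) ((shift_diff23 ^^ N) (E m)) = (\<lambda>k n p. 0)"
  shows "(shift_diff23 ^^ (j * (N + N))) (E (M0 - int j)) = (\<lambda>k n p. 0)"
proof (induction j)
  case 0
  then show ?case by (simp add: top)
next
  case (Suc j)
  define m where "m = M0 - int (Suc j)"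
  define e where "e = (shift_diff23 ^^ (j * (N + N))) (E m)"
  have m1: "m + 1 = M0 - int j" by (simp add: m_def)
  have "shift_diff13 (E m) = (\<lambda>k n p. shift_diff23 (E m) k n p + E (m + 1) k n p)"
    by (simp add: fun_eq_iff shift_diff13_def shift_diff23_def rec)
  then have "(shift_diff23 ^^ (j * (N + N))) (shift_diff13 (E m)) = shift_diff23 e"
    using Suc.IH by (simp add: shift_diff23_funpow_add m1 e_def funpow_swap1)
\<comment> \<open>what remains of \<open>E (m + 1)\<close> has been killed, so the two differences agree on \<open>e\<close>\<close>
  then have S: "shift_diff13 e = shift_diff23 e"
    using funpow_commute[of shift_diff13 shift_diff23 1 "j * (N + N)" "E m"]
    by (simp add: e_def shift_diff_commute)
  have S': "(shift_diff13 ^^ a) ((shift_diff23 ^^ b) e) = (shift_diff23 ^^ (a + b)) e" for a b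
  proof (induction a)
    case (Suc a)
    have "(shift_diff13 ^^ Suc a) ((shift_diff23 ^^ b) e) = shift_diff13 ((shift_diff23 ^^ (a + b)) e)"
      using Suc by simp
    also have "\<dots> = (shift_diff23 ^^ (a + b)) (shift_diff13 e)"
      using funpow_commute[of shift_diff13 shift_diff23 1 "a + b" e] by (simp add: shift_diff_commute)
    finally show ?case by (simp add: S funpow_swap1)
  qed simp
  have "(shift_diff23 ^^ (Suc j * (N + N))) (E m) = (shift_diff23 ^^ (N + N)) e"
    by (simp add: e_def funpow_add)
  also have "\<dots> = (shift_diff13 ^^ N) ((shift_diff23 ^^ N) e)"
    by (simp only: S')
  also have "(shift_diff23 ^^ N) e = (shift_diff23 ^^ (j * (N + N))) ((shift_diff23 ^^ N) (E m))"
    unfolding e_def by (rule funpow_commute) (rule refl)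
  also have "(shift_diff13 ^^ N) \<dots> = (shift_diff23 ^^ (j * (N + N))) ((shift_diff13 ^^ N) ((shift_diff23 ^^ N) (E m)))"
    by (rule funpow_commute) (rule shift_diff_commute)
  also have "\<dots> = (\<lambda>k n p. 0)" by (simp add: both shift_diff23_funpow_zero)
  finally show ?case by (simp add: m_def)
qed

section \<open>Binomial expansions\<close>

text \<open>Coefficients of \<open>T\<close> and of binomial series act on vectors, so the scalars are fixed to be complex;
the carrier is a whole type.\<close>

locale complex_space = vector_space scale
  for scale :: "complex \<Rightarrow> 'v::ab_group_add \<Rightarrow> 'v" (infixr "*s" 75)
begin

definition lin :: "('v \<Rightarrow> 'v) \<Rightarrow> bool"
  where "lin h \<longleftrightarrow> (\<forall>v w. h (v + w) = h v + h w) \<and> (\<forall>c v. h (c *s v) = c *s h v)"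

lemma linI: "(\<And>v w. h (v + w) = h v + h w) \<Longrightarrow> (\<And>c v. h (c *s v) = c *s h v) \<Longrightarrow> lin h"
  by (simp add: lin_def)

lemma lin_add: "lin h \<Longrightarrow> h (v + w) = h v + h w" and lin_scale: "lin h \<Longrightarrow> h (c *s v) = c *s h v"
  by (simp_all add: lin_def)

lemma lin_zero: "lin h \<Longrightarrow> h 0 = 0"
  using lin_scale[of h 0 0] by simp

lemma lin_diff: "lin h \<Longrightarrow> h (v - w) = h v - h w"
  by (metis add_diff_cancel_right' diff_add_cancel lin_add)

lemma lin_sum: "lin h \<Longrightarrow> h (sum f S) = (\<Sum>i\<in>S. h (f i))"
  by (induction S rule: infinite_finite_induct) (auto simp: lin_zero lin_add)


text \<open>The coefficients of \<open>(x\<^sub>1 - x\<^sub>2)\<^sup>m c(x\<^sub>1, x\<^sub>2)\<close>, with the power expanded in nonnegative powers of \<open>x\<^sub>2\<close>;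
for negative \<open>m\<close> the sum is finite only if \<open>c\<close> is truncated.\<close>

definition binomial_expansion :: "int \<Rightarrow> (int \<Rightarrow> int \<Rightarrow> 'v) \<Rightarrow> int \<Rightarrow> int \<Rightarrow> 'v"
  where "binomial_expansion m c k n =
    Sum_any (\<lambda>i. ((- 1) ^ i * (of_int m gchoose i)) *s c (m + k - int i) (n + int i))"

lemma binomial_expansion_eq_sum:
  assumes "\<And>k n. n \<ge> N \<Longrightarrow> c k n = 0" and "N \<le> n + int M"
  shows "binomial_expansion m c k n =
    (\<Sum>i<M. ((- 1) ^ i * (of_int m gchoose i)) *s c (m + k - int i) (n + int i))"
  unfolding binomial_expansion_def
proof (rule Sum_any.expand_superset)
  have "\<not> i < M \<Longrightarrow> c (m + k - int i) (n + int i) = 0" for i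
    by (rule assms(1)) (use assms(2) in linarith)
  then show "{i. ((- 1) ^ i * (of_int m gchoose i)) *s c (m + k - int i) (n + int i) \<noteq> 0} \<subseteq> {..<M}"
    by (auto simp del: scale_eq_0_iff) (metis scale_zero_right)
qed simp

lemma truncated_finite:
  assumes "truncated c"
  shows "finite {i. a i *s c (k - int i) (n + int i) \<noteq> 0}"
proof -
  obtain N where N: "\<And>k n. n \<ge> N \<Longrightarrow> c k n = 0" using assms by (auto simp: truncated_def)
  have "{i. a i *s c (k - int i) (n + int i) \<noteq> 0} \<subseteq> {..<nat (N - n)}"
  proof (rule subsetI, simp, elim conjE)
    fix i assume "c (k - int i) (n + int i) \<noteq> 0"
    then have "\<not> n + int i \<ge> N" using N by blast
    then show "i < nat (N - n)" by linarith
  qed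
  then show ?thesis by (rule finite_subset) simp
qed

lemma binomial_expansion_add:
  assumes "truncated c" "truncated d"
  shows "binomial_expansion m (\<lambda>k n. c k n + d k n) k n = binomial_expansion m c k n + binomial_expansion m d k n"
  unfolding binomial_expansion_def scale_right_distrib
  by (rule Sum_any.distrib) (rule truncated_finite; fact)+

lemma binomial_expansion_image:
  assumes "truncated c" "lin h"
  shows "binomial_expansion m (\<lambda>k n. h (c k n)) k n = h (binomial_expansion m c k n)"
proof -
  obtain N where N: "\<And>k n. n \<ge> N \<Longrightarrow> c k n = 0" using assms by (auto simp: truncated_def)
  have M: "N \<le> n + int (nat (N - n))" by simp
  show ?thesis
    apply (subst binomial_expansion_eq_sum[OF N M], assumption)
    apply (subst binomial_expansion_eq_sum[OF _ M, of "\<lambda>k n. h (c k n)"])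
    using assms(2) by (auto simp: N lin_zero lin_sum lin_scale)
qed

lemma lin_scaling: "lin ((*s) a)"
  by (rule linI) (simp_all add: scale_right_distrib mult.commute)

lemma truncated_add:
  fixes c d :: "int \<Rightarrow> int \<Rightarrow> 'v"
  shows "truncated c \<Longrightarrow> truncated d \<Longrightarrow> truncated (\<lambda>k n. c k n + d k n)"
  unfolding truncated_def
proof (elim exE)
  fix M N assume "\<forall>k. \<forall>n\<ge>M. c k n = 0" "\<forall>k. \<forall>n\<ge>N. d k n = 0"
  then show "\<exists>N. \<forall>k. \<forall>n\<ge>N. c k n + d k n = 0" by (intro exI[of _ "max M N"]) auto
qed

lemma truncated_image: "truncated c \<Longrightarrow> h 0 = 0 \<Longrightarrow> truncated (\<lambda>k n. h (c k n))"
  unfolding truncated_def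
proof (elim exE)
  fix N assume "h 0 = 0" "\<forall>k. \<forall>n\<ge>N. c k n = 0"
  then show "\<exists>N. \<forall>k. \<forall>n\<ge>N. h (c k n) = 0" by (intro exI[of _ N]) auto
qed

lemma binomial_expansion_diff:
  assumes "truncated c" "truncated d"
  shows "binomial_expansion m (\<lambda>k n. c k n - d k n) k n = binomial_expansion m c k n - binomial_expansion m d k n"
proof -
  have l: "lin (uminus :: 'v \<Rightarrow> 'v)" by (rule linI) auto
  have "truncated (\<lambda>k n. - d k n)" using assms(2) by (rule truncated_image) simp
  then show ?thesis
    using binomial_expansion_add[OF assms(1), of "\<lambda>k n. - d k n" m k n]
      binomial_expansion_image[OF assms(2) l, of m k n] by simp
qed

text \<open>Pascal's rule, that is \<open>(x\<^sub>1 - x\<^sub>2)\<^sup>m\<^sup>+\<^sup>1 = (x\<^sub>1 - x\<^sub>2) (x\<^sub>1 - x\<^sub>2)\<^sup>m\<close>.\<close>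

lemma binomial_expansion_Suc:
  assumes "truncated c"
  shows "binomial_expansion (m + 1) c k n = shift_diff (binomial_expansion m c) k n"
proof -
  obtain N where N: "\<And>k n. n \<ge> N \<Longrightarrow> c k n = 0" using assms by (auto simp: truncated_def)
  define M where "M = nat (N - n)"
  have M: "N \<le> n + int (Suc M)" "N \<le> n + 1 + int M" "N \<le> n + int M" by (auto simp: M_def)
  have pascal: "((- 1) ^ Suc i * (complex_of_int (m + 1) gchoose Suc i)) *s v =
      ((- 1) ^ Suc i * (of_int m gchoose Suc i)) *s v - ((- 1) ^ i * (of_int m gchoose i)) *s v" for i v
    by (simp add: gbinomial_Suc_Suc flip: scale_left_diff_distrib) (simp add: algebra_simps)
  have "binomial_expansion (m + 1) c k n =
    (\<Sum>i<Suc M. ((- 1) ^ i * (of_int (m + 1) gchoose i)) *s c (m + 1 + k - int i) (n + int i))"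
    by (rule binomial_expansion_eq_sum[OF N M(1)])
  also have "\<dots> = c (m + 1 + k) n + (\<Sum>i<M. ((- 1) ^ Suc i * (of_int (m + 1) gchoose Suc i)) *s c (m + k - int i) (n + 1 + int i))"
    by (simp add: sum.lessThan_Suc_shift algebra_simps del: power_Suc sum.lessThan_Suc)
  also have "\<dots> = c (m + 1 + k) n + (\<Sum>i<M. ((- 1) ^ Suc i * (of_int m gchoose Suc i)) *s c (m + k - int i) (n + 1 + int i))
     - (\<Sum>i<M. ((- 1) ^ i * (of_int m gchoose i)) *s c (m + k - int i) (n + 1 + int i))"
    by (simp only: pascal sum_subtractf add_diff_eq)
  also have "\<dots> = (\<Sum>i<Suc M. ((- 1) ^ i * (of_int m gchoose i)) *s c (m + (k + 1) - int i) (n + int i))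
     - (\<Sum>i<M. ((- 1) ^ i * (of_int m gchoose i)) *s c (m + k - int i) (n + 1 + int i))"
    by (simp add: sum.lessThan_Suc_shift algebra_simps del: power_Suc sum.lessThan_Suc)
  also have "\<dots> = shift_diff (binomial_expansion m c) k n"
    by (simp only: shift_diff_def binomial_expansion_eq_sum[OF N M(1)] binomial_expansion_eq_sum[OF N M(2)])
  finally show ?thesis .
qed

text \<open>The operator \<open>\<partial>\<^sub>1 + \<partial>\<^sub>2\<close> kills \<open>(x\<^sub>1 - x\<^sub>2)\<^sup>m\<close> and therefore commutes with multiplication by it. On
coefficients this is the absorption identity for binomial coefficients.\<close>

lemma binomial_expansion_derivation:
  assumes "truncated c"
  shows "binomial_expansion m (\<lambda>k n. of_int k *s c (k - 1) n + of_int n *s c k (n - 1)) k n =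
    of_int k *s binomial_expansion m c (k - 1) n + of_int n *s binomial_expansion m c k (n - 1)"
proof -
  obtain N where N: "\<And>k n. n \<ge> N \<Longrightarrow> c k n = 0" using assms by (auto simp: truncated_def)
  define M where "M = nat (N - n)"
  define b where "b i = (- 1) ^ i * (complex_of_int m gchoose i)" for i :: nat
  have M: "N \<le> n + int (Suc M)" "N \<le> (n - 1) + int (Suc M)" "N + 1 \<le> n + int (Suc M)" by (auto simp: M_def)
  have N': "of_int k *s c (k - 1) n + of_int n *s c k (n - 1) = 0" if "n \<ge> N + 1" for k n
    using that by (simp add: N)
\<comment> \<open>absorption: \<open>(i + 1) (m choose i + 1) = (m - i) (m choose i)\<close>\<close>
  have bS: "b (Suc i) * of_nat (Suc i) = - (b i * (of_int m - of_nat i))" for i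
    using gbinomial_absorb_comp[of "complex_of_int m" i]
      gbinomial_absorption[of i "complex_of_int m"]
    by (simp add: b_def mult.commute)
  have "binomial_expansion m (\<lambda>k n. of_int k *s c (k - 1) n + of_int n *s c k (n - 1)) k n =
    (\<Sum>i<Suc M. b i *s (of_int (m + k - int i) *s c (m + k - int i - 1) (n + int i) +
      of_int (n + int i) *s c (m + k - int i) (n + int i - 1)))"
    unfolding b_def by (rule binomial_expansion_eq_sum[OF N' M(3)])
  also have "\<dots> = (\<Sum>i<Suc M. of_int k *s (b i *s c (m + (k - 1) - int i) (n + int i)) +
      of_int n *s (b i *s c (m + k - int i) (n - 1 + int i)) +
      ((b i * (of_int m - of_nat i)) *s c (m + (k - 1) - int i) (n + int i) +
       (b i * of_nat i) *s c (m + k - int i) (n - 1 + int i)))"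
    by (rule sum.cong) (auto simp: algebra_simps scale_left_distrib scale_left_diff_distrib)
  also have "\<dots> = of_int k *s (\<Sum>i<Suc M. b i *s c (m + (k - 1) - int i) (n + int i)) +
      of_int n *s (\<Sum>i<Suc M. b i *s c (m + k - int i) (n - 1 + int i)) +
      ((\<Sum>i<Suc M. (b i * (of_int m - of_nat i)) *s c (m + (k - 1) - int i) (n + int i)) +
       (\<Sum>i<Suc M. (b i * of_nat i) *s c (m + k - int i) (n - 1 + int i)))"
    by (simp only: sum.distrib scale_sum_right)
  also have "(\<Sum>i<Suc M. (b i * of_nat i) *s c (m + k - int i) (n - 1 + int i)) =
      (\<Sum>i<M. - (b i * (of_int m - of_nat i)) *s c (m + (k - 1) - int i) (n + int i))"
    by (simp add: sum.lessThan_Suc_shift bS del: of_nat_Suc sum.lessThan_Suc) (simp add: algebra_simps)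
  also have "(\<Sum>i<Suc M. (b i * (of_int m - of_nat i)) *s c (m + (k - 1) - int i) (n + int i)) =
      (\<Sum>i<M. (b i * (of_int m - of_nat i)) *s c (m + (k - 1) - int i) (n + int i))"
    using N[of "n + int M"] by (simp add: M_def)
  also have "(\<Sum>i<Suc M. b i *s c (m + (k - 1) - int i) (n + int i)) = binomial_expansion m c (k - 1) n"
    unfolding b_def by (rule binomial_expansion_eq_sum[OF N M(1), symmetric])
  also have "(\<Sum>i<Suc M. b i *s c (m + k - int i) (n - 1 + int i)) = binomial_expansion m c k (n - 1)"
    unfolding b_def by (rule binomial_expansion_eq_sum[OF N M(2), symmetric])
  finally show ?thesis by (simp add: sum_negf)
qed

section \<open>Fields, locality and the Borcherds identity\<close>

definition is_field :: "(int \<Rightarrow> 'v \<Rightarrow> 'v) \<Rightarrow> bool"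
  where "is_field F \<longleftrightarrow> (\<forall>n. lin (F n)) \<and> (\<forall>w. \<exists>N. \<forall>n\<ge>N. F n w = 0)"

abbreviation commutator ::
  "complex \<Rightarrow> (int \<Rightarrow> 'v \<Rightarrow> 'v) \<Rightarrow> (int \<Rightarrow> 'v \<Rightarrow> 'v) \<Rightarrow> 'v \<Rightarrow> int \<Rightarrow> int \<Rightarrow> 'v"
  where "commutator \<epsilon> F G w \<equiv> (\<lambda>k n. F k (G n w) - \<epsilon> *s G n (F k w))"

text \<open>The power \<open>N\<close> has to serve all vectors \<open>w\<close> at once: it is multiplied with the other fields before
the vector is known.\<close>

definition mutually_local :: "complex \<Rightarrow> (int \<Rightarrow> 'v \<Rightarrow> 'v) \<Rightarrow> (int \<Rightarrow> 'v \<Rightarrow> 'v) \<Rightarrow> bool"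
  where "mutually_local \<epsilon> F G \<longleftrightarrow>
    (\<exists>N. \<forall>w. (shift_diff ^^ N) (commutator \<epsilon> F G w) = (\<lambda>k n. 0))"

text \<open>The mode form of \<open>(x\<^sub>1 - x\<^sub>2)\<^sup>m F(x\<^sub>1) G(x\<^sub>2) - \<epsilon> (- x\<^sub>2 + x\<^sub>1)\<^sup>m G(x\<^sub>2) F(x\<^sub>1)\<close>, which is one side of the Jacobi
identity. In the second term the roles of the variables are exchanged, whence the sign \<open>(- 1)\<^sup>m\<close>.\<close>

definition borcherds ::
  "complex \<Rightarrow> int \<Rightarrow> (int \<Rightarrow> 'v \<Rightarrow> 'v) \<Rightarrow> (int \<Rightarrow> 'v \<Rightarrow> 'v) \<Rightarrow> int \<Rightarrow> int \<Rightarrow> 'v \<Rightarrow> 'v"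
  where "borcherds \<epsilon> m F G k n w = binomial_expansion m (\<lambda>k n. F k (G n w)) k n
    - (\<epsilon> * (- 1) powi m) *s binomial_expansion m (\<lambda>n k. G n (F k w)) n k"

text \<open>The product \<open>F\<^sub>(\<^sub>m\<^sub>) G\<close>, the residue in \<open>x\<^sub>1\<close> of the previous series.\<close>

definition nth_product ::
  "complex \<Rightarrow> int \<Rightarrow> (int \<Rightarrow> 'v \<Rightarrow> 'v) \<Rightarrow> (int \<Rightarrow> 'v \<Rightarrow> 'v) \<Rightarrow> int \<Rightarrow> 'v \<Rightarrow> 'v"
  where "nth_product \<epsilon> m F G n w = borcherds \<epsilon> m F G 0 n w"

lemma is_field_lin: "is_field F \<Longrightarrow> lin (F n)" by (simp add: is_field_def)

lemma lin_compose: "lin f \<Longrightarrow> lin g \<Longrightarrow> lin (\<lambda>w. f (g w))" by (simp add: lin_def)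

lemma lin_diff_fun: "lin f \<Longrightarrow> lin g \<Longrightarrow> lin (\<lambda>w. f w - g w)"
  by (simp add: lin_def scale_right_diff_distrib)

lemma lin_scale_fun: "lin f \<Longrightarrow> lin (\<lambda>w. a *s f w)"
  by (simp add: lin_def scale_right_distrib mult.commute)

lemma truncated_field: "is_field G \<Longrightarrow> (\<And>k. h k 0 = 0) \<Longrightarrow> truncated (\<lambda>k n. h k (G n w))"
  unfolding is_field_def truncated_def by metis

lemma truncated_composite: "is_field F \<Longrightarrow> is_field G \<Longrightarrow> truncated (\<lambda>k n. F k (G n w))"
  by (rule truncated_field) (auto simp: is_field_def lin_zero)

lemma borcherds_rec:
  assumes "is_field F" "is_field G"
  shows "borcherds \<epsilon> (m + 1) F G k n w = borcherds \<epsilon> m F G (k + 1) n w - borcherds \<epsilon> m F G k (n + 1) w"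
  by (simp add: borcherds_def binomial_expansion_Suc truncated_composite assms shift_diff_def
      power_int_add_1 scale_right_diff_distrib)

lemma binomial_expansion_0: "binomial_expansion 0 c k n = c k n"
proof -
  have *: "(0 gchoose i) = (if i = 0 then 1 else 0 :: complex)" for i by (cases i) auto
  have "binomial_expansion 0 c k n = (\<Sum>i\<in>{0}. ((- 1) ^ i * (of_int 0 gchoose i)) *s c (0 + k - int i) (n + int i))"
    unfolding binomial_expansion_def by (rule Sum_any.expand_superset) (auto simp: *)
  then show ?thesis by simp
qed

lemma borcherds_0: "borcherds \<epsilon> 0 F G k n w = F k (G n w) - \<epsilon> *s G n (F k w)"
  by (simp add: borcherds_def binomial_expansion_0)

lemma borcherds_nonneg:
  assumes "is_field F" "is_field G"
  shows "borcherds \<epsilon> (int j) F G k n w =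
    (shift_diff ^^ j) (commutator \<epsilon> F G w) k n"
proof (induction j arbitrary: k n)
  case (Suc j)
  then show ?case
    using borcherds_rec[OF assms, of \<epsilon> "int j"] by (simp add: add.commute shift_diff_def)
qed (simp add: borcherds_0)

text \<open>For \<open>m \<ge> 0\<close> both expansions are the same polynomial, so the series is \<open>(x\<^sub>1 - x\<^sub>2)\<^sup>m\<close> times the
supercommutator.\<close>

lemma mutually_local_borcherds:
  assumes "is_field F" "is_field G" "mutually_local \<epsilon> F G"
  obtains N where "\<And>m k n w. m \<ge> int N \<Longrightarrow> borcherds \<epsilon> m F G k n w = 0"
proof -
  obtain N where N: "\<And>w. (shift_diff ^^ N) (commutator \<epsilon> F G w) = (\<lambda>k n. 0)"
    using assms(3) by (auto simp: mutually_local_def)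
  show ?thesis
  proof (rule that[of N])
    fix m k n w assume "int N \<le> m"
    then obtain j where j: "m = int j" "N \<le> j" by (metis nat_int_comparison(3) nat_0_le of_nat_0_le_iff order_trans)
    show "borcherds \<epsilon> m F G k n w = 0"
      unfolding j borcherds_nonneg[OF assms(1,2)]
      by (simp add: shift_diff_funpow_mono[OF N j(2)])
  qed
qed

lemma Sum_any_pascal:
  fixes f :: "nat \<Rightarrow> 'v"
  assumes "\<And>i. i \<ge> M \<Longrightarrow> f i = 0"
  shows "Sum_any (\<lambda>i. ((a + 1) gchoose i) *s f i) =
    Sum_any (\<lambda>i. (a gchoose i) *s f i) + Sum_any (\<lambda>i. (a gchoose i) *s f (Suc i))"
proof -
  have 1: "Sum_any (\<lambda>i. (b gchoose i) *s f i) = (\<Sum>i<Suc M. (b gchoose i) *s f i)" for b :: complex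
    by (rule Sum_any.expand_superset) (auto, metis assms not_less_eq less_or_eq_imp_le linorder_not_less scale_zero_right)
  have 2: "Sum_any (\<lambda>i. (a gchoose i) *s f (Suc i)) = (\<Sum>i<M. (a gchoose i) *s f (Suc i))"
    by (rule Sum_any.expand_superset) (auto, metis assms le_SucI linorder_not_less)
  show ?thesis
    unfolding 1 2
    by (simp add: sum.lessThan_Suc_shift gbinomial_Suc_Suc scale_left_distrib sum.distrib del: sum.lessThan_Suc)
qed

text \<open>The difference \<open>D m k n\<close> of the two sides satisfies
\<open>D m (k + 1) n = D m k (n + 1) + D (m + 1) k n\<close> by Pascal's rule and vanishes at \<open>k = 0\<close>, which settles
\<open>k \<ge> 0\<close>. For negative \<open>k\<close> the same equation expresses \<open>D m k n\<close> by \<open>D (m + 1) k (n - 1)\<close>, and by locality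
\<open>D\<close> vanishes for large \<open>m\<close>.\<close>

theorem borcherds_identity:
  assumes "is_field F" "is_field G" "mutually_local \<epsilon> F G"
  shows "borcherds \<epsilon> m F G k n w =
    Sum_any (\<lambda>i. (of_int k gchoose i) *s nth_product \<epsilon> (m + int i) F G (n + k - int i) w)"
proof -
  obtain N where N: "\<And>m k n w. m \<ge> int N \<Longrightarrow> borcherds \<epsilon> m F G k n w = 0"
    using mutually_local_borcherds[OF assms] by blast
  define L where "L m k n = Sum_any (\<lambda>i. (of_int k gchoose i) *s nth_product \<epsilon> (m + int i) F G (n + k - int i) w)" for m k n
  define D where "D m k n = borcherds \<epsilon> m F G k n w - L m k n" for m k n
  have L_rec: "L m (k + 1) n = L m k (n + 1) + L (m + 1) k n" for m k n
  proof -
    have "L m (k + 1) n = Sum_any (\<lambda>i. ((of_int k + 1) gchoose i) *s nth_product \<epsilon> (m + int i) F G (n + 1 + k - int i) w)"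
      by (simp add: L_def algebra_simps)
    also have "\<dots> = L m k (n + 1) + Sum_any (\<lambda>i. (of_int k gchoose i) *s nth_product \<epsilon> (m + int (Suc i)) F G (n + 1 + k - int (Suc i)) w)"
      unfolding L_def
      by (rule Sum_any_pascal[of "nat (int N - m)"]) (auto simp: nth_product_def intro!: N)
    finally show ?thesis by (simp add: L_def algebra_simps)
  qed
  have D_rec: "D m (k + 1) n = D m k (n + 1) + D (m + 1) k n" for m k n
    by (simp only: D_def L_rec borcherds_rec[OF assms(1,2)]) (simp add: algebra_simps)
  have D_top: "D m k n = 0" if "m \<ge> int N" for m k n
  proof -
    have "nth_product \<epsilon> (m + int i) F G n' w = 0" for i n'
      unfolding nth_product_def by (rule N) (use that in simp)
    then show ?thesis using that by (simp add: D_def L_def N)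
  qed
  have D_0: "D m 0 n = 0" for m n
  proof -
    have *: "(0 gchoose i) = (if i = 0 then 1 else 0 :: complex)" for i by (cases i) auto
    have "L m 0 n = (\<Sum>i\<in>{0}. (of_int 0 gchoose i) *s nth_product \<epsilon> (m + int i) F G (n + 0 - int i) w)"
      unfolding L_def by (rule Sum_any.expand_superset) (auto simp: *)
    then show ?thesis by (simp add: D_def nth_product_def)
  qed
  have D_pos: "D m (int k) n = 0" for m k n
  proof (induction k arbitrary: m n)
    case (Suc k)
    then show ?case using D_rec[of m "int k" n] by (simp add: add.commute)
  qed (simp add: D_0)
  have D_neg: "D m (- int k) n = 0" for m k n
  proof (induction k arbitrary: m n)
    case (Suc k)
\<comment> \<open>the term with \<open>k\<close> in place of \<open>k + 1\<close> vanishes by the outer induction\<close>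
    have step: "D m (- int (Suc k)) n = - D (m + 1) (- int (Suc k)) (n - 1)" for m n
      using D_rec[of m "- int (Suc k)" "n - 1"] Suc[of m "n - 1"] by (simp add: eq_neg_iff_add_eq_0)
    have "D (int N - int j) (- int (Suc k)) n = 0" for j n
    proof (induction j arbitrary: n)
      case (Suc j)
      show ?case using step[of "int N - int (Suc j)" n] Suc[of "n - 1"] by (simp add: algebra_simps)
    qed (simp add: D_top)
    from this[of "nat (int N - m)" n] D_top[of m] show ?case by (cases "m \<ge> int N") auto
  qed (simp add: D_0)
  have "D m k n = 0" by (cases k rule: int_cases2) (simp_all add: D_pos D_neg)
  then show ?thesis by (simp add: D_def L_def)
qed

lemma binomial_expansion_lin:
  assumes "\<And>w. truncated (c w)" and "\<And>k n. lin (\<lambda>w. c w k n)"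
  shows "lin (\<lambda>w. binomial_expansion m (c w) k n)"
proof (rule linI)
  fix v w
  have "c (v + w) = (\<lambda>k n. c v k n + c w k n)" using lin_add[OF assms(2)] by (simp add: fun_eq_iff)
  then show "binomial_expansion m (c (v + w)) k n = binomial_expansion m (c v) k n + binomial_expansion m (c w) k n"
    by (simp add: binomial_expansion_add assms)
next
  fix a v
  have "c (a *s v) = (\<lambda>k n. a *s c v k n)" using lin_scale[OF assms(2)] by (simp add: fun_eq_iff)
  then show "binomial_expansion m (c (a *s v)) k n = a *s binomial_expansion m (c v) k n"
    by (simp add: binomial_expansion_image lin_scaling assms)
qed

lemma borcherds_lin:
  assumes "is_field F" "is_field G"
  shows "lin (borcherds \<epsilon> m F G k n)"
proof -
  have "lin (\<lambda>w. binomial_expansion m (\<lambda>k n. F k (G n w)) k n)"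
    by (rule binomial_expansion_lin[where c = "\<lambda>w k n. F k (G n w)"])
      (simp_all add: truncated_composite lin_compose is_field_lin assms)
  moreover have "lin (\<lambda>w. binomial_expansion m (\<lambda>n k. G n (F k w)) n k)"
    by (rule binomial_expansion_lin[where c = "\<lambda>w n k. G n (F k w)"])
      (simp_all add: truncated_composite lin_compose is_field_lin assms)
  ultimately show ?thesis
    unfolding borcherds_def[abs_def] by (intro lin_diff_fun lin_scale_fun)
qed

text \<open>Only finitely many \<open>F i w\<close> with \<open>i \<ge> 0\<close> are nonzero, so the truncation bounds of \<open>G\<close> on these vectors
have a common maximum.\<close>

lemma nth_product_field:
  assumes "is_field F" "is_field G"
  shows "is_field (nth_product \<epsilon> m F G)"
proof -
  have "\<exists>N. \<forall>n\<ge>N. nth_product \<epsilon> m F G n w = 0" for w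
  proof -
    obtain NG where NG: "\<And>n. n \<ge> NG \<Longrightarrow> G n w = 0" using assms(2) unfolding is_field_def by metis
    obtain NF where NF: "\<And>n. n \<ge> NF \<Longrightarrow> F n w = 0" using assms(1) unfolding is_field_def by metis
    have "\<forall>i. \<exists>B. \<forall>n\<ge>B. G n (F (int i) w) = 0" using assms(2) by (auto simp: is_field_def)
    then obtain B where B: "\<And>i n. n \<ge> B i \<Longrightarrow> G n (F (int i) w) = 0" by metis
    define M where "M = nat NF"
    define C where "C = Max (B ` {..M})"
    have C: "G n (F (int i) w) = 0" if "i \<le> M" "n \<ge> C" for i n
      by (rule B, rule order_trans[of _ C]) (use that in \<open>auto simp: C_def\<close>)
    have z: "G n 0 = 0" "F n 0 = 0" for n using assms lin_zero by (auto simp: is_field_def)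
    have "nth_product \<epsilon> m F G n w = 0" if n: "n \<ge> max NG (C + int M - m)" for n
    proof -
      have "binomial_expansion m (\<lambda>k n. F k (G n w)) 0 n = 0"
        unfolding binomial_expansion_def using n by (simp add: NG z)
      moreover have "G (m + n - int i) (F (int i) w) = 0" for i
      proof (cases "i \<le> M")
        case True
        moreover have "C \<le> m + n - int i" using n True by simp
        ultimately show ?thesis by (rule C)
      next
        case False
        then have "F (int i) w = 0" by (intro NF) (simp add: M_def)
        then show ?thesis by (simp add: z)
      qed
      ultimately show ?thesis
        by (simp add: nth_product_def borcherds_def) (simp add: binomial_expansion_def)
    qed
    then show ?thesis by blast
  qed
  moreover have "nth_product \<epsilon> m F G n = borcherds \<epsilon> m F G 0 n" for n
    by (simp add: fun_eq_iff nth_product_def)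
  ultimately show ?thesis by (simp add: is_field_def borcherds_lin[OF assms])
qed

lemma shift_diff_funpow_scale:
  "(shift_diff ^^ N) (\<lambda>k n. a *s c k n) = (\<lambda>k n. a *s (shift_diff ^^ N) c k n)"
  by (rule shift_diff_funpow_image) (rule scale_right_diff_distrib)

lemma mutually_local_sym:
  assumes "mutually_local \<epsilon> F G" "\<epsilon> * \<epsilon> = 1"
  shows "mutually_local \<epsilon> G F"
proof -
  obtain N where N: "\<And>w. (shift_diff ^^ N) (commutator \<epsilon> F G w) = (\<lambda>k n. 0)"
    using assms(1) by (auto simp: mutually_local_def)
  have "(shift_diff ^^ N) (commutator \<epsilon> G F w) = (\<lambda>k n. 0)" for w
  proof -
    have "(commutator \<epsilon> G F w) = (\<lambda>k n. (- \<epsilon>) *s (F n (G k w) - \<epsilon> *s G k (F n w)))"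
      using assms(2) by (simp add: fun_eq_iff scale_right_diff_distrib)
    then show ?thesis
      by (simp only: shift_diff_funpow_scale shift_diff_funpow_flip[OF N] scale_zero_right)
  qed
  then show ?thesis by (auto simp: mutually_local_def)
qed

lemma mutually_local_mono:
  assumes "mutually_local \<epsilon> F G"
  obtains N where "\<And>M w. M \<ge> N \<Longrightarrow> (shift_diff ^^ M) (commutator \<epsilon> F G w) = (\<lambda>k n. 0)"
  using assms unfolding mutually_local_def by (meson shift_diff_funpow_mono)

lemma mutually_local_add:
  assumes "mutually_local \<epsilon> F H" "mutually_local \<epsilon> G H" "is_field H"
  shows "mutually_local \<epsilon> (\<lambda>n w. F n w + G n w) H"
proof -
  obtain N where N: "\<And>M w. M \<ge> N \<Longrightarrow> (shift_diff ^^ M) (commutator \<epsilon> F H w) = (\<lambda>k n. 0)"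
    by (rule mutually_local_mono[OF assms(1)]) blast
  obtain N' where N': "\<And>M w. M \<ge> N' \<Longrightarrow> (shift_diff ^^ M) (commutator \<epsilon> G H w) = (\<lambda>k n. 0)"
    by (rule mutually_local_mono[OF assms(2)]) blast
  have "(\<lambda>k n. F k (H n w) + G k (H n w) - \<epsilon> *s H n (F k w + G k w)) =
    (\<lambda>k n. (F k (H n w) - \<epsilon> *s H n (F k w)) + (G k (H n w) - \<epsilon> *s H n (G k w)))" for w
    by (simp add: fun_eq_iff lin_add[OF is_field_lin[OF assms(3)]] scale_right_distrib)
  then have "(shift_diff ^^ (max N N')) (\<lambda>k n. F k (H n w) + G k (H n w) - \<epsilon> *s H n (F k w + G k w)) = (\<lambda>k n. 0)" for w
    by (simp add: shift_diff_funpow_add N N')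
  then show ?thesis unfolding mutually_local_def by blast
qed

lemma mutually_local_scale:
  assumes "mutually_local \<epsilon> F H" "is_field H"
  shows "mutually_local \<epsilon> (\<lambda>n w. a *s F n w) H"
proof -
  obtain N where N: "\<And>w. (shift_diff ^^ N) (commutator \<epsilon> F H w) = (\<lambda>k n. 0)"
    using assms(1) by (auto simp: mutually_local_def)
  have "(\<lambda>k n. a *s F k (H n w) - \<epsilon> *s H n (a *s F k w)) =
    (\<lambda>k n. a *s (F k (H n w) - \<epsilon> *s H n (F k w)))" for w
    by (simp add: fun_eq_iff lin_scale[OF is_field_lin[OF assms(2)]] scale_right_diff_distrib mult.commute)
  then have "(shift_diff ^^ N) (\<lambda>k n. a *s F k (H n w) - \<epsilon> *s H n (a *s F k w)) = (\<lambda>k n. 0)" for w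
    by (simp only: shift_diff_funpow_scale N scale_zero_right)
  then show ?thesis unfolding mutually_local_def by blast
qed

section \<open>Dong's lemma\<close>

lemma binomial_expansion_shift_diff13:
  assumes "\<And>p. truncated (\<lambda>k n. c k n p)"
  shows "shift_diff13 (\<lambda>k n p. binomial_expansion m (\<lambda>k n. c k n p) k n) =
    (\<lambda>k n p. binomial_expansion m (\<lambda>k n. shift_diff13 c k n p) k n)"
proof -
  have "truncated (\<lambda>k n. c (k + 1) n p)" for p
    using assms[of p] unfolding truncated_def by blast
  then show ?thesis
    by (simp add: fun_eq_iff shift_diff13_def binomial_expansion_diff assms)
       (simp add: binomial_expansion_def algebra_simps)
qed

lemma binomial_expansion_shift_diff23:
  assumes "\<And>p. truncated (\<lambda>k n. c k n p)"
  shows "shift_diff23 (\<lambda>k n p. binomial_expansion m (\<lambda>k n. c k n p) k n) =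
    (\<lambda>k n p. binomial_expansion m (\<lambda>k n. shift_diff23 c k n p) k n)"
proof -
  have "truncated (\<lambda>k n. c k (n + 1) p)" for p
  proof -
    obtain N where "\<forall>k. \<forall>n\<ge>N. c k n p = 0" using assms[of p] by (auto simp: truncated_def)
    then show ?thesis unfolding truncated_def by (intro exI[of _ N]) auto
  qed
  then show ?thesis
    by (simp add: fun_eq_iff shift_diff23_def binomial_expansion_diff assms)
       (simp add: binomial_expansion_def algebra_simps)
qed

lemma truncated_shift_diff13:
  fixes c :: "int \<Rightarrow> int \<Rightarrow> int \<Rightarrow> 'v"
  assumes "\<And>p. truncated (\<lambda>k n. c k n p)"
  shows "truncated (\<lambda>k n. shift_diff13 c k n p)"
proof -
  obtain N where N: "\<forall>k. \<forall>n\<ge>N. c k n p = 0" using assms[of p] by (auto simp: truncated_def)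
  obtain N' where N': "\<forall>k. \<forall>n\<ge>N'. c k n (p + 1) = 0" using assms[of "p + 1"] by (auto simp: truncated_def)
  show ?thesis unfolding truncated_def shift_diff13_def by (intro exI[of _ "max N N'"]) (use N N' in auto)
qed

lemma truncated_shift_diff23:
  fixes c :: "int \<Rightarrow> int \<Rightarrow> int \<Rightarrow> 'v"
  assumes "\<And>p. truncated (\<lambda>k n. c k n p)"
  shows "truncated (\<lambda>k n. shift_diff23 c k n p)"
proof -
  obtain N where N: "\<forall>k. \<forall>n\<ge>N. c k n p = 0" using assms[of p] by (auto simp: truncated_def)
  obtain N' where N': "\<forall>k. \<forall>n\<ge>N'. c k n (p + 1) = 0" using assms[of "p + 1"] by (auto simp: truncated_def)
  show ?thesis unfolding truncated_def shift_diff23_def by (intro exI[of _ "max N N'"]) (use N N' in auto)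
qed

text \<open>Multiplication by \<open>(x\<^sub>1 - x\<^sub>2)\<^sup>m\<close> commutes with multiplication by polynomials in \<open>x\<^sub>1 - x\<^sub>3\<close> and
\<open>x\<^sub>2 - x\<^sub>3\<close>.\<close>

lemma binomial_expansion_shift_diffs:
  fixes c :: "int \<Rightarrow> int \<Rightarrow> int \<Rightarrow> 'v"
  assumes "\<And>p. truncated (\<lambda>k n. c k n p)"
    and zero: "(shift_diff13 ^^ a) ((shift_diff23 ^^ b) c) = (\<lambda>k n p. 0)"
  shows "(shift_diff13 ^^ a) ((shift_diff23 ^^ b) (\<lambda>k n p. binomial_expansion m (\<lambda>k n. c k n p) k n)) = (\<lambda>k n p. 0)"
proof -
  have 23: "(\<forall>p. truncated (\<lambda>k n. (shift_diff23 ^^ b) c k n p)) \<and>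
    (shift_diff23 ^^ b) (\<lambda>k n p. binomial_expansion m (\<lambda>k n. c k n p) k n) =
      (\<lambda>k n p. binomial_expansion m (\<lambda>k n. (shift_diff23 ^^ b) c k n p) k n)" for b
    by (induction b) (auto simp: assms(1) truncated_shift_diff23 binomial_expansion_shift_diff23)
  define d where "d = (shift_diff23 ^^ b) c"
  have "\<And>p. truncated (\<lambda>k n. d k n p)" using 23 by (simp add: d_def)
  then have 13: "(\<forall>p. truncated (\<lambda>k n. (shift_diff13 ^^ a) d k n p)) \<and>
    (shift_diff13 ^^ a) (\<lambda>k n p. binomial_expansion m (\<lambda>k n. d k n p) k n) =
      (\<lambda>k n p. binomial_expansion m (\<lambda>k n. (shift_diff13 ^^ a) d k n p) k n)" for a
    by (induction a) (auto simp: truncated_shift_diff13 binomial_expansion_shift_diff13)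
  show ?thesis
    using 23[of b] 13[of a] zero by (simp add: d_def) (simp add: binomial_expansion_def)
qed

lemma shift_diff_funpow_exchange:
  "(shift_diff13 ^^ a) ((shift_diff23 ^^ b) (\<lambda>k n p. c n k p)) =
   (\<lambda>k n p. (shift_diff13 ^^ b) ((shift_diff23 ^^ a) c) n k p)"
proof -
  have 1: "shift_diff13 (\<lambda>k n p. c n k p) = (\<lambda>k n p. shift_diff23 c n k p)"
    "shift_diff23 (\<lambda>k n p. c n k p) = (\<lambda>k n p. shift_diff13 c n k p)" for c :: "int \<Rightarrow> int \<Rightarrow> int \<Rightarrow> 'a::ab_group_add"
    by (simp_all add: fun_eq_iff shift_diff13_def shift_diff23_def)
  have 2: "(shift_diff13 ^^ a) (\<lambda>k n p. c n k p) = (\<lambda>k n p. (shift_diff23 ^^ a) c n k p)"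
    for a and c :: "int \<Rightarrow> int \<Rightarrow> int \<Rightarrow> 'a::ab_group_add"
    by (induction a) (simp_all only: funpow.simps o_apply id_apply 1(1))
  have 3: "(shift_diff23 ^^ b) (\<lambda>k n p. c n k p) = (\<lambda>k n p. (shift_diff13 ^^ b) c n k p)"
    for b and c :: "int \<Rightarrow> int \<Rightarrow> int \<Rightarrow> 'a::ab_group_add"
    by (induction b) (simp_all only: funpow.simps o_apply id_apply 1(2))
  show ?thesis unfolding 3[of b c] 2[of a "(shift_diff13 ^^ b) c"]
    by (simp only: funpow_commute[of shift_diff13 shift_diff23, OF shift_diff_commute])
qed

text \<open>The third field is moved to the left past \<open>G\<close> at the cost of \<open>(x\<^sub>2 - x\<^sub>3)\<^sup>N'\<close> and then past \<open>F\<close> at the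
cost of \<open>(x\<^sub>1 - x\<^sub>3)\<^sup>N\<close>; \<open>c1\<close> and \<open>c2\<close> are the errors of the two moves.\<close>

lemma three_fields_vanishing:
  assumes "is_field F" "is_field G" "is_field H"
    and FH: "\<And>w. (shift_diff ^^ N) (commutator \<delta>1 F H w) = (\<lambda>k n. 0)"
    and GH: "\<And>w. (shift_diff ^^ N') (commutator \<delta>2 G H w) = (\<lambda>k n. 0)"
  shows "(shift_diff13 ^^ N) ((shift_diff23 ^^ N') (\<lambda>k n p. F k (G n (H p w)) - (\<delta>1 * \<delta>2) *s H p (F k (G n w)))) = (\<lambda>k n p. 0)"
proof -
  have lF: "lin (F n)" and lG: "lin (G n)" for n using assms is_field_lin by auto
  define c1 where "c1 k n p = F k (G n (H p w) - \<delta>2 *s H p (G n w))" for k n p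
  define c2 where "c2 k n p = \<delta>2 *s (F k (H p (G n w)) - \<delta>1 *s H p (F k (G n w)))" for k n p
  have "(shift_diff ^^ N') (c1 k) = (\<lambda>n p. F k ((shift_diff ^^ N') (\<lambda>n p. G n (H p w) - \<delta>2 *s H p (G n w)) n p))" for k
    unfolding c1_def[abs_def] by (rule shift_diff_funpow_image) (rule lin_diff[OF lF])
  then have "(shift_diff23 ^^ N') c1 = (\<lambda>k n p. 0)"
    by (simp only: fun_eq_iff shift_diff23_funpow GH lin_zero[OF lF] simp_thms)
  then have 1: "(shift_diff13 ^^ N) ((shift_diff23 ^^ N') c1) = (\<lambda>k n p. 0)"
    by (simp add: shift_diff13_funpow_zero)
  have "(shift_diff13 ^^ N) c2 = (\<lambda>k n p. 0)"
    unfolding fun_eq_iff shift_diff13_funpow c2_def[abs_def]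
    by (simp only: shift_diff_funpow_scale FH scale_zero_right simp_thms)
  then have 2: "(shift_diff13 ^^ N) ((shift_diff23 ^^ N') c2) = (\<lambda>k n p. 0)"
    by (subst funpow_commute) (simp_all add: shift_diff_commute shift_diff23_funpow_zero)
  have "(\<lambda>k n p. F k (G n (H p w)) - (\<delta>1 * \<delta>2) *s H p (F k (G n w))) = (\<lambda>k n p. c1 k n p + c2 k n p)"
    by (simp add: fun_eq_iff c1_def c2_def lin_diff[OF lF] lin_scale[OF lF] scale_right_diff_distrib mult.commute)
  then show ?thesis by (simp add: shift_diff23_funpow_add shift_diff13_funpow_add 1 2)
qed

text \<open>Let \<open>E m\<close> be the supercommutator of \<open>H(x\<^sub>3)\<close> with the series of \<open>borcherds\<close>. It is killed by
\<open>(x\<^sub>1 - x\<^sub>3)\<^sup>N (x\<^sub>2 - x\<^sub>3)\<^sup>N\<close> because \<open>H\<close> can be moved past \<open>F\<close> and \<open>G\<close>, and it vanishes for large \<open>m\<close> because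
\<open>F\<close> and \<open>G\<close> are local, so \<open>descending_elimination\<close> applies. Taking the residue in \<open>x\<^sub>1\<close> is putting
\<open>k = 0\<close>.\<close>

theorem dong:
  assumes F: "is_field F" and G: "is_field G" and H: "is_field H"
    and "mutually_local \<epsilon> F G" "mutually_local \<delta>1 F H" "mutually_local \<delta>2 G H"
  shows "mutually_local (\<delta>1 * \<delta>2) (nth_product \<epsilon> m F G) H"
proof -
  obtain M0 where M0: "\<And>m k n w. m \<ge> int M0 \<Longrightarrow> borcherds \<epsilon> m F G k n w = 0"
    using mutually_local_borcherds[OF F G assms(4)] by blast
  obtain N1 where N1: "\<And>M w. M \<ge> N1 \<Longrightarrow> (shift_diff ^^ M) (commutator \<delta>1 F H w) = (\<lambda>k n. 0)"
    by (rule mutually_local_mono[OF assms(5)]) blast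
  obtain N2 where N2: "\<And>M w. M \<ge> N2 \<Longrightarrow> (shift_diff ^^ M) (commutator \<delta>2 G H w) = (\<lambda>k n. 0)"
    by (rule mutually_local_mono[OF assms(6)]) blast
  define N where "N = max N1 N2"
  have lF: "lin (F n)" and lG: "lin (G n)" and lH: "lin (H n)" for n using assms is_field_lin by auto
  define \<delta> where "\<delta> = \<delta>1 * \<delta>2"
  define E where "E w m k n p = borcherds \<epsilon> m F G k n (H p w) - \<delta> *s H p (borcherds \<epsilon> m F G k n w)" for w m k n p
  have rec: "E w (m + 1) k n p = E w m (k + 1) n p - E w m k (n + 1) p" for w m k n p
    by (simp add: E_def borcherds_rec[OF F G] lin_diff[OF lH] scale_right_diff_distrib)
  have top: "E w m = (\<lambda>k n p. 0)" if "m \<ge> int M0" for w m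
    using that by (simp add: fun_eq_iff E_def M0 lin_zero[OF lH])
  have both: "(shift_diff13 ^^ N) ((shift_diff23 ^^ N) (E w m)) = (\<lambda>k n p. 0)" for w m
  proof -
    define c1 where "c1 k n p = F k (G n (H p w)) - \<delta> *s H p (F k (G n w))" for k n p
    define c2 where "c2 n k p = G n (F k (H p w)) - \<delta> *s H p (G n (F k w))" for k n p
    have t: "truncated (\<lambda>k n. F k (G n u))" "truncated (\<lambda>n k. G n (F k u))" for u
      using F G by (auto intro: truncated_composite)
    have t': "truncated (\<lambda>k n. - (\<delta> *s H p (F k (G n u))))" "truncated (\<lambda>n k. - (\<delta> *s H p (G n (F k u))))" for u p
      by (rule truncated_image[OF t(1)] truncated_image[OF t(2)], simp add: lin_zero[OF lH])+
    have t1: "truncated (\<lambda>k n. c1 k n p)" and t2: "truncated (\<lambda>n k. c2 n k p)" for p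
      using truncated_add[OF t(1)[of "H p w"] t'(1)[of p w]] truncated_add[OF t(2)[of "H p w"] t'(2)[of p w]]
      by (simp_all add: c1_def c2_def)
    have hl: "lin (\<lambda>v. \<delta> *s H p v)" for p by (rule lin_scale_fun[OF lH])
    have e1: "binomial_expansion m (\<lambda>k n. c1 k n p) k n = binomial_expansion m (\<lambda>k n. F k (G n (H p w))) k n
       - \<delta> *s H p (binomial_expansion m (\<lambda>k n. F k (G n w)) k n)" for k n p
      unfolding c1_def
      by (subst binomial_expansion_diff[OF t(1) truncated_image[OF t(1)]])
         (simp_all add: lin_zero[OF lH] binomial_expansion_image[OF t(1) hl])
    have e2: "binomial_expansion m (\<lambda>n k. c2 n k p) n k = binomial_expansion m (\<lambda>n k. G n (F k (H p w))) n k
       - \<delta> *s H p (binomial_expansion m (\<lambda>n k. G n (F k w)) n k)" for k n p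
      unfolding c2_def
      by (subst binomial_expansion_diff[OF t(2) truncated_image[OF t(2)]])
         (simp_all add: lin_zero[OF lH] binomial_expansion_image[OF t(2) hl])
    define e where "e = - (\<epsilon> * (- 1) powi m)"
    have E: "E w m = (\<lambda>k n p. binomial_expansion m (\<lambda>k n. c1 k n p) k n + e *s binomial_expansion m (\<lambda>n k. c2 n k p) n k)"
      by (simp add: fun_eq_iff E_def borcherds_def e1 e2 e_def lin_diff[OF lH] lin_scale[OF lH]
          scale_right_diff_distrib mult.commute[of \<delta>])
    have 1: "(shift_diff13 ^^ N) ((shift_diff23 ^^ N) (\<lambda>k n p. binomial_expansion m (\<lambda>k n. c1 k n p) k n)) = (\<lambda>k n p. 0)"
      by (rule binomial_expansion_shift_diffs[OF t1])
         (unfold c1_def[abs_def] \<delta>_def, rule three_fields_vanishing[OF F G H N1 N2], simp_all add: N_def)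
    have 2: "(shift_diff13 ^^ N) ((shift_diff23 ^^ N) (\<lambda>k n p. binomial_expansion m (\<lambda>k n. c2 k n p) k n)) = (\<lambda>k n p. 0)"
      by (rule binomial_expansion_shift_diffs[OF t2])
         (unfold c2_def[abs_def] \<delta>_def mult.commute[of \<delta>1], rule three_fields_vanishing[OF G F H N2 N1], simp_all add: N_def)
    have 3: "(shift_diff13 ^^ N) ((shift_diff23 ^^ N) (\<lambda>k n p. e *s c n k p)) = (\<lambda>k n p. 0)"
      if "(shift_diff13 ^^ N) ((shift_diff23 ^^ N) c) = (\<lambda>k n p. 0)" for c :: "int \<Rightarrow> int \<Rightarrow> int \<Rightarrow> 'v"
    proof -
      have s1: "(shift_diff13 ^^ N) (\<lambda>k n p. e *s c k n p) = (\<lambda>k n p. e *s (shift_diff13 ^^ N) c k n p)"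
        and s2: "(shift_diff23 ^^ N) (\<lambda>k n p. e *s c k n p) = (\<lambda>k n p. e *s (shift_diff23 ^^ N) c k n p)"
        for N and c :: "int \<Rightarrow> int \<Rightarrow> int \<Rightarrow> 'v"
        by (simp_all add: fun_eq_iff shift_diff13_funpow shift_diff23_funpow
            shift_diff_funpow_scale)
      show ?thesis
        by (subst shift_diff_funpow_exchange) (simp add: s1 s2 that)
    qed
    show ?thesis unfolding E shift_diff23_funpow_add shift_diff13_funpow_add 1
      using 3[OF 2] by simp
  qed
  define j where "j = nat (int M0 - m)"
  have van: "(shift_diff23 ^^ (j * (N + N))) (E w m) = (\<lambda>k n p. 0)" for w
  proof (cases "m \<ge> int M0")
    case True
    then show ?thesis by (simp add: top shift_diff23_funpow_zero)
  next
    case False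
    then have m: "m = int M0 - int j" by (simp add: j_def)
    show ?thesis unfolding m by (rule descending_elimination[where E = "E w"]) (rule rec, erule top, rule both)
  qed
  have "(shift_diff ^^ (j * (N + N))) (\<lambda>n p. nth_product \<epsilon> m F G n (H p w) - (\<delta>1 * \<delta>2) *s H p (nth_product \<epsilon> m F G n w)) = (\<lambda>k n. 0)" for w
    using fun_cong[OF van[of w], of 0] unfolding shift_diff23_funpow
    by (simp add: E_def[abs_def] nth_product_def \<delta>_def)
  then show ?thesis unfolding mutually_local_def by blast
qed

end

section \<open>Reconstruction from generating fields\<close>

text \<open>This rule would replace sums of parities by Boolean expressions.\<close>

declare add_bit_eq_xor [simp del]

lemma koszul_sign_square: "koszul_sign \<alpha> \<beta> * koszul_sign \<alpha> \<beta> = 1"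
  by (simp add: koszul_sign_def)

lemma koszul_sign_sym: "koszul_sign \<alpha> \<beta> = koszul_sign \<beta> \<alpha>"
  by (simp add: koszul_sign_def mult.commute)

lemma koszul_sign_add: "koszul_sign (\<alpha> + \<beta>) \<gamma> = koszul_sign \<alpha> \<gamma> * koszul_sign \<beta> \<gamma>"
  by (cases \<alpha>; cases \<beta>; cases \<gamma>) (simp_all add: koszul_sign_def add_bit_eq_xor)

lemma koszul_sign_zero: "koszul_sign 0 \<beta> = 1"
  by (simp add: koszul_sign_def)

context complex_space
begin

lemma borcherds_eq_Sum_any:
  assumes "is_field F" "is_field G"
  shows "borcherds \<epsilon> m F G k n w = Sum_any (\<lambda>i. ((- 1) ^ i * (of_int m gchoose i)) *s
      (F (m + k - int i) (G (n + int i) w) - (\<epsilon> * (- 1) powi m) *s G (m + n - int i) (F (k + int i) w)))"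
    and "finite {i. ((- 1) ^ i * (of_int m gchoose i)) *s
      (F (m + k - int i) (G (n + int i) w) - (\<epsilon> * (- 1) powi m) *s G (m + n - int i) (F (k + int i) w)) \<noteq> 0}"
proof -
  define a where "a i = (- 1) ^ i * (of_int m gchoose i :: complex)" for i
  define e where "e = - (\<epsilon> * (- 1) powi m)"
  define f where "f i = a i *s F (m + k - int i) (G (n + int i) w)" for i
  define g where "g i = e *s (a i *s G (m + n - int i) (F (k + int i) w))" for i
  have g': "g i = a i *s (e *s G (m + n - int i) (F (k + int i) w))" for i
    by (simp add: g_def mult.commute)
  have eq: "(\<lambda>i. a i *s (F (m + k - int i) (G (n + int i) w) - (\<epsilon> * (- 1) powi m) *s G (m + n - int i) (F (k + int i) w)))
    = (\<lambda>i. f i + g i)"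
    by (simp add: fun_eq_iff f_def g_def e_def scale_right_diff_distrib mult.commute mult.left_commute)
  have tF: "truncated (\<lambda>k n. F k (G n w))" and tG: "truncated (\<lambda>n k. e *s G n (F k w))"
    using truncated_composite[OF assms] truncated_image[OF truncated_composite[OF assms(2,1)], of "(*s) e"] by simp_all
  have ff: "finite {i. f i \<noteq> 0}" unfolding f_def by (rule truncated_finite[OF tF])
  have fg: "finite {i. g i \<noteq> 0}" unfolding g' by (rule truncated_finite[OF tG])
  have "Sum_any g = binomial_expansion m (\<lambda>n k. e *s G n (F k w)) n k"
    unfolding g' binomial_expansion_def a_def ..
  also have "\<dots> = e *s binomial_expansion m (\<lambda>n k. G n (F k w)) n k"
    by (rule binomial_expansion_image[OF truncated_composite[OF assms(2,1)] lin_scaling])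
  finally have "borcherds \<epsilon> m F G k n w = Sum_any f + Sum_any g"
    by (simp add: borcherds_def e_def) (simp add: f_def[abs_def] a_def binomial_expansion_def)
  also have "\<dots> = Sum_any (\<lambda>i. f i + g i)" by (rule Sum_any.distrib[symmetric, OF ff fg])
  finally show "borcherds \<epsilon> m F G k n w = Sum_any (\<lambda>i. ((- 1) ^ i * (of_int m gchoose i)) *s
      (F (m + k - int i) (G (n + int i) w) - (\<epsilon> * (- 1) powi m) *s G (m + n - int i) (F (k + int i) w)))"
    unfolding eq[symmetric] a_def .
  have "{i. f i + g i \<noteq> 0} \<subseteq> {i. f i \<noteq> 0} \<union> {i. g i \<noteq> 0}" by auto
  then have "finite {i. f i + g i \<noteq> 0}" by (rule finite_subset) (simp add: ff fg)
  then show "finite {i. ((- 1) ^ i * (of_int m gchoose i)) *s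
      (F (m + k - int i) (G (n + int i) w) - (\<epsilon> * (- 1) powi m) *s G (m + n - int i) (F (k + int i) w)) \<noteq> 0}"
    using eq by (simp add: fun_eq_iff a_def del: scale_eq_0_iff)
qed

definition translation_covariant :: "('v \<Rightarrow> 'v) \<Rightarrow> (int \<Rightarrow> 'v \<Rightarrow> 'v) \<Rightarrow> bool"
  where "translation_covariant T F \<longleftrightarrow> (\<forall>n w. T (F n w) = F n (T w) - of_int n *s F (n - 1) w)"

lemma binomial_expansion_covariant:
  assumes F: "is_field F" "translation_covariant T F" and G: "is_field G" "translation_covariant T G" and "lin T"
  shows "T (binomial_expansion m (\<lambda>k n. F k (G n w)) k n) =
    binomial_expansion m (\<lambda>k n. F k (G n (T w))) k n -
     (of_int k *s binomial_expansion m (\<lambda>k n. F k (G n w)) (k - 1) n +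
      of_int n *s binomial_expansion m (\<lambda>k n. F k (G n w)) k (n - 1))"
proof -
  have lF: "lin (F n)" for n using F is_field_lin by auto
  have t: "truncated (\<lambda>k n. F k (G n w))" for w by (rule truncated_composite) fact+
  obtain N where N: "\<And>k n. n \<ge> N \<Longrightarrow> F k (G n w) = 0" using t[of w] by (auto simp: truncated_def)
  have t': "truncated (\<lambda>k n. of_int k *s F (k - 1) (G n w) + of_int n *s F k (G (n - 1) w))"
    unfolding truncated_def by (intro exI[of _ "N + 1"]) (simp add: N)
  have "T (binomial_expansion m (\<lambda>k n. F k (G n w)) k n) = binomial_expansion m (\<lambda>k n. T (F k (G n w))) k n"
    by (rule binomial_expansion_image[symmetric, OF t \<open>lin T\<close>])
  also have "(\<lambda>k n. T (F k (G n w))) = (\<lambda>k n. F k (G n (T w)) - (of_int k *s F (k - 1) (G n w) + of_int n *s F k (G (n - 1) w)))"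
    using F(2) G(2) by (simp add: fun_eq_iff translation_covariant_def lin_diff[OF lF] lin_scale[OF lF])
  also have "binomial_expansion m \<dots> k n = binomial_expansion m (\<lambda>k n. F k (G n (T w))) k n -
     (of_int k *s binomial_expansion m (\<lambda>k n. F k (G n w)) (k - 1) n +
      of_int n *s binomial_expansion m (\<lambda>k n. F k (G n w)) k (n - 1))"
    by (simp only: binomial_expansion_diff[OF t t'] binomial_expansion_derivation[OF t])
  finally show ?thesis .
qed

lemma nth_product_covariant:
  assumes F: "is_field F" "translation_covariant T F" and G: "is_field G" "translation_covariant T G" and "lin T"
  shows "translation_covariant T (nth_product \<epsilon> m F G)"
  unfolding translation_covariant_def
  by (simp add: nth_product_def borcherds_def lin_diff[OF \<open>lin T\<close>] lin_scale[OF \<open>lin T\<close>] scale_right_diff_distrib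
      binomial_expansion_covariant[OF F G \<open>lin T\<close>] binomial_expansion_covariant[OF G F \<open>lin T\<close>] mult.commute)

text \<open>In the first sum only \<open>i = 0\<close> meets a nonzero \<open>G (n + i) vac\<close>; all terms of the second sum contain some
\<open>F i vac\<close> with \<open>i \<ge> 0\<close>.\<close>

lemma nth_product_vacuum:
  assumes "is_field F" "is_field G" and F: "\<And>n. n \<ge> 0 \<Longrightarrow> F n vac = 0" and G: "\<And>n. n \<ge> 0 \<Longrightarrow> G n vac = 0"
  shows "n \<ge> 0 \<Longrightarrow> nth_product \<epsilon> m F G n vac = 0"
    and "nth_product \<epsilon> m F G (- 1) vac = F m (G (- 1) vac)"
proof -
  have z: "F n 0 = 0" "G n 0 = 0" for n using assms(1,2) is_field_lin lin_zero by blast+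
  show "nth_product \<epsilon> m F G n vac = 0" if "n \<ge> 0"
    using that by (simp add: nth_product_def borcherds_eq_Sum_any(1)[OF assms(1,2)] F G z)
  have "nth_product \<epsilon> m F G (- 1) vac = (\<Sum>i\<in>{0}. ((- 1) ^ i * (of_int m gchoose i)) *s
      (F (m + 0 - int i) (G (- 1 + int i) vac) - (\<epsilon> * (- 1) powi m) *s G (m + - 1 - int i) (F (0 + int i) vac)))"
    unfolding nth_product_def borcherds_eq_Sum_any(1)[OF assms(1,2)]
  proof (rule Sum_any.expand_superset)
    have "F (m + 0 - int i) (G (- 1 + int i) vac) = 0" if "i \<noteq> 0" for i
      using that by (simp add: G z)
    then show "{i. ((- 1) ^ i * (of_int m gchoose i)) *s
      (F (m + 0 - int i) (G (- 1 + int i) vac) - (\<epsilon> * (- 1) powi m) *s G (m + - 1 - int i) (F (0 + int i) vac)) \<noteq> 0} \<subseteq> {0}"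
      by (auto simp: F z)
  qed simp
  then show "nth_product \<epsilon> m F G (- 1) vac = F m (G (- 1) vac)" by (simp add: F z)
qed

lemma Sum_any_in_subspace:
  assumes "subspace S" "\<And>i. f i \<in> S"
  shows "Sum_any f \<in> S"
  unfolding Sum_any.expand_set by (rule subspace_sum) (use assms in auto)

definition identity_field :: "int \<Rightarrow> 'v \<Rightarrow> 'v"
  where "identity_field n w = (if n = - 1 then w else 0)"

lemma identity_field: "is_field identity_field"
  unfolding is_field_def identity_field_def
proof (intro conjI allI)
  fix n :: int show "lin (\<lambda>w. if n = - 1 then w else 0)" by (rule linI) auto
  fix w :: 'v show "\<exists>N::int. \<forall>n\<ge>N. (if n = - 1 then w else 0) = 0" by (rule exI[of _ 0]) auto
qed

end

text \<open>The even and the odd part are subsets \<open>P 0\<close> and \<open>P 1\<close> of a larger space on which all operators are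
defined: identities between operators hold there without side conditions, and only statements about
generation refer to the parts. The maps \<open>pr\<close> are projections to the parts; the condition \<open>generated\<close> says
that the parts are the smallest subspaces that contain the vacuum and are stable under the generators.\<close>

locale generating_fields = complex_space scale
  for scale :: "complex \<Rightarrow> 'v::ab_group_add \<Rightarrow> 'v" (infixr "*s" 75) +
  fixes P :: "bit \<Rightarrow> 'v set" and pr :: "bit \<Rightarrow> 'v \<Rightarrow> 'v" and vac :: 'v and T :: "'v \<Rightarrow> 'v"
    and gen :: "bit \<Rightarrow> (int \<Rightarrow> 'v \<Rightarrow> 'v) set"
  assumes P_subspace: "subspace (P \<alpha>)"
    and pr_lin: "lin (pr \<alpha>)"
    and pr_P: "w \<in> P \<beta> \<Longrightarrow> pr \<alpha> w = (if \<alpha> = \<beta> then w else 0)"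
    and vac: "vac \<in> P 0"
    and T_lin: "lin T"
    and T_vac: "T vac = 0"
    and gen_field: "g \<in> gen \<alpha> \<Longrightarrow> is_field g"
    and gen_covariant: "g \<in> gen \<alpha> \<Longrightarrow> translation_covariant T g"
    and gen_vac: "g \<in> gen \<alpha> \<Longrightarrow> n \<ge> 0 \<Longrightarrow> g n vac = 0"
    and gen_parity: "g \<in> gen \<alpha> \<Longrightarrow> w \<in> P \<beta> \<Longrightarrow> g n w \<in> P (\<alpha> + \<beta>)"
    and gen_local: "g \<in> gen \<alpha> \<Longrightarrow> h \<in> gen \<beta> \<Longrightarrow> mutually_local (koszul_sign \<alpha> \<beta>) g h"
    and generated: "(\<And>\<beta>. subspace (Q \<beta>)) \<Longrightarrow> vac \<in> Q 0 \<Longrightarrow>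
      (\<And>\<beta> \<gamma> g n w. g \<in> gen \<beta> \<Longrightarrow> w \<in> Q \<gamma> \<Longrightarrow> w \<in> P \<gamma> \<Longrightarrow> g n w \<in> Q (\<beta> + \<gamma>)) \<Longrightarrow> P \<alpha> \<subseteq> Q \<alpha>"
begin

text \<open>The properties that determine a field by its value on the vacuum.\<close>

definition good :: "bit \<Rightarrow> (int \<Rightarrow> 'v \<Rightarrow> 'v) \<Rightarrow> bool"
  where "good \<alpha> F \<longleftrightarrow> is_field F \<and> translation_covariant T F \<and> (\<forall>n\<ge>0. F n vac = 0) \<and>
    (\<forall>\<beta> n. \<forall>w\<in>P \<beta>. F n w \<in> P (\<alpha> + \<beta>)) \<and> (\<forall>\<beta>. \<forall>g\<in>gen \<beta>. mutually_local (koszul_sign \<alpha> \<beta>) F g)"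

text \<open>Requiring locality with every good field, rather than with generating fields only, makes this family
closed under all products by a direct application of Dong's lemma.\<close>

definition vertex_operators :: "bit \<Rightarrow> (int \<Rightarrow> 'v \<Rightarrow> 'v) set"
  where "vertex_operators \<alpha> = {F. good \<alpha> F \<and> (\<forall>\<beta> G. good \<beta> G \<longrightarrow> mutually_local (koszul_sign \<alpha> \<beta>) F G)}"

lemma vertex_operators_good: "F \<in> vertex_operators \<alpha> \<Longrightarrow> good \<alpha> F"
  by (simp add: vertex_operators_def)

lemma good_field: "good \<alpha> F \<Longrightarrow> is_field F" by (simp add: good_def)

lemma good_parity: "good \<alpha> F \<Longrightarrow> w \<in> P \<beta> \<Longrightarrow> F n w \<in> P (\<alpha> + \<beta>)" by (simp add: good_def)

lemma good_add:
  assumes "good \<alpha> F" "good \<alpha> G"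
  shows "good \<alpha> (\<lambda>n w. F n w + G n w)"
proof -
  have "is_field (\<lambda>n w. F n w + G n w)"
    unfolding is_field_def
  proof (intro conjI allI)
    fix n show "lin (\<lambda>w. F n w + G n w)"
      using assms[THEN good_field, THEN is_field_lin]
      by (simp add: lin_def scale_right_distrib algebra_simps)
  next
    fix w
    obtain N where N: "\<forall>n\<ge>N. F n w = 0" using assms(1) unfolding good_def is_field_def by blast
    obtain N' where N': "\<forall>n\<ge>N'. G n w = 0" using assms(2) unfolding good_def is_field_def by blast
    show "\<exists>N. \<forall>n\<ge>N. F n w + G n w = 0" by (intro exI[of _ "max N N'"]) (simp add: N N')
  qed
  moreover have "translation_covariant T (\<lambda>n w. F n w + G n w)"
    using assms by (simp add: good_def translation_covariant_def lin_add[OF T_lin] scale_right_distrib)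
  moreover have "mutually_local (koszul_sign \<alpha> \<beta>) (\<lambda>n w. F n w + G n w) g" if "g \<in> gen \<beta>" for \<beta> g
    by (rule mutually_local_add) (use assms gen_field that in \<open>auto simp: good_def\<close>)
  ultimately show ?thesis
    using assms by (simp add: good_def subspace_add[OF P_subspace])
qed

lemma good_scale:
  assumes "good \<alpha> F"
  shows "good \<alpha> (\<lambda>n w. a *s F n w)"
proof -
  have "is_field (\<lambda>n w. a *s F n w)"
    unfolding is_field_def
  proof (intro conjI allI)
    fix n show "lin (\<lambda>w. a *s F n w)"
      using assms is_field_lin by (auto simp: good_def intro: lin_scale_fun)
  next
    fix w
    obtain N where "\<forall>n\<ge>N. F n w = 0" using assms(1) unfolding good_def is_field_def by blast
    then show "\<exists>N. \<forall>n\<ge>N. a *s F n w = 0" by (intro exI[of _ N]) simp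
  qed
  moreover have "translation_covariant T (\<lambda>n w. a *s F n w)"
    using assms by (simp add: good_def translation_covariant_def lin_scale[OF T_lin] scale_right_diff_distrib mult.commute)
  moreover have "mutually_local (koszul_sign \<alpha> \<beta>) (\<lambda>n w. a *s F n w) g" if "g \<in> gen \<beta>" for \<beta> g
    by (rule mutually_local_scale) (use assms gen_field that in \<open>auto simp: good_def\<close>)
  ultimately show ?thesis
    using assms by (simp add: good_def subspace_scale[OF P_subspace])
qed

lemma vertex_operators_add:
  "F \<in> vertex_operators \<alpha> \<Longrightarrow> G \<in> vertex_operators \<alpha> \<Longrightarrow> (\<lambda>n w. F n w + G n w) \<in> vertex_operators \<alpha>"
  by (simp add: vertex_operators_def good_add good_field mutually_local_add)

lemma vertex_operators_scale:
  "F \<in> vertex_operators \<alpha> \<Longrightarrow> (\<lambda>n w. a *s F n w) \<in> vertex_operators \<alpha>"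
  by (simp add: vertex_operators_def good_scale good_field mutually_local_scale)

lemma gen_good: "g \<in> gen \<alpha> \<Longrightarrow> good \<alpha> g"
  by (simp add: good_def gen_field gen_covariant gen_vac gen_parity gen_local)

lemma gen_vertex_operator: "g \<in> gen \<alpha> \<Longrightarrow> g \<in> vertex_operators \<alpha>"
  unfolding vertex_operators_def
  using gen_good mutually_local_sym[OF _ koszul_sign_square]
  by (auto simp: koszul_sign_sym[of \<alpha>]) (auto simp: good_def)

lemma identity_vertex_operator: "identity_field \<in> vertex_operators 0"
proof -
  have loc: "mutually_local 1 identity_field G" if "is_field G" for G
  proof -
    have "(shift_diff ^^ 0) (\<lambda>k n. identity_field k (G n w) - 1 *s G n (identity_field k w)) = (\<lambda>k n. 0)" for w
      by (simp add: fun_eq_iff identity_field_def lin_zero is_field_lin[OF that])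
    then show ?thesis unfolding mutually_local_def by blast
  qed
  have "translation_covariant T identity_field"
    by (auto simp: translation_covariant_def identity_field_def lin_zero[OF T_lin])
  moreover have "0 \<in> P \<alpha>" for \<alpha> by (rule subspace_0[OF P_subspace])
  ultimately show ?thesis
    by (auto simp: vertex_operators_def good_def identity_field koszul_sign_zero loc gen_field) (auto simp: identity_field_def)
qed

lemma zero_vertex_operator: "(\<lambda>n w. 0) \<in> vertex_operators \<alpha>"
proof -
  have "is_field (\<lambda>n w. 0)" by (auto simp: is_field_def lin_def)
  moreover have "mutually_local \<epsilon> (\<lambda>n w. 0) G" if "is_field G" for \<epsilon> G
  proof -
    have "(shift_diff ^^ 0) (\<lambda>k n. 0 - \<epsilon> *s G n 0) = (\<lambda>k n. 0)" for w :: 'v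
      by (simp add: fun_eq_iff lin_zero is_field_lin[OF that])
    then show ?thesis unfolding mutually_local_def by blast
  qed
  moreover have "translation_covariant T (\<lambda>n w. 0)"
    by (auto simp: translation_covariant_def lin_zero[OF T_lin])
  moreover have "0 \<in> P \<beta>" for \<beta> by (rule subspace_0[OF P_subspace])
  ultimately show ?thesis by (auto simp: vertex_operators_def good_def gen_field)
qed

lemma nth_product_good:
  assumes F: "good \<alpha> F" and G: "good \<beta> G" and FG: "mutually_local (koszul_sign \<alpha> \<beta>) F G"
  shows "good (\<alpha> + \<beta>) (nth_product (koszul_sign \<alpha> \<beta>) m F G)"
proof -
  have fF: "is_field F" and fG: "is_field G" using F G good_field by auto
  have "nth_product (koszul_sign \<alpha> \<beta>) m F G n w \<in> P (\<alpha> + \<beta> + \<gamma>)" if w: "w \<in> P \<gamma>" for n \<gamma> w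
    unfolding nth_product_def borcherds_eq_Sum_any(1)[OF fF fG]
  proof (intro Sum_any_in_subspace[OF P_subspace] subspace_scale[OF P_subspace] subspace_diff[OF P_subspace])
    fix k l
    show "F k (G l w) \<in> P (\<alpha> + \<beta> + \<gamma>)"
      using good_parity[OF F good_parity[OF G w]] by (simp add: add.assoc)
    show "G k (F l w) \<in> P (\<alpha> + \<beta> + \<gamma>)"
      using good_parity[OF G good_parity[OF F w]] by (simp add: add.assoc add.left_commute)
  qed
  moreover have "mutually_local (koszul_sign (\<alpha> + \<beta>) \<gamma>) (nth_product (koszul_sign \<alpha> \<beta>) m F G) g" if "g \<in> gen \<gamma>" for \<gamma> g
    unfolding koszul_sign_add
    by (rule dong[OF fF fG gen_field[OF that] FG]) (use F G that in \<open>auto simp: good_def\<close>)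
  ultimately show ?thesis
    using F G by (simp add: good_def nth_product_field nth_product_covariant T_lin nth_product_vacuum(1))
qed

lemma nth_product_vertex_operator:
  assumes "F \<in> vertex_operators \<alpha>" "G \<in> vertex_operators \<beta>"
  shows "nth_product (koszul_sign \<alpha> \<beta>) m F G \<in> vertex_operators (\<alpha> + \<beta>)"
proof -
  have F: "good \<alpha> F" and G: "good \<beta> G" using assms by (auto simp: vertex_operators_def)
  have FG: "mutually_local (koszul_sign \<alpha> \<beta>) F G" using assms(1) G by (simp add: vertex_operators_def)
  have "mutually_local (koszul_sign (\<alpha> + \<beta>) \<gamma>) (nth_product (koszul_sign \<alpha> \<beta>) m F G) H" if "good \<gamma> H" for \<gamma> H
    unfolding koszul_sign_add
    by (rule dong[OF good_field[OF F] good_field[OF G] good_field[OF that] FG])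
      (use assms that in \<open>auto simp: vertex_operators_def\<close>)
  then show ?thesis by (simp add: vertex_operators_def nth_product_good[OF F G FG])
qed

text \<open>Translation covariance turns \<open>F (- 1) vac = 0\<close> into \<open>F n vac = 0\<close> for all \<open>n\<close>. The vectors that are
killed by all modes of \<open>F\<close> are stable under a generator \<open>g\<close>: locality then reads \<open>(x\<^sub>1 - x\<^sub>2)\<^sup>N F(x\<^sub>1) g(x\<^sub>2) w = 0\<close>,
and the truncated series \<open>F(x\<^sub>1) g(x\<^sub>2) w\<close> must vanish itself.\<close>

lemma good_zero:
  assumes F: "good \<alpha> F" and z: "F (- 1) vac = 0" and w: "w \<in> P \<beta>"
  shows "F n w = 0"
proof -
  have lF: "lin (F n)" for n using F good_field is_field_lin by blast
  define Q where "Q \<gamma> = {w. \<forall>n. F n w = 0}" for \<gamma> :: bit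
\<comment> \<open>covariance at the vacuum reads \<open>T (F (- j) vac) = j F (- j - 1) vac\<close>\<close>
  have neg: "F (- int j - 1) vac = 0" for j
  proof (induction j)
    case (Suc j)
    have "T (F (- int j - 1) vac) = F (- int j - 1) (T vac) - of_int (- int j - 1) *s F (- int j - 1 - 1) vac"
      using F by (simp only: good_def translation_covariant_def)
    then have "of_int (- int j - 1) *s F (- int j - 1 - 1) vac = 0"
      by (simp only: Suc T_vac lin_zero[OF lF] lin_zero[OF T_lin] diff_0 zero_eq_1_divide_iff neg_equal_0_iff_equal
          neg_0_equal_iff_equal)
    moreover have "complex_of_int (- int j - 1) \<noteq> 0" by (simp only: of_int_eq_0_iff)
    moreover have "- int j - 1 - 1 = - int j - 2" by simp
    ultimately have "F (- int j - 2) vac = 0" by (simp only: scale_eq_0_iff simp_thms)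
    moreover have "- int (Suc j) - 1 = - int j - 2" by simp
    ultimately show ?case by (simp only:)
  qed (simp add: z)
  have "F n vac = 0" for n
  proof (cases "n \<ge> 0")
    case True
    then show ?thesis using F by (simp add: good_def)
  next
    case False
    then show ?thesis using neg[of "nat (- n - 1)"] by simp
  qed
  moreover have "F n (g k w) = 0" if g: "g \<in> gen \<gamma>" and w: "\<forall>n. F n w = 0" for \<gamma> g w n k
  proof -
    have "mutually_local (koszul_sign \<alpha> \<gamma>) F g" using F g by (simp add: good_def)
    then obtain N where N: "\<And>w. (shift_diff ^^ N) (commutator (koszul_sign \<alpha> \<gamma>) F g w) = (\<lambda>k n. 0)"
      by (auto simp: mutually_local_def)
    have "(commutator (koszul_sign \<alpha> \<gamma>) F g w) = (\<lambda>k n. F k (g n w))"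
      using w by (simp add: lin_zero[OF is_field_lin[OF gen_field[OF g]]])
    with N[of w] have "(shift_diff ^^ N) (\<lambda>k n. F k (g n w)) = (\<lambda>k n. 0)" by simp
    then show ?thesis
      by (rule shift_diff_inject) (rule truncated_composite[OF good_field[OF F] gen_field[OF g]])
  qed
  moreover have "subspace (Q \<gamma>)" for \<gamma>
    by (auto simp: subspace_def Q_def lin_zero[OF lF] lin_add[OF lF] lin_scale[OF lF])
  ultimately have "P \<beta> \<subseteq> Q \<beta>" by (intro generated) (auto simp: Q_def)
  then show ?thesis using w by (auto simp: Q_def)
qed

lemma good_eqI:
  assumes "good \<alpha> F" "good \<alpha> G" "F (- 1) vac = G (- 1) vac" "w \<in> P \<beta>"
  shows "F n w = G n w"
proof -
  have "good \<alpha> (\<lambda>n w. F n w + (- 1) *s G n w)" by (intro good_add good_scale assms)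
  from good_zero[OF this _ assms(4), of n] assms(3) show ?thesis by simp
qed

text \<open>The vectors created by vertex operators are stable under a generator \<open>g\<close> because \<open>g\<^sub>(\<^sub>n\<^sub>) F\<close> creates
\<open>g n w\<close> when \<open>F\<close> creates \<open>w\<close>.\<close>

lemma state_field_surj: "u \<in> P \<alpha> \<Longrightarrow> \<exists>F \<in> vertex_operators \<alpha>. F (- 1) vac = u"
proof -
  assume u: "u \<in> P \<alpha>"
  define Q where "Q \<beta> = (\<lambda>F. F (- 1) vac) ` vertex_operators \<beta>" for \<beta>
  have "P \<alpha> \<subseteq> Q \<alpha>"
  proof (rule generated)
    have idv: "identity_field (- 1) vac = vac" by (simp add: identity_field_def)
    show v: "vac \<in> Q 0" unfolding Q_def by (rule image_eqI[where x = identity_field]) (simp_all add: idv identity_vertex_operator)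
    show "g n w \<in> Q (\<beta> + \<gamma>)" if g: "g \<in> gen \<beta>" and w: "w \<in> Q \<gamma>" for \<beta> \<gamma> g n w
    proof -
      obtain F where F: "F \<in> vertex_operators \<gamma>" "w = F (- 1) vac" using w by (auto simp: Q_def)
      have "nth_product (koszul_sign \<beta> \<gamma>) n g F (- 1) vac = g n w"
        unfolding F(2) using g F(1)
        by (intro nth_product_vacuum(2)) (auto simp: vertex_operators_def good_def gen_field gen_vac)
      then show ?thesis
        unfolding Q_def using nth_product_vertex_operator[OF gen_vertex_operator[OF g] F(1)] by (metis image_eqI)
    qed
    show "subspace (Q \<beta>)" for \<beta>
      unfolding subspace_def Q_def
    proof (intro conjI ballI allI)
      show "0 \<in> (\<lambda>F. F (- 1) vac) ` vertex_operators \<beta>"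
        by (rule image_eqI[OF _ zero_vertex_operator]) simp
    next
      fix x y assume "x \<in> (\<lambda>F. F (- 1) vac) ` vertex_operators \<beta>" "y \<in> (\<lambda>F. F (- 1) vac) ` vertex_operators \<beta>"
      then obtain F G where "F \<in> vertex_operators \<beta>" "G \<in> vertex_operators \<beta>" "x = F (- 1) vac" "y = G (- 1) vac" by auto
      then show "x + y \<in> (\<lambda>F. F (- 1) vac) ` vertex_operators \<beta>"
        by (intro image_eqI[OF _ vertex_operators_add[of F _ G]]) auto
    next
      fix c x assume "x \<in> (\<lambda>F. F (- 1) vac) ` vertex_operators \<beta>"
      then obtain F where "F \<in> vertex_operators \<beta>" "x = F (- 1) vac" by auto
      then show "c *s x \<in> (\<lambda>F. F (- 1) vac) ` vertex_operators \<beta>"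
        by (intro image_eqI[OF _ vertex_operators_scale[of F]]) auto
    qed
  qed
  then show ?thesis using u by (auto simp: Q_def)
qed

definition state_field :: "bit \<Rightarrow> 'v \<Rightarrow> int \<Rightarrow> 'v \<Rightarrow> 'v"
  where "state_field \<alpha> u = (SOME F. F \<in> vertex_operators \<alpha> \<and> F (- 1) vac = u)"

lemma state_field:
  assumes "u \<in> P \<alpha>"
  shows "state_field \<alpha> u \<in> vertex_operators \<alpha>" and "state_field \<alpha> u (- 1) vac = u"
  using someI_ex[of "\<lambda>F. F \<in> vertex_operators \<alpha> \<and> F (- 1) vac = u"] state_field_surj[OF assms]
  by (auto simp: state_field_def)

definition carrier_space :: "'v set"
  where "carrier_space = {x + y |x y. x \<in> P 0 \<and> y \<in> P 1}"

definition Y :: "'v \<Rightarrow> int \<Rightarrow> 'v \<Rightarrow> 'v"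
  where "Y u n w = state_field 0 (pr 0 u) n w + state_field 1 (pr 1 u) n w"

lemma P_carrier: "w \<in> P \<alpha> \<Longrightarrow> w \<in> carrier_space"
  unfolding carrier_space_def using subspace_0[OF P_subspace]
  by (cases \<alpha>) (auto intro: exI[of _ w] exI[of _ 0] add_0_left[symmetric] add_0_right[symmetric])

lemma carrier_induct [consumes 1, case_names P add]:
  assumes "w \<in> carrier_space" "\<And>\<alpha> w. w \<in> P \<alpha> \<Longrightarrow> R w" "\<And>x y. R x \<Longrightarrow> R y \<Longrightarrow> R (x + y)"
  shows "R w"
  using assms by (auto simp: carrier_space_def)

lemma carrier_subspace: "subspace carrier_space"
  unfolding carrier_space_def by (rule subspace_sums) (rule P_subspace)+

lemma good_closed: "good \<alpha> F \<Longrightarrow> w \<in> carrier_space \<Longrightarrow> F n w \<in> carrier_space"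
  by (erule carrier_induct)
    (auto simp: lin_add[OF is_field_lin[OF good_field]] intro: P_carrier good_parity subspace_add[OF carrier_subspace])

lemma good_eqI':
  assumes "good \<alpha> F" "good \<alpha> G" "F (- 1) vac = G (- 1) vac" "w \<in> carrier_space"
  shows "F n w = G n w"
  using assms(4) by (induction rule: carrier_induct)
    (auto simp: lin_add[OF is_field_lin[OF good_field[OF assms(1)]]] lin_add[OF is_field_lin[OF good_field[OF assms(2)]]]
      intro: good_eqI[OF assms(1-3)])

lemma state_field_0: "w \<in> carrier_space \<Longrightarrow> state_field \<alpha> 0 n w = 0"
  using good_eqI'[of \<alpha> "state_field \<alpha> 0" "\<lambda>n w. 0" w n] state_field[OF subspace_0[OF P_subspace]]
    zero_vertex_operator[THEN vertex_operators_good] vertex_operators_good by metis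

lemma Y_state_field: "u \<in> P \<alpha> \<Longrightarrow> w \<in> carrier_space \<Longrightarrow> Y u n w = state_field \<alpha> u n w"
  by (cases \<alpha>) (simp_all add: Y_def pr_P state_field_0)

lemma Y_eqI:
  assumes "u \<in> P \<alpha>" "good \<alpha> F" "F (- 1) vac = u" "w \<in> carrier_space"
  shows "Y u n w = F n w"
  unfolding Y_state_field[OF assms(1,4)]
  by (rule good_eqI') (use state_field[OF assms(1)] vertex_operators_good assms in auto)

lemma pr_carrier: "u \<in> carrier_space \<Longrightarrow> pr \<alpha> u \<in> P \<alpha>"
  by (erule carrier_induct)
    (auto simp: pr_P lin_add[OF pr_lin] intro: subspace_0[OF P_subspace] subspace_add[OF P_subspace])

lemma carrier_pr: "u \<in> carrier_space \<Longrightarrow> u = pr 0 u + pr 1 u"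
  by (auto simp: carrier_space_def pr_P lin_add[OF pr_lin])

lemma Y_add_right: "u \<in> carrier_space \<Longrightarrow> Y u n (v + w) = Y u n v + Y u n w"
  and Y_scale_right: "u \<in> carrier_space \<Longrightarrow> Y u n (c *s v) = c *s Y u n v"
proof -
  assume u: "u \<in> carrier_space"
  have l: "lin (state_field \<alpha> (pr \<alpha> u) n)" for \<alpha>
    using state_field(1)[OF pr_carrier[OF u]] vertex_operators_good good_field is_field_lin by blast
  show "Y u n (v + w) = Y u n v + Y u n w" "Y u n (c *s v) = c *s Y u n v"
    by (simp_all add: Y_def lin_add[OF l] lin_scale[OF l] scale_right_distrib)
qed

lemma Y_left_P:
  assumes "u \<in> P \<alpha>" "u' \<in> P \<alpha>" "w \<in> carrier_space"
  shows "state_field \<alpha> (u + u') n w = state_field \<alpha> u n w + state_field \<alpha> u' n w"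
    and "state_field \<alpha> (c *s u) n w = c *s state_field \<alpha> u n w"
proof -
  note s = state_field(2)[OF assms(1)] state_field(2)[OF assms(2)]
  note g = state_field(1)[OF assms(1), THEN vertex_operators_good] state_field(1)[OF assms(2), THEN vertex_operators_good]
  have 1: "u + u' \<in> P \<alpha>" and 2: "c *s u \<in> P \<alpha>"
    using assms by (auto intro: subspace_add[OF P_subspace] subspace_scale[OF P_subspace])
  show "state_field \<alpha> (u + u') n w = state_field \<alpha> u n w + state_field \<alpha> u' n w"
    using good_eqI'[OF vertex_operators_good[OF state_field(1)[OF 1]] good_add[OF g] _ assms(3)]
    by (simp add: state_field(2)[OF 1] s)
  show "state_field \<alpha> (c *s u) n w = c *s state_field \<alpha> u n w"
    using good_eqI'[OF vertex_operators_good[OF state_field(1)[OF 2]] good_scale[OF g(1)] _ assms(3)]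
    by (simp add: state_field(2)[OF 2] s)
qed

lemma Y_add_left:
  "u \<in> carrier_space \<Longrightarrow> u' \<in> carrier_space \<Longrightarrow> w \<in> carrier_space \<Longrightarrow> Y (u + u') n w = Y u n w + Y u' n w"
  and Y_scale_left: "u \<in> carrier_space \<Longrightarrow> w \<in> carrier_space \<Longrightarrow> Y (c *s u) n w = c *s Y u n w"
  by (simp_all add: Y_def lin_add[OF pr_lin] lin_scale[OF pr_lin] Y_left_P(1) Y_left_P(2)[OF pr_carrier pr_carrier] pr_carrier scale_right_distrib)

lemma Y_parity: "u \<in> P \<alpha> \<Longrightarrow> w \<in> P \<beta> \<Longrightarrow> Y u n w \<in> P (\<alpha> + \<beta>)"
  by (simp add: Y_state_field P_carrier good_parity vertex_operators_good state_field(1))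

lemma Y_closed: "u \<in> carrier_space \<Longrightarrow> w \<in> carrier_space \<Longrightarrow> Y u n w \<in> carrier_space"
  unfolding Y_def
  by (rule subspace_add[OF carrier_subspace]; rule good_closed[OF vertex_operators_good[OF state_field(1)[OF pr_carrier]]])

lemma Y_truncation:
  assumes "u \<in> carrier_space"
  shows "\<exists>N. \<forall>n\<ge>N. Y u n w = 0"
proof -
  have "is_field (state_field \<alpha> (pr \<alpha> u))" for \<alpha>
    using state_field(1)[OF pr_carrier[OF assms]] vertex_operators_good good_field by blast
  then have "\<forall>\<alpha>. \<exists>N. \<forall>n\<ge>N. state_field \<alpha> (pr \<alpha> u) n w = 0"
    unfolding is_field_def by blast
  then obtain N where "\<And>\<alpha> n. n \<ge> N \<alpha> \<Longrightarrow> state_field \<alpha> (pr \<alpha> u) n w = 0"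
    by metis
  then show ?thesis by (intro exI[of _ "max (N 0) (N 1)"]) (simp add: Y_def)
qed

text \<open>By uniqueness \<open>Y (Y u p v)\<close> is the product \<open>F\<^sub>(\<^sub>p\<^sub>) G\<close> of \<open>F = Y u\<close> and \<open>G = Y v\<close>, and the claim becomes
the Borcherds identity for \<open>F\<close> and \<open>G\<close>.\<close>

theorem Y_jacobi:
  fixes m n k :: int
  assumes u: "u \<in> P \<alpha>" and v: "v \<in> P \<beta>" and w: "w \<in> carrier_space"
  defines "f \<equiv> \<lambda>i. ((- 1) ^ i * (of_int m gchoose i)) *s
      (Y u (m + k - int i) (Y v (n + int i) w) -
       (koszul_sign \<alpha> \<beta> * (- 1) powi m) *s Y v (m + n - int i) (Y u (k + int i) w))"
    and "g \<equiv> \<lambda>i. (of_int k gchoose i) *s Y (Y u (m + int i) v) (n + k - int i) w"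
  shows "finite {i. f i \<noteq> 0}" "finite {i. g i \<noteq> 0}" "Sum_any f = Sum_any g"
proof -
  define F where "F = state_field \<alpha> u"
  define G where "G = state_field \<beta> v"
  have F: "F \<in> vertex_operators \<alpha>" "F (- 1) vac = u" and G: "G \<in> vertex_operators \<beta>" "G (- 1) vac = v"
    using state_field u v by (auto simp: F_def G_def)
  note gF = vertex_operators_good[OF F(1)] and gG = vertex_operators_good[OF G(1)]
  note fF = good_field[OF gF] and fG = good_field[OF gG]
  have loc: "mutually_local (koszul_sign \<alpha> \<beta>) F G" using F gG by (simp add: vertex_operators_def)
  have Yu: "Y u n x = F n x" and Yv: "Y v n x = G n x" if "x \<in> carrier_space" for n x
    using that u v by (auto simp: Y_state_field F_def G_def)
  have f: "f = (\<lambda>i. ((- 1) ^ i * (of_int m gchoose i)) *s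
      (F (m + k - int i) (G (n + int i) w) -
       (koszul_sign \<alpha> \<beta> * (- 1) powi m) *s G (m + n - int i) (F (k + int i) w)))"
    by (simp add: f_def Yu Yv w good_closed[OF gF] good_closed[OF gG])
  have prod: "Y (Y u p v) q w = nth_product (koszul_sign \<alpha> \<beta>) p F G q w" for p q
  proof (rule Y_eqI[OF _ _ _ w])
    show "Y u p v \<in> P (\<alpha> + \<beta>)" by (rule Y_parity[OF u v])
    show "good (\<alpha> + \<beta>) (nth_product (koszul_sign \<alpha> \<beta>) p F G)" by (rule nth_product_good[OF gF gG loc])
    show "nth_product (koszul_sign \<alpha> \<beta>) p F G (- 1) vac = Y u p v"
      using gF gG by (subst nth_product_vacuum(2)) (auto simp: good_def Yu P_carrier[OF v] G(2))
  qed
  show "finite {i. f i \<noteq> 0}" unfolding f by (rule borcherds_eq_Sum_any(2)[OF fF fG])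
  show "Sum_any f = Sum_any g"
    unfolding f g_def prod
    by (simp only: borcherds_eq_Sum_any(1)[OF fF fG, symmetric] borcherds_identity[OF fF fG loc])
  obtain N where N: "\<And>n. n \<ge> N \<Longrightarrow> Y u n v = 0" using Y_truncation[OF P_carrier[OF u]] by blast
  have "Y 0 q w = 0" for q by (simp add: Y_def lin_zero[OF pr_lin] state_field_0 w)
  then have "g i = 0" if "\<not> i \<le> nat (N - m)" for i
    unfolding g_def using N[of "m + int i"] that by simp
  then have "{i. g i \<noteq> 0} \<subseteq> {..nat (N - m)}" by blast
  then show "finite {i. g i \<noteq> 0}" by (rule finite_subset) simp
qed

lemma Y_vac: "w \<in> carrier_space \<Longrightarrow> Y vac n w = (if n = - 1 then w else 0)"
  using Y_eqI[OF vac vertex_operators_good[OF identity_vertex_operator], of w n]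
  by (simp add: identity_field_def)

lemma vac_carrier: "vac \<in> carrier_space" by (rule P_carrier[OF vac])

lemma Y_creation: "v \<in> carrier_space \<Longrightarrow> Y v (- 1) vac = v"
  by (simp add: Y_def state_field(2) pr_carrier carrier_pr[symmetric])

lemma Y_vacuum:
  assumes "v \<in> carrier_space" "n \<ge> 0"
  shows "Y v n vac = 0"
proof -
  have "state_field \<alpha> (pr \<alpha> v) n vac = 0" for \<alpha>
    using vertex_operators_good[OF state_field(1)[OF pr_carrier[OF assms(1)]]] assms(2) by (simp add: good_def)
  then show ?thesis by (simp add: Y_def)
qed

lemma Y_gen: "g \<in> gen \<alpha> \<Longrightarrow> w \<in> carrier_space \<Longrightarrow> Y (g (- 1) vac) n w = g n w"
  by (rule Y_eqI[of _ "\<alpha>"]) (use gen_parity[of g \<alpha> vac 0] vac in \<open>auto simp: gen_good\<close>)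

text \<open>The assumption \<open>iterate\<close> is the Jacobi identity with \<open>k = 0\<close> for a generator on the left. The parts are
treated separately since it is available for homogeneous \<open>v\<close> only.\<close>

theorem Y_unique:
  assumes add: "\<And>u v n w. u \<in> carrier_space \<Longrightarrow> v \<in> carrier_space \<Longrightarrow> w \<in> carrier_space \<Longrightarrow> Y' (u + v) n w = Y' u n w + Y' v n w"
    and scale: "\<And>c u n w. u \<in> carrier_space \<Longrightarrow> w \<in> carrier_space \<Longrightarrow> Y' (c *s u) n w = c *s Y' u n w"
    and vacuum: "\<And>n w. w \<in> carrier_space \<Longrightarrow> Y' vac n w = (if n = - 1 then w else 0)"
    and iterate: "\<And>\<alpha> \<beta> g m v n w. g \<in> gen \<alpha> \<Longrightarrow> v \<in> P \<beta> \<Longrightarrow> w \<in> carrier_space \<Longrightarrow>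
      Y' (g m v) n w = Sum_any (\<lambda>i. ((- 1) ^ i * (of_int m gchoose i)) *s
      (g (m - int i) (Y' v (n + int i) w) - (koszul_sign \<alpha> \<beta> * (- 1) powi m) *s Y' v (m + n - int i) (g (int i) w)))"
    and v: "v \<in> carrier_space" and w: "w \<in> carrier_space"
  shows "Y' v n w = Y v n w"
proof -
  define Q where "Q \<beta> = {v \<in> P \<beta>. \<forall>n. \<forall>w\<in>carrier_space. Y' v n w = Y v n w}" for \<beta>
  have Y'0: "Y' 0 n w = 0" if "w \<in> carrier_space" for n w
    using scale[of 0 w 0 n] that subspace_0[OF carrier_subspace] by simp
  have Y0: "Y 0 n w = 0" if "w \<in> carrier_space" for n w
    using Y_scale_left[of 0 w 0 n] that subspace_0[OF carrier_subspace] by simp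
  have "P \<beta> \<subseteq> Q \<beta>" for \<beta>
  proof (rule generated)
    show "subspace (Q \<beta>)" for \<beta>
      unfolding subspace_def Q_def
      by (auto simp: Y'0 Y0 add scale Y_add_left Y_scale_left P_carrier
          intro: subspace_0[OF P_subspace] subspace_add[OF P_subspace] subspace_scale[OF P_subspace])
    show "vac \<in> Q 0" by (simp add: Q_def vac vacuum Y_vac)
    show "g m x \<in> Q (\<beta> + \<gamma>)" if g: "g \<in> gen \<beta>" and x: "x \<in> Q \<gamma>" for \<beta> \<gamma> g m x
    proof -
      have xP: "x \<in> P \<gamma>" and xY: "\<And>n w. w \<in> carrier_space \<Longrightarrow> Y' x n w = Y x n w"
        using x by (auto simp: Q_def)
      have "Y' (g m x) n w = Y (g m x) n w" if w: "w \<in> carrier_space" for n w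
      proof -
        note gg = gen_good[OF g]
        have gP: "g (- 1) vac \<in> P \<beta>" using gen_parity[OF g vac, of "- 1"] by simp
        have *: "(0 gchoose i) = (if i = 0 then 1 else 0 :: complex)" for i by (cases i) auto
        have "Y' (g m x) n w = Sum_any (\<lambda>i. ((- 1) ^ i * (of_int m gchoose i)) *s
          (Y (g (- 1) vac) (m + 0 - int i) (Y x (n + int i) w) -
           (koszul_sign \<beta> \<gamma> * (- 1) powi m) *s Y x (m + n - int i) (Y (g (- 1) vac) (0 + int i) w)))"
          by (simp add: iterate[OF g xP w] xY w Y_gen[OF g] good_closed[OF gg] Y_closed P_carrier[OF xP])
        also have "\<dots> = Sum_any (\<lambda>i. (of_int 0 gchoose i) *s Y (Y (g (- 1) vac) (m + int i) x) (n + 0 - int i) w)"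
          by (rule Y_jacobi(3)[OF gP xP w])
        also have "\<dots> = (\<Sum>i\<in>{0}. (of_int 0 gchoose i) *s Y (Y (g (- 1) vac) (m + int i) x) (n + 0 - int i) w)"
          by (rule Sum_any.expand_superset) (auto simp: *)
        finally show ?thesis by (simp add: Y_gen[OF g] P_carrier[OF xP])
      qed
      then show ?thesis using gen_parity[OF g xP] by (simp add: Q_def)
    qed
  qed
  then have P: "Y' v n w = Y v n w" if "v \<in> P \<beta>" for v \<beta> using that w by (auto simp: Q_def)
  have "Y' (pr 0 v + pr 1 v) n w = Y (pr 0 v + pr 1 v) n w"
    by (simp add: add Y_add_left P[OF pr_carrier[OF v]] P_carrier[OF pr_carrier[OF v]] w)
  then show ?thesis by (simp only: carrier_pr[OF v, symmetric])
qed

end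

section \<open>The free algebra\<close>

definition sum_ext :: "('k \<Rightarrow> 'c::zero \<Rightarrow> 'm::comm_monoid_add) \<Rightarrow> ('k \<Rightarrow>\<^sub>0 'c) \<Rightarrow> 'm"
  where "sum_ext h f = (\<Sum>k\<in>Poly_Mapping.keys f. h k (Poly_Mapping.lookup f k))"

lemma sum_ext_superset:
  assumes "\<And>k. h k 0 = 0" "finite S" "Poly_Mapping.keys f \<subseteq> S"
  shows "sum_ext h f = (\<Sum>k\<in>S. h k (Poly_Mapping.lookup f k))"
  unfolding sum_ext_def by (rule sum.mono_neutral_left) (use assms in \<open>auto simp: in_keys_iff\<close>)

lemma sum_ext_add:
  fixes h :: "'k \<Rightarrow> 'c::comm_monoid_add \<Rightarrow> 'm::comm_monoid_add"
  assumes "\<And>k. h k 0 = 0" "\<And>k a b. h k (a + b) = h k a + h k b"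
  shows "sum_ext h (f + g) = sum_ext h f + sum_ext h g"
proof -
  let ?S = "Poly_Mapping.keys f \<union> Poly_Mapping.keys g"
  have "sum_ext h (f + g) = (\<Sum>k\<in>?S. h k (Poly_Mapping.lookup (f + g) k))"
    by (rule sum_ext_superset) (use assms keys_add[of f g] in auto)
  also have "\<dots> = (\<Sum>k\<in>?S. h k (Poly_Mapping.lookup f k)) + (\<Sum>k\<in>?S. h k (Poly_Mapping.lookup g k))"
    by (simp add: lookup_add assms(2) sum.distrib)
  also have "\<dots> = sum_ext h f + sum_ext h g"
    using sum_ext_superset[of h ?S f] sum_ext_superset[of h ?S g] assms(1) by simp
  finally show ?thesis .
qed

lemma sum_ext_single: "h k 0 = 0 \<Longrightarrow> sum_ext h (Poly_Mapping.single k c) = h k c"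
  by (simp add: sum_ext_def)

lemma sum_ext_zero [simp]: "sum_ext h 0 = 0"
  by (simp add: sum_ext_def)

lemma poly_mapping_additive_induct [case_names single add]:
  fixes f :: "'k \<Rightarrow>\<^sub>0 'c::comm_monoid_add"
  assumes single: "\<And>k c. R (Poly_Mapping.single k c)" and add: "\<And>f g. R f \<Longrightarrow> R g \<Longrightarrow> R (f + g)"
  shows "R f"
proof (induction f rule: update_induct)
  case const
  show ?case using single[of undefined 0] by simp
next
  case (update f a b)
  have "Poly_Mapping.update a b f = Poly_Mapping.single a b + f"
    using update(1) by (intro poly_mapping_eqI) (auto simp: lookup_update lookup_add lookup_single in_keys_iff)
  then show ?case using single add update(3) by simp
qed

lemma mono_mult [simp]: "mono v a * mono w b = mono (v @ w) (a * b)"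
  by (simp add: mult_single plus_list_def)

lemma mono_Nil_1: "mono [] 1 = 1"
  by (simp flip: zero_list_def)

lemma mono_commute: "mono [] c * p = p * mono [] c"
proof (induction p rule: poly_mapping_additive_induct)
  case (single k c')
  then show ?case by (simp add: mult.commute)
qed (simp add: distrib_left distrib_right)

text \<open>Scalars act by multiplication with multiples of the empty word.\<close>

interpretation free: complex_space "\<lambda>c (p :: 'l list \<Rightarrow>\<^sub>0 complex). mono [] c * p"
proof (unfold_locales, goal_cases)
  case (2 a b x) then show ?case by (simp add: single_add distrib_right)
next
  case (3 a b x) then show ?case by (simp flip: mult.assoc)
qed (simp_all add: distrib_left mono_Nil_1)

lemma in_free_algebra: "p \<in> carrier (free_algebra S) \<longleftrightarrow> (\<forall>w\<in>Poly_Mapping.keys p. set w \<subseteq> S)"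
  by (simp add: free_algebra_def)

lemma free_algebra_UNIV [simp]: "carrier (free_algebra UNIV) = UNIV"
  by (simp add: free_algebra_def)

lemma free_algebra_simps [simp]:
  "x \<otimes>\<^bsub>free_algebra S\<^esub> y = x * y" "\<one>\<^bsub>free_algebra S\<^esub> = 1"
  "x \<oplus>\<^bsub>free_algebra S\<^esub> y = x + y" "\<zero>\<^bsub>free_algebra S\<^esub> = 0"
  by (simp_all add: free_algebra_def)

lemma free_algebra_mono: "set w \<subseteq> S \<Longrightarrow> mono w c \<in> carrier (free_algebra S)"
  by (auto simp: in_free_algebra)

lemma free_algebra_add: "p \<in> carrier (free_algebra S) \<Longrightarrow> q \<in> carrier (free_algebra S) \<Longrightarrow> p + q \<in> carrier (free_algebra S)"
  using keys_add[of p q] by (auto simp: in_free_algebra)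

lemma free_algebra_uminus: "p \<in> carrier (free_algebra S) \<Longrightarrow> - p \<in> carrier (free_algebra S)"
  by (simp add: in_free_algebra)

lemma free_algebra_diff: "p \<in> carrier (free_algebra S) \<Longrightarrow> q \<in> carrier (free_algebra S) \<Longrightarrow> p - q \<in> carrier (free_algebra S)"
  using free_algebra_add[of p S "- q"] free_algebra_uminus[of q S] by simp

lemma free_algebra_mult: "p \<in> carrier (free_algebra S) \<Longrightarrow> q \<in> carrier (free_algebra S) \<Longrightarrow> p * q \<in> carrier (free_algebra S)"
  using keys_mult[of p q] by (fastforce simp: in_free_algebra plus_list_def)

lemma free_algebra_zero: "0 \<in> carrier (free_algebra S)"
  by (simp add: in_free_algebra)

lemma free_algebra_one: "1 \<in> carrier (free_algebra S)"
  by (simp add: in_free_algebra zero_list_def)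

lemma free_algebra_ring: "ring (free_algebra S)"
proof (rule ringI)
  show "abelian_group (free_algebra S)"
  proof (rule abelian_groupI)
    fix x assume x: "x \<in> carrier (free_algebra S)"
    show "\<exists>y\<in>carrier (free_algebra S). y \<oplus>\<^bsub>free_algebra S\<^esub> x = \<zero>\<^bsub>free_algebra S\<^esub>"
      using free_algebra_uminus[OF x] by (intro bexI[of _ "- x"]) auto
  qed (auto simp: free_algebra_add free_algebra_zero add.assoc add.commute)
  show "monoid (free_algebra S)"
    by (rule monoidI) (auto simp: free_algebra_mult free_algebra_one mult.assoc)
qed (auto simp: distrib_left distrib_right)

lemma free_algebra_a_inv:
  assumes "x \<in> carrier (free_algebra S)"
  shows "\<ominus>\<^bsub>free_algebra S\<^esub> x = - x"
proof -
  interpret ring "free_algebra S" by (rule free_algebra_ring)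
  show ?thesis using assms minus_equality[of "- x" x] free_algebra_uminus by force
qed

text \<open>An ideal criterion in terms of the operations of the type, free of the inverse of the additive
monoid.\<close>

lemma free_algebra_idealI:
  assumes "K \<subseteq> carrier (free_algebra S)" "0 \<in> K"
    and "\<And>p q. p \<in> K \<Longrightarrow> q \<in> K \<Longrightarrow> p + q \<in> K" "\<And>p. p \<in> K \<Longrightarrow> - p \<in> K"
    and "\<And>p q. p \<in> K \<Longrightarrow> q \<in> carrier (free_algebra S) \<Longrightarrow> q * p \<in> K"
    and "\<And>p q. p \<in> K \<Longrightarrow> q \<in> carrier (free_algebra S) \<Longrightarrow> p * q \<in> K"
  shows "ideal K (free_algebra S)"
proof (rule idealI[OF free_algebra_ring])
  have "inv\<^bsub>add_monoid (free_algebra S)\<^esub> x = - x" if "x \<in> K" for x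
    using free_algebra_a_inv[of x S] that assms(1) unfolding a_inv_def by blast
  then show "subgroup K (add_monoid (free_algebra S))"
    using assms(1-4) by (intro subgroup.intro) auto
qed (use assms in auto)

section \<open>Representations of the free algebra\<close>

context complex_space
begin

text \<open>The action of the free algebra that extends operators \<open>R x\<close> for the generators \<open>x\<close>.\<close>

definition rep :: "('l \<Rightarrow> 'v \<Rightarrow> 'v) \<Rightarrow> ('l list \<Rightarrow>\<^sub>0 complex) \<Rightarrow> 'v \<Rightarrow> 'v"
  where "rep R p v = sum_ext (\<lambda>w c. c *s foldr R w v) p"

lemma rep_mono [simp]: "rep R (mono w c) v = c *s foldr R w v"
  by (simp add: rep_def sum_ext_single)

lemma rep_add: "rep R (p + q) v = rep R p v + rep R q v"
  unfolding rep_def by (rule sum_ext_add) (simp_all add: scale_left_distrib)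

lemma rep_zero [simp]: "rep R 0 v = 0" by (simp add: rep_def)

lemma rep_diff: "rep R (p - q) v = rep R p v - rep R q v"
  by (metis add_diff_cancel_right' diff_add_cancel rep_add)

lemma foldr_lin: "(\<And>x. lin (R x)) \<Longrightarrow> lin (foldr R w)"
  by (induction w) (auto simp: lin_def)

lemma rep_lin:
  assumes "\<And>x. lin (R x)"
  shows "lin (rep R p)"
proof (induction p rule: poly_mapping_additive_induct)
  case (single w c)
  then show ?case using foldr_lin[of R w] assms by (auto simp: lin_def scale_right_distrib mult.commute)
qed (auto simp: lin_def rep_add scale_right_distrib algebra_simps)

lemma rep_mult:
  assumes "\<And>x. lin (R x)"
  shows "rep R (p * q) v = rep R p (rep R q v)"
proof (induction p rule: poly_mapping_additive_induct)
  case (single w c)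
  show ?case
  proof (induction q rule: poly_mapping_additive_induct)
    case (single w' c')
    then show ?case using lin_scale[OF foldr_lin, of R, OF assms] by simp
  next
    case (add f g)
    then show ?case using lin_add[OF foldr_lin, of R, OF assms]
      by (simp add: distrib_left rep_add scale_right_distrib)
  qed
qed (simp add: distrib_right rep_add)

end

interpretation complex_self: complex_space "(*) :: complex \<Rightarrow> complex \<Rightarrow> complex"
  by unfold_locales (simp_all add: algebra_simps)

text \<open>For scalars acting on scalars this rule associates products to the left.\<close>

declare complex_self.scale_scale [simp del]

lemma word_act_rep: "word_act \<rho> p z = complex_self.rep \<rho> p z"
  by (simp add: word_act_def complex_self.rep_def sum_ext_def)

section \<open>The universal property of induced modules\<close>

text \<open>The subalgebra \<open>P\<close> acts on \<open>\<complex>\<close> through the character \<open>\<chi>\<close>. The map \<open>U(P) \<rightarrow> U(L)\<close>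
turns \<open>U(L)\<close> into a right module, so the relations below involve the ideals of both algebras.\<close>

locale induced_data =
  fixes L P :: "'l::ab_group_add lie_super" and \<rho> :: "'l \<Rightarrow> complex \<Rightarrow> complex" and \<chi> :: "'l \<Rightarrow> complex"
  assumes L_UNIV: "sl_carrier L = UNIV"
    and P_relations: "enveloping_relations P \<subseteq> enveloping_relations L"
    and P_closed: "enveloping_relations P \<subseteq> carrier (free_algebra (sl_carrier P))"
    and \<rho>_scalar: "\<rho> x z = \<chi> x * z"
    and \<rho>_relations: "r \<in> enveloping_relations P \<Longrightarrow> word_act \<rho> r z = 0"
begin

abbreviation "I \<equiv> enveloping_ideal L"
abbreviation "J \<equiv> enveloping_ideal P"
abbreviation "FL \<equiv> free_algebra (UNIV :: 'l set)"
abbreviation "FP \<equiv> free_algebra (sl_carrier P)"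
abbreviation "cl \<equiv> env_class L"
abbreviation "clP \<equiv> env_class P"
abbreviation "UL \<equiv> enveloping_algebra L"
abbreviation "UP \<equiv> enveloping_algebra P"

lemma I_ideal: "ideal I FL"
  unfolding enveloping_ideal_def L_UNIV by (rule ring.genideal_ideal[OF free_algebra_ring]) simp

lemma I_relations: "enveloping_relations L \<subseteq> I"
  unfolding enveloping_ideal_def L_UNIV by (rule ring.genideal_self[OF free_algebra_ring]) simp

lemma J_ideal: "ideal J FP"
  unfolding enveloping_ideal_def by (rule ring.genideal_ideal[OF free_algebra_ring P_closed])

sublocale I: ideal I FL by (rule I_ideal)
sublocale J: ideal J FP by (rule J_ideal)

lemma I_closed:
  "0 \<in> I" "p \<in> I \<Longrightarrow> q \<in> I \<Longrightarrow> p + q \<in> I" "p \<in> I \<Longrightarrow> - p \<in> I" "p \<in> I \<Longrightarrow> q \<in> I \<Longrightarrow> p - q \<in> I"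
  "p \<in> I \<Longrightarrow> q * p \<in> I" "p \<in> I \<Longrightarrow> p * q \<in> I"
proof -
  show "0 \<in> I" using additive_subgroup.zero_closed[OF I.additive_subgroup_axioms] by simp
  show a: "p \<in> I \<Longrightarrow> q \<in> I \<Longrightarrow> p + q \<in> I" for p q using additive_subgroup.a_closed[OF I.additive_subgroup_axioms, of p q] by simp
  show m: "p \<in> I \<Longrightarrow> - p \<in> I" for p using additive_subgroup.a_inv_closed[OF I.additive_subgroup_axioms, of p] free_algebra_a_inv[of p UNIV] by simp
  show "p \<in> I \<Longrightarrow> q \<in> I \<Longrightarrow> p - q \<in> I" using a[of p "- q"] m by simp
  show "p \<in> I \<Longrightarrow> q * p \<in> I" using I.I_l_closed[of p q] by simp
  show "p \<in> I \<Longrightarrow> p * q \<in> I" using I.I_r_closed[of p q] by simp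
qed

lemma J_closed:
  "p \<in> J \<Longrightarrow> p \<in> carrier FP" "0 \<in> J"
  using J.a_subset additive_subgroup.zero_closed[OF J.additive_subgroup_axioms] by auto

lemma J_subset: "J \<subseteq> I"
proof -
  have "ideal (I \<inter> carrier FP) FP"
    by (rule free_algebra_idealI)
      (auto simp: I_closed free_algebra_add free_algebra_uminus free_algebra_zero free_algebra_mult)
  moreover have "enveloping_relations P \<subseteq> I \<inter> carrier FP"
    using P_relations I_relations P_closed by auto
  ultimately show ?thesis
    using ring.genideal_minimal[OF free_algebra_ring] unfolding enveloping_ideal_def[of P] by blast
qed

lemma cl_eq: "cl p = {i + p |i. i \<in> I}"
  by (auto simp: env_class_def L_UNIV a_r_coset_def r_coset_def)

lemma clP_eq: "clP p = {i + p |i. i \<in> J}"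
  by (auto simp: env_class_def a_r_coset_def r_coset_def)

lemma cl_eq_iff: "cl p = cl q \<longleftrightarrow> p - q \<in> I"
proof
  assume "cl p = cl q"
  then have "0 + p \<in> cl q" using I_closed(1) unfolding cl_eq by blast
  then show "p - q \<in> I" by (auto simp: cl_eq)
next
  have sub: "cl p \<subseteq> cl q" if "p - q \<in> I" for p q
  proof
    fix x assume "x \<in> cl p"
    then obtain i where "i \<in> I" "x = (i + (p - q)) + q" by (auto simp: cl_eq)
    then show "x \<in> cl q" using that I_closed(2) unfolding cl_eq by blast
  qed
  assume "p - q \<in> I"
  then show "cl p = cl q" using sub[of p q] sub[of q p] I_closed(3)[of "p - q"] by auto
qed

lemma UL_carrier: "carrier UL = range cl"
  by (auto simp: enveloping_algebra_def FactRing_def A_RCOSETS_def' env_class_def L_UNIV)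

lemma UP_carrier: "carrier UP = clP ` carrier FP"
  by (auto simp: enveloping_algebra_def FactRing_def A_RCOSETS_def' env_class_def)

lemma UL_add: "cl p \<oplus>\<^bsub>UL\<^esub> cl q = cl (p + q)"
  using I.a_rcos_sum[of p q] by (simp add: enveloping_algebra_def FactRing_def env_class_def L_UNIV)

lemma UL_mult: "cl p \<otimes>\<^bsub>UL\<^esub> cl q = cl (p * q)"
  using I.rcoset_mult_add[of p q] by (simp add: enveloping_algebra_def FactRing_def env_class_def L_UNIV)

lemma UL_one: "\<one>\<^bsub>UL\<^esub> = cl 1"
  by (simp add: enveloping_algebra_def FactRing_def env_class_def L_UNIV)

lemma env_map_cl: "env_map L (clP q) = cl q"
proof -
  have "env_map L (clP q) = {a + (j + q) |a j. a \<in> I \<and> j \<in> J}"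
    by (auto simp: env_map_def clP_eq L_UNIV set_add_def' set_add_defs)
  also have "\<dots> = cl q"
  proof (intro equalityI subsetI)
    fix x assume "x \<in> {a + (j + q) |a j. a \<in> I \<and> j \<in> J}"
    then obtain a j where "a \<in> I" "j \<in> J" "x = (a + j) + q" by (auto simp: add.assoc)
    then show "x \<in> cl q" using J_subset I_closed(2)[of a j] unfolding cl_eq by blast
  next
    fix x assume "x \<in> cl q"
    then obtain i where "i \<in> I" "x = i + (0 + q)" by (auto simp: cl_eq)
    then show "x \<in> {a + (j + q) |a j. a \<in> I \<and> j \<in> J}" using J_closed(2) by blast
  qed
  finally show ?thesis .
qed

lemma \<rho>_lin: "complex_self.lin (\<rho> x)"
  by (rule complex_self.linI) (simp_all only: \<rho>_scalar distrib_left mult.left_commute)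

lemma word_act_mult: "word_act \<rho> (p * q) z = word_act \<rho> p (word_act \<rho> q z)"
  unfolding word_act_rep by (rule complex_self.rep_mult[OF \<rho>_lin])

lemma word_act_scalar: "word_act \<rho> p z = word_act \<rho> p 1 * z"
  using complex_self.lin_scale[OF complex_self.rep_lin[where R = \<rho> and p = p, OF \<rho>_lin], of z 1] by (simp add: word_act_rep mult.commute)

text \<open>The ideal of \<open>P\<close> lies in the kernel of the character because that kernel is an ideal that contains
the relations.\<close>

lemma word_act_J: "j \<in> J \<Longrightarrow> word_act \<rho> j z = 0"
proof -
  define K where "K = {j \<in> carrier FP. \<forall>z. word_act \<rho> j z = 0}"
  have z: "word_act \<rho> p 0 = 0" for p using word_act_scalar[of p 0] by simp
  have m: "word_act \<rho> (- p) z = - word_act \<rho> p z" for p z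
    using complex_self.rep_diff[of \<rho> 0 p z] by (simp add: word_act_rep)
  have a: "word_act \<rho> (p + q) z = word_act \<rho> p z + word_act \<rho> q z" for p q z
    by (simp add: word_act_rep complex_self.rep_add)
  have "ideal K FP"
    by (rule free_algebra_idealI)
      (auto simp: K_def a m word_act_def[of \<rho> 0] free_algebra_add free_algebra_uminus free_algebra_zero
        word_act_mult z free_algebra_mult)
  moreover have "enveloping_relations P \<subseteq> K"
    using P_closed \<rho>_relations by (auto simp: K_def)
  ultimately have "J \<subseteq> K"
    using ring.genideal_minimal[OF free_algebra_ring] unfolding enveloping_ideal_def[of P] by blast
  then show "j \<in> J \<Longrightarrow> word_act \<rho> j z = 0" by (auto simp: K_def)
qed

lemma env_act_cl: "env_act \<rho> (clP q) z = word_act \<rho> q z"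
proof -
  have "word_act \<rho> p z = word_act \<rho> q z" if "p \<in> clP q" for p
    using that word_act_J[unfolded word_act_rep]
    by (auto simp: clP_eq word_act_rep complex_self.rep_add)
  moreover have "q \<in> clP q"
    unfolding clP_eq mem_Collect_eq by (rule exI[of _ 0], rule conjI[OF _ J_closed(2)], simp)
  ultimately have "(\<lambda>p. word_act \<rho> p z) ` clP q = {word_act \<rho> q z}" by blast
  then show ?thesis by (simp add: env_act_def)
qed

abbreviation "rels \<equiv> tensor_relations UP UL (\<lambda>x r. x \<otimes>\<^bsub>UL\<^esub> env_map L r) complex_ring (env_act \<rho>)"
abbreviation "G \<equiv> free_Abelian_group (carrier UL \<times> (UNIV :: complex set))"
abbreviation "H \<equiv> induced_subgroup L P \<rho>"

lemma complex_ring_simps [simp]: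
  "carrier complex_ring = UNIV" "x \<oplus>\<^bsub>complex_ring\<^esub> y = x + y" "x \<otimes>\<^bsub>complex_ring\<^esub> y = x * y"
  "\<one>\<^bsub>complex_ring\<^esub> = 1" "\<zero>\<^bsub>complex_ring\<^esub> = 0"
  by (simp_all add: complex_ring_def)

text \<open>The tensor relations with every class written as the class of an element of the free algebra. The
third family is the balancing relation.\<close>

lemma rels_eq: "rels =
    {frag_of (cl (p + q), z) - frag_of (cl p, z) - frag_of (cl q, z) |p q z. True} \<union>
    {frag_of (cl p, y + z) - frag_of (cl p, y) - frag_of (cl p, z) |p y z. True} \<union>
    {frag_of (cl (p * q), z) - frag_of (cl p, word_act \<rho> q z) |p q z. q \<in> carrier FP}"
proof -
  have 1: "{frag_of (x \<oplus>\<^bsub>UL\<^esub> y, z) - frag_of (x, z) - frag_of (y, z) |x y z.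
      x \<in> range cl \<and> y \<in> range cl \<and> z \<in> UNIV} =
    {frag_of (cl (p + q), z) - frag_of (cl p, z) - frag_of (cl q, z) |p q z. True}"
    unfolding UL_add[symmetric] by blast
  have 2: "{frag_of (x, y + z) - frag_of (x, y) - frag_of (x, z) |x y z.
      x \<in> range cl \<and> y \<in> UNIV \<and> z \<in> UNIV} =
    {frag_of (cl p, y + z) - frag_of (cl p, y) - frag_of (cl p, z) |p y z. True}" by blast
  have "cl (p * q) = cl p \<otimes>\<^bsub>UL\<^esub> env_map L (clP q)" "word_act \<rho> q z = env_act \<rho> (clP q) z" for p q z
    by (simp_all add: UL_mult env_map_cl env_act_cl)
  then have 3: "{frag_of (x \<otimes>\<^bsub>UL\<^esub> env_map L r, z) - frag_of (x, env_act \<rho> r z) |x r z.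
      x \<in> range cl \<and> r \<in> clP ` carrier FP \<and> z \<in> UNIV} =
    {frag_of (cl (p * q), z) - frag_of (cl p, word_act \<rho> q z) |p q z. q \<in> carrier FP}" by auto
  show ?thesis
    by (simp only: tensor_relations_def UL_carrier UP_carrier complex_ring_simps 1 2 3)
qed

lemma rels_carrier: "rels \<subseteq> carrier G"
proof -
  have d: "a \<in> carrier G \<Longrightarrow> b \<in> carrier G \<Longrightarrow> a - b \<in> carrier G" for a b
    using keys_diff[of a b] by (auto simp: carrier_free_Abelian_group_iff)
  have "frag_of (cl p, z) \<in> carrier G" for p z by (simp add: UL_carrier)
  then show ?thesis unfolding rels_eq using d by blast
qed

lemma H_generate: "H = generate G rels"
  by (simp add: induced_subgroup_def tensor_subgroup_def)

lemma H_subgroup: "subgroup H G"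
  unfolding H_generate by (rule group.generate_is_subgroup[OF group_free_Abelian_group rels_carrier])

lemma H_closed: "0 \<in> H" "f \<in> H \<Longrightarrow> g \<in> H \<Longrightarrow> f + g \<in> H" "f \<in> H \<Longrightarrow> - f \<in> H" "f \<in> H \<Longrightarrow> g \<in> H \<Longrightarrow> f - g \<in> H"
proof -
  show "0 \<in> H" using subgroup.one_closed[OF H_subgroup] by simp
  show a: "f \<in> H \<Longrightarrow> g \<in> H \<Longrightarrow> f + g \<in> H" for f g using subgroup.m_closed[OF H_subgroup, of f g] by simp
  show m: "f \<in> H \<Longrightarrow> - f \<in> H" for f
    using subgroup.m_inv_closed[OF H_subgroup, of f] subgroup.subset[OF H_subgroup]
    by (auto simp: subset_iff carrier_free_Abelian_group_iff)
  show "f \<in> H \<Longrightarrow> g \<in> H \<Longrightarrow> f - g \<in> H" using a[of f "- g"] m by simp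
qed

lemma H_rels: "r \<in> rels \<Longrightarrow> r \<in> H"
  unfolding H_generate by (rule generate.incl)

lemma H_induct [consumes 1, case_names rel zero uminus add]:
  assumes "f \<in> H" "\<And>r. r \<in> rels \<Longrightarrow> R r" "R 0" "\<And>f. R f \<Longrightarrow> R (- f)" "\<And>f g. R f \<Longrightarrow> R g \<Longrightarrow> R (f + g)"
  shows "R f"
  using assms(1) unfolding H_generate
proof (induction rule: generate.induct)
  case (inv h)
  then have "inv\<^bsub>G\<^esub> h = - h" using rels_carrier by (auto simp: subset_iff carrier_free_Abelian_group_iff)
  then show ?case using assms inv by simp
qed (use assms in auto)

lemma H_add: "frag_of (cl (p + q), z) - frag_of (cl p, z) - frag_of (cl q, z) \<in> H"
  by (rule H_rels) (unfold rels_eq, blast)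

lemma H_add': "frag_of (cl p, y + z) - frag_of (cl p, y) - frag_of (cl p, z) \<in> H"
  by (rule H_rels) (unfold rels_eq, blast)

lemma H_balanced: "q \<in> carrier FP \<Longrightarrow> frag_of (cl (p * q), z) - frag_of (cl p, word_act \<rho> q z) \<in> H"
  by (rule H_rels) (unfold rels_eq, blast)

lemma coset_eq: "H #>\<^bsub>G\<^esub> f = {h + f |h. h \<in> H}"
  by (auto simp: r_coset_def)

lemma coset_eq_iff: "H #>\<^bsub>G\<^esub> f = H #>\<^bsub>G\<^esub> g \<longleftrightarrow> f - g \<in> H"
proof
  assume "H #>\<^bsub>G\<^esub> f = H #>\<^bsub>G\<^esub> g"
  then have "0 + f \<in> H #>\<^bsub>G\<^esub> g" using H_closed(1) unfolding coset_eq by blast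
  then show "f - g \<in> H" by (auto simp: coset_eq)
next
  have sub: "H #>\<^bsub>G\<^esub> f \<subseteq> H #>\<^bsub>G\<^esub> g" if "f - g \<in> H" for f g
  proof
    fix x assume "x \<in> H #>\<^bsub>G\<^esub> f"
    then obtain i where "i \<in> H" "x = (i + (f - g)) + g" by (auto simp: coset_eq)
    then show "x \<in> H #>\<^bsub>G\<^esub> g" using that H_closed(2) unfolding coset_eq by blast
  qed
  assume "f - g \<in> H"
  then show "H #>\<^bsub>G\<^esub> f = H #>\<^bsub>G\<^esub> g" using sub[of f g] sub[of g f] H_closed(3)[of "f - g"] by auto
qed

text \<open>Every element of the tensor product is of this form, since \<open>x \<otimes> z = x z \<otimes> 1\<close> for scalars \<open>z\<close>.\<close>

definition \<Psi> :: "('l list \<Rightarrow>\<^sub>0 complex) \<Rightarrow> 'l ind"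
  where "\<Psi> p = H #>\<^bsub>G\<^esub> frag_of (cl p, 1)"

abbreviation "V \<equiv> induced_module L P \<rho>"

lemma \<Psi>_eq_iff: "\<Psi> p = \<Psi> q \<longleftrightarrow> frag_of (cl p, 1) - frag_of (cl q, 1) \<in> H"
  by (simp add: \<Psi>_def coset_eq_iff)

lemma H_scalar: "frag_of (cl p, z) - frag_of (cl (p * mono [] z), 1) \<in> H"
proof -
  have "frag_of (cl (p * mono [] z), 1) - frag_of (cl p, word_act \<rho> (mono [] z) 1) \<in> H"
    by (rule H_balanced) (rule free_algebra_mono, simp)
  from H_closed(3)[OF this] show ?thesis by (simp add: word_act_rep)
qed

lemma H_zero: "frag_of (cl 0, z) \<in> H"
  using H_closed(3)[OF H_add[of 0 0 z]] by simp

lemma \<Psi>_surj: "f \<in> carrier G \<Longrightarrow> \<exists>p. H #>\<^bsub>G\<^esub> f = \<Psi> p"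
proof -
  have "Poly_Mapping.keys f \<subseteq> carrier UL \<times> UNIV \<Longrightarrow> \<exists>p. f - frag_of (cl p, 1) \<in> H"
  proof (induction f rule: frag_induction)
    case zero
    show ?case using H_closed(3)[OF H_zero[of 1]] by (intro exI[of _ 0]) simp
  next
    case (one x)
    then show ?case using H_scalar by (auto simp: UL_carrier)
  next
    case (diff a b)
    then obtain p q where pq: "a - frag_of (cl p, 1) \<in> H" "b - frag_of (cl q, 1) \<in> H" by blast
    have "a - b - frag_of (cl (p - q), 1) = (a - frag_of (cl p, 1)) - (b - frag_of (cl q, 1))
       + (frag_of (cl (p - q + q), 1) - frag_of (cl (p - q), 1) - frag_of (cl q, 1))" by simp
    also have "\<dots> \<in> H" by (rule H_closed(2)[OF H_closed(4)[OF pq] H_add])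
    finally show ?case by blast
  qed
  then show "f \<in> carrier G \<Longrightarrow> \<exists>p. H #>\<^bsub>G\<^esub> f = \<Psi> p"
    by (simp add: \<Psi>_def coset_eq_iff carrier_free_Abelian_group_iff)
qed

lemma V_group: "induced_group L P \<rho> = G Mod H"
  by (simp add: induced_group_def tensor_product_def induced_subgroup_def)

lemma frag_cl_carrier: "frag_of (cl p, z) \<in> carrier G" by (simp add: UL_carrier)

lemma V_carrier: "carrier V = range \<Psi>"
proof -
  have "carrier V = (\<lambda>f. H #>\<^bsub>G\<^esub> f) ` carrier G"
    by (auto simp: induced_module_def V_group FactGroup_def RCOSETS_def)
  also have "\<dots> = range \<Psi>"
  proof (intro equalityI image_subsetI)
    fix f assume "f \<in> carrier G"
    then show "H #>\<^bsub>G\<^esub> f \<in> range \<Psi>" using \<Psi>_surj by blast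
  next
    fix p show "\<Psi> p \<in> (\<lambda>f. H #>\<^bsub>G\<^esub> f) ` carrier G"
      unfolding \<Psi>_def by (rule imageI) (rule frag_cl_carrier)
  qed
  finally show ?thesis .
qed

lemma H_normal: "H \<lhd> G"
  by (rule comm_group.subgroup_imp_normal[OF abelian_free_Abelian_group H_subgroup])

lemma V_add: "\<Psi> p \<oplus>\<^bsub>V\<^esub> \<Psi> q = \<Psi> (p + q)"
proof -
  have "\<Psi> p \<oplus>\<^bsub>V\<^esub> \<Psi> q = H #>\<^bsub>G\<^esub> (frag_of (cl p, 1) + frag_of (cl q, 1))"
    using normal.rcos_sum[OF H_normal frag_cl_carrier[of p 1] frag_cl_carrier[of q 1]]
    by (simp add: induced_module_def V_group FactGroup_def \<Psi>_def)
  also have "\<dots> = \<Psi> (p + q)"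
    unfolding \<Psi>_def coset_eq_iff using H_closed(3)[OF H_add[of p q 1]] by (simp add: algebra_simps)
  finally show ?thesis .
qed

lemma V_zero: "\<zero>\<^bsub>V\<^esub> = \<Psi> 0"
proof -
  have "\<zero>\<^bsub>V\<^esub> = H #>\<^bsub>G\<^esub> 0" by (simp add: induced_module_def V_group FactGroup_def coset_eq)
  also have "\<dots> = \<Psi> 0" unfolding \<Psi>_def coset_eq_iff using H_closed(3)[OF H_zero] by simp
  finally show ?thesis .
qed

text \<open>The map \<open>x \<otimes> z \<mapsto> s x \<otimes> z\<close> preserves each of the three families of tensor relations, so the union in
the definition of the action is a single coset.\<close>

lemma env_act: "induced_env_act L P \<rho> (cl s) (\<Psi> p) = \<Psi> (s * p)"
proof -
  define \<phi> where "\<phi> = frag_extend (\<lambda>(x, z :: complex). frag_of (cl s \<otimes>\<^bsub>UL\<^esub> x, z))"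
  have \<phi>_of: "\<phi> (frag_of (cl q, z)) = frag_of (cl (s * q), z)" for q z by (simp add: \<phi>_def UL_mult)
  have \<phi>_diff: "\<phi> (a - b) = \<phi> a - \<phi> b" for a b by (simp add: \<phi>_def frag_extend_diff)
  have \<phi>_H: "\<phi> f \<in> H" if "f \<in> H" for f
    using that
  proof (induction rule: H_induct)
    case (rel r)
    then consider p q z where "r = frag_of (cl (p + q), z) - frag_of (cl p, z) - frag_of (cl q, z)"
      | p y z where "r = frag_of (cl p, y + z) - frag_of (cl p, y) - frag_of (cl p, z)"
      | p q z where "r = frag_of (cl (p * q), z) - frag_of (cl p, word_act \<rho> q z)" "q \<in> carrier FP"
      unfolding rels_eq by blast
    then show ?case
    proof cases
      case 1
      then show ?thesis using H_add[of "s * p" "s * q" z]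
        by (simp add: \<phi>_of \<phi>_diff distrib_left)
    next
      case 2
      then show ?thesis using H_add'[of "s * p" y z] by (simp add: \<phi>_of \<phi>_diff)
    next
      case 3
      then show ?thesis using H_balanced[of q "s * p" z]
        by (simp add: \<phi>_of \<phi>_diff mult.assoc)
    qed
  next
    case zero then show ?case by (simp add: \<phi>_def H_closed)
  next
    case (uminus f) then show ?case using H_closed(3) by (simp add: \<phi>_def frag_extend_minus)
  next
    case (add f g) then show ?case using H_closed(2) by (simp add: \<phi>_def frag_extend_add)
  qed
  have "H #>\<^bsub>G\<^esub> \<phi> f = \<Psi> (s * p)" if f: "f \<in> \<Psi> p" for f
  proof -
    obtain h where h: "h \<in> H" "f = h + frag_of (cl p, 1)" using f unfolding \<Psi>_def coset_eq by blast
    have "\<phi> f = \<phi> h + frag_of (cl (s * p), 1)" unfolding h(2) by (simp add: \<phi>_def frag_extend_add UL_mult)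
    then show ?thesis using \<phi>_H[OF h(1)] by (simp add: \<Psi>_def coset_eq_iff)
  qed
  moreover have "0 + frag_of (cl p, 1) \<in> \<Psi> p" using H_closed(1) unfolding \<Psi>_def coset_eq by blast
  ultimately show ?thesis unfolding induced_env_act_def \<phi>_def[symmetric] by blast
qed

lemma V_smult: "c \<odot>\<^bsub>V\<^esub> \<Psi> p = \<Psi> (mono [] c * p)"
  by (simp add: induced_module_def env_act)

lemma lie_act: "induced_lie_act L P \<rho> x (\<Psi> p) = \<Psi> (mono [x] 1 * p)"
  by (simp add: induced_lie_act_def env_act)

lemma tensor_one: "induced_tensor L P \<rho> \<one>\<^bsub>UL\<^esub> 1 = \<Psi> 1"
  by (simp add: induced_tensor_def \<Psi>_def UL_one)

lemma H_transfer:
  assumes 1: "a - c - b \<in> H" and d: "d \<in> H"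
  shows "a - b \<in> H \<longleftrightarrow> c - d \<in> H"
proof
  assume "a - b \<in> H"
  from H_closed(4)[OF H_closed(4)[OF this 1] d] show "c - d \<in> H" by simp
next
  assume "c - d \<in> H"
  from H_closed(2)[OF H_closed(2)[OF this 1] d] show "a - b \<in> H" by simp
qed

lemma \<Psi>_eq_iff_diff: "\<Psi> p = \<Psi> q \<longleftrightarrow> \<Psi> (p - q) = \<Psi> 0"
proof -
  have "frag_of (cl p, 1) - frag_of (cl (p - q), 1) - frag_of (cl q, 1) \<in> H"
    using H_add[of "p - q" q 1] by (simp only: diff_add_cancel)
  note * = H_transfer[OF this H_zero[of 1]]
  show ?thesis by (subst \<Psi>_eq_iff, subst \<Psi>_eq_iff) (rule *)
qed

lemma \<Psi>_relation: "r \<in> enveloping_relations L \<Longrightarrow> \<Psi> (p * r * q) = \<Psi> 0"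
proof -
  assume "r \<in> enveloping_relations L"
  then have "r \<in> I" using I_relations by blast
  then have "p * r * q \<in> I" by (rule I_closed(6)[OF I_closed(5)])
  then have "cl (p * r * q) = cl 0" by (simp add: cl_eq_iff)
  then show ?thesis by (simp add: \<Psi>_def)
qed

text \<open>This is the balancing relation for the word \<open>[x]\<close>.\<close>

lemma \<Psi>_P: "x \<in> sl_carrier P \<Longrightarrow> \<Psi> (p * mono [x] 1) = \<Psi> (mono [] (\<chi> x) * p)"
proof -
  assume x: "x \<in> sl_carrier P"
  have "frag_of (cl (p * mono [x] 1), 1) - frag_of (cl p, word_act \<rho> (mono [x] 1) 1) \<in> H"
    by (rule H_balanced) (rule free_algebra_mono, simp add: x)
  then have 1: "frag_of (cl (p * mono [x] 1), 1) - frag_of (cl p, \<chi> x) \<in> H"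
    by (simp add: word_act_rep \<rho>_scalar)
  show ?thesis
    by (subst \<Psi>_eq_iff) (use H_closed(2)[OF 1 H_scalar[of p "\<chi> x"]] in \<open>simp add: mono_commute\<close>)
qed

end

context complex_space
begin

text \<open>The representation annihilates the ideal of \<open>L\<close>, so \<open>(x, z) \<mapsto> z \<cdot> x v0\<close> is well defined on classes \<open>x\<close>. Its
additive extension \<open>\<Phi>\<close> kills the tensor relations; for the balancing relation this uses that an element
of the free algebra on \<open>P\<close> acts on \<open>v0\<close> by the character.\<close>

theorem induced_universal:
  assumes "induced_data L P \<rho> \<chi>"
    and R_lin: "\<And>x. lin (R x)"
    and R_rel: "\<And>r v. r \<in> enveloping_relations L \<Longrightarrow> rep R r v = 0"
    and R_P: "\<And>x. x \<in> sl_carrier P \<Longrightarrow> R x v0 = \<chi> x *s v0"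
    and eq: "induced_data.\<Psi> L P \<rho> p = induced_data.\<Psi> L P \<rho> q"
  shows "rep R p v0 = rep R q v0"
proof -
  interpret induced_data L P \<rho> \<chi> by fact
  define K where "K = {i. \<forall>v. rep R i v = 0}"
  have z: "rep R p 0 = 0" for p by (rule lin_zero[OF rep_lin[OF R_lin]])
  have "ideal K FL"
    using rep_diff[of R 0]
    by (intro free_algebra_idealI) (auto simp: K_def rep_add rep_mult[OF R_lin] z)
  moreover have "enveloping_relations L \<subseteq> K" using R_rel by (auto simp: K_def)
  ultimately have "I \<subseteq> K"
    using ring.genideal_minimal[OF free_algebra_ring] unfolding enveloping_ideal_def[of L] L_UNIV by blast
  then have cl: "rep R p v = rep R q v" if "cl p = cl q" for p q v
    using that rep_diff[of R p q v] by (auto simp: cl_eq_iff K_def)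
  define g where "g = (\<lambda>(X, z :: complex). z *s rep R (SOME p. X = cl p) v0)"
  have g: "g (cl p, z) = z *s rep R p v0" for p z
  proof -
    have "cl p = cl (SOME q. cl p = cl q)" by (rule someI) (rule refl)
    from cl[OF this] show ?thesis unfolding g_def prod.case by (simp only:)
  qed
  define \<Phi> where "\<Phi> = sum_ext (\<lambda>k n. of_int n *s g k)"
  have \<Phi>_add: "\<Phi> (a + b) = \<Phi> a + \<Phi> b" for a b
    unfolding \<Phi>_def by (rule sum_ext_add) (simp_all add: scale_left_distrib)
  have \<Phi>_0: "\<Phi> 0 = 0" by (simp add: \<Phi>_def)
  have \<Phi>_diff: "\<Phi> (a - b) = \<Phi> a - \<Phi> b" for a b
    by (metis \<Phi>_add add_diff_cancel_right' diff_add_cancel)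
  have \<Phi>_of: "\<Phi> (frag_of (cl p, z)) = z *s rep R p v0" for p z
    unfolding \<Phi>_def by (subst sum_ext_single) (simp_all add: g)
  have P: "rep R q v0 = word_act \<rho> q 1 *s v0" if "q \<in> carrier FP" for q
  proof -
    have w: "foldr R w v0 = foldr \<rho> w 1 *s v0" if "set w \<subseteq> sl_carrier P" for w
      using that by (induction w) (auto simp: lin_scale[OF R_lin] R_P \<rho>_scalar mult.commute)
    have "rep R q v0 = (\<Sum>w\<in>Poly_Mapping.keys q. Poly_Mapping.lookup q w *s (foldr \<rho> w 1 *s v0))"
      unfolding rep_def sum_ext_def using that by (intro sum.cong refl) (simp add: w in_free_algebra)
    then show ?thesis by (simp add: word_act_def scale_sum_left)
  qed
  have "\<Phi> f = 0" if "f \<in> H" for f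
    using that
  proof (induction rule: H_induct)
    case (rel r)
    then consider p q z where "r = frag_of (cl (p + q), z) - frag_of (cl p, z) - frag_of (cl q, z)"
      | p y z where "r = frag_of (cl p, y + z) - frag_of (cl p, y) - frag_of (cl p, z)"
      | p q z where "r = frag_of (cl (p * q), z) - frag_of (cl p, word_act \<rho> q z)" "q \<in> carrier FP"
      unfolding rels_eq by blast
    then show ?case
    proof cases
      case 3
      then show ?thesis
        using word_act_scalar[of q z]
        by (simp add: \<Phi>_diff \<Phi>_of rep_mult[OF R_lin] P lin_scale[OF rep_lin[OF R_lin]] mult.commute)
    qed (simp_all add: \<Phi>_diff \<Phi>_of rep_add scale_right_distrib scale_left_distrib)
  qed (simp_all add: \<Phi>_0 \<Phi>_add \<Phi>_diff[of 0, simplified])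
  then have "\<Phi> (frag_of (cl p, 1) - frag_of (cl q, 1)) = 0" using eq[THEN \<Psi>_eq_iff[THEN iffD1]] by blast
  then show ?thesis by (simp add: \<Phi>_diff \<Phi>_of)
qed

end

section \<open>The bracket\<close>

context vector_space
begin

lemma sum_ext_scale_add:
  "sum_ext (\<lambda>n a. Poly_Mapping.single (h n) (scale (e n) a)) (f + g) =
    sum_ext (\<lambda>n a. Poly_Mapping.single (h n) (scale (e n) a)) f + sum_ext (\<lambda>n a. Poly_Mapping.single (h n) (scale (e n) a)) g"
  by (rule sum_ext_add) (simp_all only: scale_zero_right scale_right_distrib single_add single_zero)

lemma map_scale: "Poly_Mapping.map (scale c) f = sum_ext (\<lambda>n a. Poly_Mapping.single n (scale c a)) f"
  by (rule poly_mapping_eqI)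
    (simp add: sum_ext_def lookup_sum lookup_single map.rep_eq when_def in_keys_iff)

lemma sum_ext_scale_commute:
  "sum_ext (\<lambda>n a. Poly_Mapping.single (h n) (scale (e n) a)) (Poly_Mapping.map (scale c) f) =
    Poly_Mapping.map (scale c) (sum_ext (\<lambda>n a. Poly_Mapping.single (h n) (scale (e n) a)) f)"
  unfolding map_scale
  by (induction f rule: poly_mapping_additive_induct)
    (simp_all only: sum_ext_single scale_zero_right single_zero scale_scale sum_ext_scale_add mult.commute)

end

text \<open>Additivity of \<open>bi_sum\<close> in each argument reduces to additivity of \<open>sum_ext\<close>.\<close>

lemma bi_sum_eq: "bi_sum h f g = sum_ext (\<lambda>m x. sum_ext (\<lambda>n y. h m n x y) g) f"
  by (simp add: bi_sum_def sum_ext_def)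

lemma keys_map_subset: "Poly_Mapping.keys (Poly_Mapping.map f p) \<subseteq> Poly_Mapping.keys p"
  by (auto simp: in_keys_iff map.rep_eq)

locale biadditive_family =
  fixes h :: "int \<Rightarrow> int \<Rightarrow> 'x::ab_group_add \<Rightarrow> 'y::ab_group_add \<Rightarrow> 'z::ab_group_add"
  assumes add_left: "h m n (x + x') y = h m n x y + h m n x' y"
    and add_right: "h m n x (y + y') = h m n x y + h m n x y'"
begin

lemma zero_left [simp]: "h m n 0 y = 0" using add_left[of m n 0 0 y] by simp
lemma zero_right [simp]: "h m n x 0 = 0" using add_right[of m n x 0 0] by simp

lemma bi_sum_add_left: "bi_sum h (f + f') g = bi_sum h f g + bi_sum h f' g"
  unfolding bi_sum_eq
  by (rule sum_ext_add) (simp_all add: add_left sum_ext_def sum.distrib)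

lemma bi_sum_add_right: "bi_sum h f (g + g') = bi_sum h f g + bi_sum h f g'"
proof -
  have "sum_ext (\<lambda>n y. h m n x y) (g + g') = sum_ext (\<lambda>n y. h m n x y) g + sum_ext (\<lambda>n y. h m n x y) g'" for m x
    by (rule sum_ext_add) (simp_all add: add_right)
  then show ?thesis unfolding bi_sum_eq by (simp add: sum_ext_def sum.distrib)
qed

lemma bi_sum_uminus: "bi_sum h (- f) g = - bi_sum h f g" "bi_sum h f (- g) = - bi_sum h f g"
  using bi_sum_add_left[of "- f" f g] bi_sum_add_right[of f "- g" g]
  by (simp_all add: eq_neg_iff_add_eq_0 bi_sum_def[of _ 0] bi_sum_def[of _ _ 0])

lemma bi_sum_single [simp]: "bi_sum h (Poly_Mapping.single m x) (Poly_Mapping.single n y) = h m n x y"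
  unfolding bi_sum_eq by (subst sum_ext_single) (simp_all add: sum_ext_single sum_ext_def)

end

lemma bi_sum_zero [simp]: "bi_sum h 0 g = 0" "bi_sum h f 0 = 0"
  by (simp_all add: bi_sum_def)

lemma bi_sum_in:
  assumes "0 \<in> S" "\<And>x y. x \<in> S \<Longrightarrow> y \<in> S \<Longrightarrow> x + y \<in> S"
    and "\<And>m n x y. m \<in> Poly_Mapping.keys f \<Longrightarrow> n \<in> Poly_Mapping.keys g \<Longrightarrow> h m n x y \<in> S"
  shows "bi_sum h f g \<in> S"
proof -
  have s: "finite B \<Longrightarrow> (\<And>b. b \<in> B \<Longrightarrow> F b \<in> S) \<Longrightarrow> sum F B \<in> S" for F and B :: "int set"
    by (induction B rule: finite_induct) (auto simp: assms(1,2))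
  show ?thesis unfolding bi_sum_def by (intro s finite_keys assms(3))
qed

lemma bilinear_map_rules:
  assumes "bilinear_map sx sy sz f"
  shows "f (x + x') y = f x y + f x' y" "f x (y + y') = f x y + f x y'"
    "f (sx c x) y = sz c (f x y)" "f x (sy c y) = sz c (f x y)"
proof -
  interpret l: Vector_Spaces.linear sx sz "\<lambda>x. f x y" using assms by (simp add: bilinear_map_def)
  interpret r: Vector_Spaces.linear sy sz "f x" using assms by (simp add: bilinear_map_def)
  show "f (x + x') y = f x y + f x' y" "f x (y + y') = f x y + f x y'"
    "f (sx c x) y = sz c (f x y)" "f x (sy c y) = sz c (f x y)"
    by (simp_all add: l.add r.add l.scale r.scale)
qed

lemma gbinomial_3: "(x :: complex) gchoose 3 = x * (x - 1) * (x - 2) / 6"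
  by (simp add: gbinomial_prod_rev numeral_3_eq_3 prod.atLeast0_lessThan_Suc)

lemma gbinomial_2: "(x :: complex) gchoose 2 = x * (x - 1) / 2"
  by (simp add: gbinomial_prod_rev numeral_2_eq_2 prod.atLeast0_lessThan_Suc)

text \<open>The level \<open>l\<close> is fixed here so that \<open>V\<close> becomes part of the context.\<close>

locale vacuum_module = compatible_pair scaleA scaleU act formA formU circ
  for scaleA :: "complex \<Rightarrow> 'a::comm_ring \<Rightarrow> 'a"
    and scaleU :: "complex \<Rightarrow> 'u::ab_group_add \<Rightarrow> 'u"
    and act :: "'a \<Rightarrow> 'u \<Rightarrow> 'u"
    and formA :: "'a \<Rightarrow> 'a \<Rightarrow> complex"
    and formU :: "'u \<Rightarrow> 'u \<Rightarrow> complex"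
    and circ :: "'u \<Rightarrow> 'u \<Rightarrow> 'a" +
  fixes l :: complex
begin

abbreviation "L \<equiv> laff scaleA scaleU act formA formU circ"
abbreviation "B \<equiv> laff_bracket scaleA scaleU act formA formU circ"

lemma scaleA_mult_right: "a * scaleA c b = scaleA c (a * b)"
  by (metis A.scaleA_mult mult.commute)

lemmas scaleA_mult_left = A.scaleA_mult[symmetric]
lemmas act_rules = bilinear_map_rules[OF act_bilinear]
lemmas formA_rules = bilinear_map_rules[OF formA_bilinear]
lemmas formU_rules = bilinear_map_rules[OF formU_bilinear]
lemmas circ_rules = bilinear_map_rules[OF circ_bilinear]

definition "aa = (\<lambda>m n a b. Poly_Mapping.single (m + n - 1) (scaleA (of_int (m - n) / 2) (a * b)))"
definition "au = (\<lambda>m n a u. Poly_Mapping.single (m + n - 1) (scaleU (of_int (m - 2 * n) / 4) (act a u)))"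
definition "uu = (\<lambda>m n u v. Poly_Mapping.single (m + n) (circ u v))"
definition "aaK = (\<lambda>m n a b. if m + n - 2 = 0 then (of_int m gchoose 3) * formA a b else 0)"
definition "uuK = (\<lambda>m n u v. if m + n - 1 = 0 then of_int (m * (m - 1)) / 2 * formU u v else 0)"

lemma bracket_eq: "B (f, g, k) (f', g', k') =
    (bi_sum aa f f' + bi_sum uu g g', bi_sum au f g' - bi_sum au f' g, bi_sum aaK f f' + bi_sum uuK g g')"
  by (simp add: laff_bracket_def Let_def aa_def au_def uu_def aaK_def uuK_def)

sublocale aa: biadditive_family aa
  by unfold_locales (simp_all add: aa_def distrib_right distrib_left A.scale_right_distrib single_add)
sublocale au: biadditive_family au
  by unfold_locales (simp_all add: au_def act_rules(1,2) U.scale_right_distrib single_add)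
sublocale uu: biadditive_family uu
  by unfold_locales (simp_all add: uu_def circ_rules(1,2) single_add)
sublocale aaK: biadditive_family aaK
  by unfold_locales (simp_all add: aaK_def formA_rules(1,2) distrib_left)
sublocale uuK: biadditive_family uuK
  by unfold_locales (simp_all add: uuK_def formU_rules(1,2) distrib_left)

lemmas bi_sum_adds =
  aa.bi_sum_add_left aa.bi_sum_add_right au.bi_sum_add_left au.bi_sum_add_right uu.bi_sum_add_left uu.bi_sum_add_right
  aaK.bi_sum_add_left aaK.bi_sum_add_right uuK.bi_sum_add_left uuK.bi_sum_add_right

lemma bracket_add_left: "B (x + y) z = B x z + B y z"
  by (cases x; cases y; cases z) (simp add: bracket_eq bi_sum_adds algebra_simps)

lemma bracket_add_right: "B x (y + z) = B x y + B x z"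
  by (cases x; cases y; cases z) (simp add: bracket_eq bi_sum_adds algebra_simps)

text \<open>Identities that are additive in \<open>x\<close> need to be checked on modes and on multiples of \<open>K\<close> only.\<close>

lemma laff_induct [case_names even odd central add]:
  assumes "\<And>a n. R (mode a 0 n)" "\<And>u n. R (mode 0 u n)" "\<And>k. R (0, 0, k)" "\<And>x y. R x \<Longrightarrow> R y \<Longrightarrow> R (x + y)"
  shows "R (x :: ('a, 'u) laff)"
proof -
  obtain f g k where x: "x = (f, g, k)" by (cases x) auto
  have "R (f, 0, 0)"
  proof (induction f rule: poly_mapping_additive_induct)
    case (single n a) then show ?case using assms(1)[of a n] by (simp add: mode_def)
  next
    case (add f g) from assms(4)[OF this] show ?case by simp
  qed
  moreover have "R (0, g, 0)"
  proof (induction g rule: poly_mapping_additive_induct)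
    case (single n a) then show ?case using assms(2)[of a n] by (simp add: mode_def)
  next
    case (add f g) from assms(4)[OF this] show ?case by simp
  qed
  ultimately show ?thesis using assms(4)[OF assms(4)[of "(f, 0, 0)" "(0, g, 0)"] assms(3)[of k]] by (simp add: x)
qed

lemma bracket_even_even: "B (mode a 0 m) (mode b 0 n) =
    (Poly_Mapping.single (m + n - 1) (scaleA (of_int (m - n) / 2) (a * b)), 0,
     if m + n - 2 = 0 then (of_int m gchoose 3) * formA a b else 0)"
  by (simp add: mode_def bracket_eq) (simp add: aa_def aaK_def)

lemma bracket_even_odd: "B (mode a 0 m) (mode 0 u n) =
    (0, Poly_Mapping.single (m + n - 1) (scaleU (of_int (m - 2 * n) / 4) (act a u)), 0)"
  by (simp add: mode_def bracket_eq) (simp add: au_def)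

lemma bracket_odd_even: "B (mode 0 u n) (mode a 0 m) = - B (mode a 0 m) (mode 0 u n)"
  by (simp add: mode_def bracket_eq)

lemma bracket_odd_odd: "B (mode 0 u m) (mode 0 v n) =
    (Poly_Mapping.single (m + n) (circ u v), 0, if m + n - 1 = 0 then of_int (m * (m - 1)) / 2 * formU u v else 0)"
  by (simp add: mode_def bracket_eq) (simp add: uu_def uuK_def)

lemma bracket_central: "B (0, 0, k) x = 0" "B x (0, 0, k) = 0"
  by (cases x; simp add: bracket_eq zero_prod_def)+

text \<open>The derivation \<open>- d/dt\<close>, with \<open>v \<otimes> t\<^sup>n \<mapsto> - n v \<otimes> t\<^sup>n\<^sup>-\<^sup>1\<close> and \<open>K \<mapsto> 0\<close>.\<close>

definition derivation :: "('a, 'u) laff \<Rightarrow> ('a, 'u) laff"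
  where "derivation = (\<lambda>(f, g, k).
    (sum_ext (\<lambda>n a. Poly_Mapping.single (n - 1) (scaleA (- of_int n) a)) f,
     sum_ext (\<lambda>n u. Poly_Mapping.single (n - 1) (scaleU (- of_int n) u)) g, 0))"

lemma derivation_add: "derivation (x + y) = derivation x + derivation y"
  by (cases x; cases y)
    (simp only: derivation_def prod.case add_Pair add_0_left A.sum_ext_scale_add U.sum_ext_scale_add)

lemma derivation_single: "derivation (Poly_Mapping.single n a, Poly_Mapping.single m u, k) =
    (Poly_Mapping.single (n - 1) (scaleA (- of_int n) a), Poly_Mapping.single (m - 1) (scaleU (- of_int m) u), 0)"
  by (simp add: derivation_def sum_ext_single)

lemma derivation_mode: "derivation (mode a u n) = mode (scaleA (- of_int n) a) (scaleU (- of_int n) u) (n - 1)"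
  by (simp add: mode_def derivation_single)

lemma derivation_central: "derivation (0, 0, k) = 0"
  by (simp add: derivation_def zero_prod_def)

lemma derivation_uminus: "derivation (- x) = - derivation x"
  using derivation_add[of x "- x"] derivation_central[of 0]
  by (simp add: eq_neg_iff_add_eq_0 add.commute zero_prod_def)

lemma derivation_even: "derivation (Poly_Mapping.single n a, 0, k) = (Poly_Mapping.single (n - 1) (scaleA (- of_int n) a), 0, 0)"
  and derivation_odd: "derivation (0, Poly_Mapping.single n u, k) = (0, Poly_Mapping.single (n - 1) (scaleU (- of_int n) u), 0)"
  using derivation_single[of n a 0 0 k] derivation_single[of 0 0 n u k] by simp_all

text \<open>The equation \<open>K\<close> says that the central terms cancel; for \<open>m + n = 3\<close> it is the identity
\<open>m \<cdot> (m - 1 choose 3) + n \<cdot> (m choose 3) = 0\<close>.\<close>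

lemma derivation_bracket_even_even:
  "derivation (B (mode a 0 m) (mode b 0 n)) = B (derivation (mode a 0 m)) (mode b 0 n) + B (mode a 0 m) (derivation (mode b 0 n))"
proof -
  have c: "- of_int (m + n - 1) * (of_int (m - n) / 2) =
    of_int (m - 1 - n) / 2 * - of_int m + of_int (m - (n - 1)) / 2 * (- of_int n :: complex)"
    by (simp add: algebra_simps add_divide_distrib diff_divide_distrib)
  have K: "(if m - 1 + n - 2 = 0 then (of_int (m - 1) gchoose 3) * (- of_int m * formA a b) else 0)
    + (if m + (n - 1) - 2 = 0 then (of_int m gchoose 3) * (- of_int n * formA a b) else 0) = 0"
  proof (cases "m + n = 3")
    case True
    then have n: "n = 3 - m" by simp
    show ?thesis
      by (simp add: n gbinomial_3 algebra_simps add_divide_distrib diff_divide_distrib)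
  qed auto
  have e: "m - 1 + n - 1 = m + n - 1 - 1" "m + (n - 1) - 1 = m + n - 1 - 1" by simp_all
  show ?thesis
    unfolding derivation_mode A.scale_zero_right U.scale_zero_right bracket_even_even derivation_even
      scaleA_mult_left scaleA_mult_right A.scale_scale formA_rules add_Pair K c A.scale_left_distrib single_add e add_0_left
    by (rule refl)
qed

lemma derivation_bracket_even_odd:
  "derivation (B (mode a 0 m) (mode 0 u n)) = B (derivation (mode a 0 m)) (mode 0 u n) + B (mode a 0 m) (derivation (mode 0 u n))"
proof -
  have c: "- of_int (m + n - 1) * (of_int (m - 2 * n) / 4) =
    of_int (m - 1 - 2 * n) / 4 * - of_int m + of_int (m - 2 * (n - 1)) / 4 * (- of_int n :: complex)"
    by (simp add: algebra_simps add_divide_distrib diff_divide_distrib)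
  have e: "m - 1 + n - 1 = m + n - 1 - 1" "m + (n - 1) - 1 = m + n - 1 - 1" by simp_all
  show ?thesis
    unfolding derivation_mode A.scale_zero_right U.scale_zero_right bracket_even_odd derivation_odd
      act_rules U.scale_scale add_Pair c U.scale_left_distrib single_add e add_0_left
    by (rule refl)
qed

lemma derivation_bracket_odd_odd:
  "derivation (B (mode 0 u m) (mode 0 v n)) = B (derivation (mode 0 u m)) (mode 0 v n) + B (mode 0 u m) (derivation (mode 0 v n))"
proof -
  have c: "- of_int (m + n) = - of_int m + (- of_int n :: complex)" by simp
  have K: "(if m + n - 1 - 1 = 0 then of_int ((m - 1) * (m - 1 - 1)) / 2 * (- of_int m * formU u v) else 0)
    + (if m + n - 1 - 1 = 0 then of_int (m * (m - 1)) / 2 * (- of_int n * formU u v) else 0) = 0"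
  proof (cases "m + n = 2")
    case True
    then have n: "n = 2 - m" by simp
    show ?thesis
      by (simp add: n algebra_simps add_divide_distrib diff_divide_distrib)
  qed auto
  have e: "m - 1 + n = m + n - 1" "m + (n - 1) = m + n - 1" by simp_all
  show ?thesis
    unfolding derivation_mode A.scale_zero_right U.scale_zero_right bracket_odd_odd derivation_even
      circ_rules formU_rules add_Pair c A.scale_left_distrib single_add e add_0_left
    unfolding K by (rule refl)
qed

lemma derivation_bracket: "derivation (B x y) = B (derivation x) y + B x (derivation y)"
proof (induction x rule: laff_induct)
  case (even a m)
  show ?case
    by (induction y rule: laff_induct)
      (simp_all add: derivation_bracket_even_even derivation_bracket_even_odd bracket_central derivation_central
        derivation_central[of 0, folded zero_prod_def] bracket_add_right derivation_add bracket_central(2)[of _ 0, folded zero_prod_def])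
next
  case (odd u m)
  show ?case
  proof (induction y rule: laff_induct)
    case (even a n)
    have o: "B (derivation (mode 0 u m)) (mode a 0 n) = - B (mode a 0 n) (derivation (mode 0 u m))"
      "B (mode 0 u m) (derivation (mode a 0 n)) = - B (derivation (mode a 0 n)) (mode 0 u m)"
      by (simp_all only: derivation_mode A.scale_zero_right U.scale_zero_right bracket_odd_even)
    show ?case unfolding o bracket_odd_even derivation_uminus derivation_bracket_even_odd by simp
  qed (simp_all add: derivation_bracket_odd_odd bracket_central derivation_central
      derivation_central[of 0, folded zero_prod_def] bracket_add_right derivation_add bracket_central(2)[of _ 0, folded zero_prod_def])
next
  case (central k)
  then show ?case
    by (simp add: bracket_central derivation_central derivation_central[of 0, folded zero_prod_def]
      bracket_central(1)[of 0, folded zero_prod_def])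
next
  case (add x x')
  then show ?case by (simp add: bracket_add_left derivation_add)
qed

definition parity_involution :: "('a, 'u) laff \<Rightarrow> ('a, 'u) laff"
  where "parity_involution = (\<lambda>(f, g, k). (f, - g, k))"

lemma parity_involution_add: "parity_involution (x + y) = parity_involution x + parity_involution y"
  by (cases x; cases y) (simp add: parity_involution_def)

lemma parity_involution_bracket: "parity_involution (B x y) = B (parity_involution x) (parity_involution y)"
  by (cases x; cases y)
    (simp add: parity_involution_def bracket_eq au.bi_sum_uminus uu.bi_sum_uminus uuK.bi_sum_uminus)

lemma sl_part_L: "sl_part L 0 = {(f, 0, k) |f k. True}" "sl_part L 1 = {(0, g, 0) |g. True}"
  by (simp_all add: laff_def)

lemma sl_simps: "sl_scale L = (\<lambda>c (f, g, k). (Poly_Mapping.map (scaleA c) f, Poly_Mapping.map (scaleU c) g, c * k))"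
  "sl_bracket L = B"
  by (simp_all add: laff_def)

text \<open>The underlying space of \<open>\<L>(A, U)\<^sup>+\<close>.\<close>

definition nonneg :: "('a, 'u) laff set"
  where "nonneg = {(f, g, k). Poly_Mapping.keys f \<subseteq> {0..} \<and> Poly_Mapping.keys g \<subseteq> {0..}}"

lemma L_UNIV: "sl_carrier L = UNIV"
proof -
  have "x \<in> sl_carrier L" for x :: "('a, 'u) laff"
  proof -
    obtain f g k where x: "x = (f, g, k)" by (cases x) auto
    have "x = (f, 0, k) + (0, g, 0)" by (simp add: x)
    then show ?thesis unfolding sl_carrier_def sl_part_L by blast
  qed
  then show ?thesis by blast
qed

lemma laff_plus_simps: "sl_part (laff_plus L) \<alpha> = sl_part L \<alpha> \<inter> nonneg"
  "sl_scale (laff_plus L) = sl_scale L" "sl_bracket (laff_plus L) = B"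
  by (simp_all add: laff_plus_def nonneg_def sl_simps)

lemma nonneg_add: "x \<in> nonneg \<Longrightarrow> y \<in> nonneg \<Longrightarrow> x + y \<in> nonneg"
  using keys_add by (cases x; cases y) (fastforce simp: nonneg_def)

lemma plus_carrier: "sl_carrier (laff_plus L) = nonneg"
proof -
  have "x \<in> sl_carrier (laff_plus L)" if "x \<in> nonneg" for x
  proof -
    obtain f g k where x: "x = (f, g, k)" by (cases x) auto
    have "x = (f, 0, k) + (0, g, 0)" by (simp add: x)
    moreover have "(f, 0, k) \<in> sl_part L 0 \<inter> nonneg" "(0, g, 0) \<in> sl_part L 1 \<inter> nonneg"
      using that by (auto simp: sl_part_L nonneg_def x)
    ultimately show ?thesis unfolding sl_carrier_def laff_plus_simps by blast
  qed
  moreover have "sl_carrier (laff_plus L) \<subseteq> nonneg"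
    unfolding sl_carrier_def laff_plus_simps using nonneg_add by blast
  ultimately show ?thesis by blast
qed

lemma nonneg_scale: "x \<in> nonneg \<Longrightarrow> sl_scale L c x \<in> nonneg"
  by (cases x) (auto simp: nonneg_def sl_simps dest!: subsetD[OF keys_map_subset])

text \<open>The only product of two nonnegative modes with a negative index comes from \<open>m = n = 0\<close> and has the
coefficient zero. Central terms need \<open>m + n = 2\<close> or \<open>m + n = 1\<close>, where the binomial coefficients vanish for
nonnegative \<open>m\<close> and \<open>n\<close>.\<close>

lemma nonneg_bracket:
  assumes "x \<in> nonneg" "y \<in> nonneg"
  shows "B x y \<in> nonneg" and "snd (snd (B x y)) = 0"
proof -
  obtain f g k f' g' k' where x: "x = (f, g, k)" and y: "y = (f', g', k')" by (cases x; cases y) auto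
  have keys: "m \<ge> 0" if "m \<in> Poly_Mapping.keys f \<union> Poly_Mapping.keys f'" for m
    using assms that by (auto simp: nonneg_def x y)
  have keys': "m \<ge> 0" if "m \<in> Poly_Mapping.keys g \<union> Poly_Mapping.keys g'" for m
    using assms that by (auto simp: nonneg_def x y)
  define S :: "(int \<Rightarrow>\<^sub>0 'a) set" where "S = {f. Poly_Mapping.keys f \<subseteq> {0..}}"
  define S' :: "(int \<Rightarrow>\<^sub>0 'u) set" where "S' = {f. Poly_Mapping.keys f \<subseteq> {0..}}"
  have S: "0 \<in> S" "a \<in> S \<Longrightarrow> b \<in> S \<Longrightarrow> a + b \<in> S" for a b
    using keys_add[of a b] by (auto simp: S_def)
  have S': "0 \<in> S'" "a \<in> S' \<Longrightarrow> b \<in> S' \<Longrightarrow> a + b \<in> S'" "a \<in> S' \<Longrightarrow> - a \<in> S'" for a b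
    using keys_add[of a b] by (auto simp: S'_def)
  have "bi_sum aa f f' \<in> S"
  proof (rule bi_sum_in[OF S])
    fix m n a b assume "m \<in> Poly_Mapping.keys f" "n \<in> Poly_Mapping.keys f'"
    then have "m \<ge> 0" "n \<ge> 0" using keys by auto
    then show "aa m n a b \<in> S" by (cases "m = 0 \<and> n = 0") (auto simp: aa_def S_def)
  qed
  moreover have "bi_sum uu g g' \<in> S"
  proof (rule bi_sum_in[OF S])
    fix m n a b assume "m \<in> Poly_Mapping.keys g" "n \<in> Poly_Mapping.keys g'"
    then show "uu m n a b \<in> S" using keys' by (auto simp: uu_def S_def)
  qed
  moreover have au: "bi_sum au f g \<in> S'" if "\<And>m. m \<in> Poly_Mapping.keys f \<Longrightarrow> m \<ge> 0" "\<And>m. m \<in> Poly_Mapping.keys g \<Longrightarrow> m \<ge> 0" for f g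
  proof (rule bi_sum_in[OF S'(1,2)])
    fix m n a b assume "m \<in> Poly_Mapping.keys f" "n \<in> Poly_Mapping.keys g"
    then have "m \<ge> 0" "n \<ge> 0" using that by auto
    then show "au m n a b \<in> S'" by (cases "m = 0 \<and> n = 0") (auto simp: au_def S'_def)
  qed
  have "bi_sum au f g' \<in> S'" "bi_sum au f' g \<in> S'" using keys keys' by (auto intro!: au)
  then have "bi_sum au f g' - bi_sum au f' g \<in> S'" using S'(2)[of "bi_sum au f g'" "- bi_sum au f' g"] S'(3) by simp
  ultimately show "B x y \<in> nonneg"
    using S(2)[of "bi_sum aa f f'" "bi_sum uu g g'"] by (simp add: x y bracket_eq nonneg_def S_def S'_def)
  have "bi_sum aaK f f' \<in> {0}"
  proof (rule bi_sum_in)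
    fix m n a b assume "m \<in> Poly_Mapping.keys f" "n \<in> Poly_Mapping.keys f'"
    then have mn: "m \<ge> 0" "n \<ge> 0" using keys by auto
    have "of_int m gchoose 3 = (0 :: complex)" if "m + n = 2"
    proof -
      have "m = 0 \<or> m = 1 \<or> m = 2" using mn that by linarith
      then show ?thesis by (auto simp: gbinomial_3)
    qed
    then show "aaK m n a b \<in> {0}" by (auto simp: aaK_def)
  qed auto
  moreover have "bi_sum uuK g g' \<in> {0}"
  proof (rule bi_sum_in)
    fix m n a b assume "m \<in> Poly_Mapping.keys g" "n \<in> Poly_Mapping.keys g'"
    then have mn: "m \<ge> 0" "n \<ge> 0" using keys' by auto
    have "m * (m - 1) = 0" if "m + n = 1"
    proof -
      have "m = 0 \<or> m = 1" using mn that by linarith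
      then show ?thesis by auto
    qed
    then show "uuK m n a b \<in> {0}" by (auto simp: uuK_def)
  qed auto
  ultimately show "snd (snd (B x y)) = 0" by (simp add: x y bracket_eq)
qed

text \<open>The character by which \<open>\<L>(A, U)\<^sup>+\<close> acts on \<open>\<complex>\<^sub>\<ell>\<close>.\<close>

definition charge :: "('a, 'u) laff \<Rightarrow> complex"
  where "charge x = l * snd (snd x)"

lemma charge_simps: "charge (x + y) = charge x + charge y" "charge (sl_scale L c x) = c * charge x"
  "x \<in> sl_part L 1 \<Longrightarrow> charge x = 0"
  by (auto simp: charge_def distrib_left sl_simps sl_part_L split: prod.split)

lemma level_act_charge: "level_act l x z = charge x * z"
  by (cases x) (simp add: level_act_def charge_def)

lemma enveloping_relation_cases:
  assumes "r \<in> enveloping_relations L'"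
  obtains x y where "r = mono [x + y] 1 - mono [x] 1 - mono [y] 1" "x \<in> sl_carrier L'" "y \<in> sl_carrier L'"
  | c x where "r = mono [sl_scale L' c x] 1 - mono [x] c" "x \<in> sl_carrier L'"
  | \<alpha> \<beta> x y where "r = mono [x, y] 1 - mono [y, x] (koszul_sign \<alpha> \<beta>) - mono [sl_bracket L' x y] 1"
    "x \<in> sl_part L' \<alpha>" "y \<in> sl_part L' \<beta>"
  using assms unfolding enveloping_relations_def by blast

lemma part_plus_carrier: "x \<in> sl_part (laff_plus L) \<alpha> \<Longrightarrow> x \<in> nonneg \<and> x \<in> sl_part L \<alpha>"
  by (simp add: laff_plus_simps)

sublocale induced_data L "laff_plus L" "level_act l" charge
proof
  show "sl_carrier L = UNIV" by (rule L_UNIV)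
  show "enveloping_relations (laff_plus L) \<subseteq> enveloping_relations L"
  proof
    fix r assume "r \<in> enveloping_relations (laff_plus L)"
    then show "r \<in> enveloping_relations L"
    proof (cases rule: enveloping_relation_cases)
      case (1 x y) then show ?thesis unfolding enveloping_relations_def L_UNIV by blast
    next
      case (2 c x) then show ?thesis unfolding enveloping_relations_def L_UNIV laff_plus_simps by blast
    next
      case (3 \<alpha> \<beta> x y)
      then show ?thesis unfolding enveloping_relations_def laff_plus_simps sl_simps by blast
    qed
  qed
  show "enveloping_relations (laff_plus L) \<subseteq> carrier (free_algebra (sl_carrier (laff_plus L)))"
  proof
    fix r assume "r \<in> enveloping_relations (laff_plus L)"
    then show "r \<in> carrier (free_algebra (sl_carrier (laff_plus L)))"
    proof (cases rule: enveloping_relation_cases)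
      case (1 x y) then show ?thesis
        by (auto simp: plus_carrier nonneg_add intro!: free_algebra_diff free_algebra_mono)
    next
      case (2 c x) then show ?thesis
        by (auto simp: plus_carrier nonneg_scale laff_plus_simps intro!: free_algebra_diff free_algebra_mono)
    next
      case (3 \<alpha> \<beta> x y)
      then show ?thesis
        using part_plus_carrier[OF 3(2)] part_plus_carrier[OF 3(3)]
        by (auto simp: plus_carrier nonneg_bracket laff_plus_simps intro!: free_algebra_diff free_algebra_mono)
    qed
  qed
  show "level_act l x z = charge x * z" for x z by (rule level_act_charge)
  show "word_act (level_act l) r z = 0" if "r \<in> enveloping_relations (laff_plus L)" for r z
    using that
  proof (cases rule: enveloping_relation_cases)
    case (1 x y) then show ?thesis
      by (simp add: word_act_rep complex_self.rep_diff level_act_charge charge_simps distrib_right)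
  next
    case (2 c x) then show ?thesis
      by (simp add: word_act_rep complex_self.rep_diff level_act_charge charge_simps laff_plus_simps)
  next
    case (3 \<alpha> \<beta> x y)
    have "charge (B x y) = 0"
      using part_plus_carrier[OF 3(2)] part_plus_carrier[OF 3(3)] by (simp add: charge_def nonneg_bracket)
    moreover have "charge x * charge y = koszul_sign \<alpha> \<beta> * (charge y * charge x)"
    proof (cases "koszul_sign \<alpha> \<beta> = 1")
      case False
      then have "\<alpha> = 1" by (auto simp: koszul_sign_def split: if_splits)
      then show ?thesis using part_plus_carrier[OF 3(2)] charge_simps(3) by auto
    qed simp
    ultimately show ?thesis
      by (auto simp: 3(1) word_act_rep complex_self.rep_diff level_act_charge laff_plus_simps)
  qed
qed

end

section \<open>The vacuum module as a space of representatives\<close>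

text \<open>The difference operator lowers the degree of a polynomial in \<open>k\<close> with coefficients that depend on
\<open>k + n\<close> only. In the basis of binomial coefficients it lowers the index.\<close>

lemma (in complex_space) polynomial_commutator_local:
  assumes "\<And>w k n. F k (G n w) - \<epsilon> *s G n (F k w) = (\<Sum>j<N. (of_int k gchoose j) *s Z w j (k + n))"
  shows "mutually_local \<epsilon> F G"
proof -
  have step: "shift_diff (\<lambda>k n. (of_int k gchoose Suc j) *s X (k + n)) = (\<lambda>k n. (of_int k gchoose j) *s X (k + n + 1))"
    for j and X :: "int \<Rightarrow> 'v"
  proof (intro ext)
    fix k n :: int
    have e: "k + 1 + n = k + n + 1" "k + (n + 1) = k + n + 1" by simp_all
    show "shift_diff (\<lambda>k n. (of_int k gchoose Suc j) *s X (k + n)) k n = (of_int k gchoose j) *s X (k + n + 1)"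
      unfolding shift_diff_def e scale_left_diff_distrib[symmetric]
      by (simp add: gbinomial_Suc_Suc)
  qed
  have mono: "(shift_diff ^^ Suc j) (\<lambda>k n. (of_int k gchoose j) *s X (k + n)) = (\<lambda>k n. 0)" for j and X :: "int \<Rightarrow> 'v"
  proof (induction j arbitrary: X)
    case 0
    show ?case by (simp add: fun_eq_iff shift_diff_def add.commute add.left_commute)
  next
    case (Suc j)
    show ?case using Suc[of "\<lambda>s. X (s + 1)"] by (simp only: funpow_Suc_right o_apply step)
  qed
  have "(shift_diff ^^ M) (\<lambda>k n. \<Sum>j<N'. (of_int k gchoose j) *s Z w j (k + n)) = (\<lambda>k n. 0)" if "N' \<le> M" for w M N'
    using that
  proof (induction N')
    case 0
    then show ?case by (simp add: shift_diff_funpow_zero)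
  next
    case (Suc N')
    then show ?case
      using shift_diff_funpow_mono[OF mono[of N' "Z w N'"], of M] by (simp add: shift_diff_funpow_add del: funpow.simps)
  qed
  then show ?thesis unfolding mutually_local_def assms by blast
qed

lemma complex_space_prod:
  assumes "complex_space s" "complex_space t"
  shows "complex_space (\<lambda>c (v, w). (s c v, t c w))"
proof -
  interpret s: complex_space s by fact
  interpret t: complex_space t by fact
  show ?thesis
    by unfold_locales (auto simp: s.scale_right_distrib s.scale_left_distrib t.scale_right_distrib t.scale_left_distrib)
qed

context vacuum_module
begin

abbreviation fscale :: "complex \<Rightarrow> (('a, 'u) laff list \<Rightarrow>\<^sub>0 complex) \<Rightarrow> (('a, 'u) laff list \<Rightarrow>\<^sub>0 complex)" (infixr "*f" 75)
  where "c *f p \<equiv> mono [] c * p"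

lemma \<Psi>_zero_closed:
  "\<Psi> p = \<Psi> 0 \<Longrightarrow> \<Psi> q = \<Psi> 0 \<Longrightarrow> \<Psi> (p + q) = \<Psi> 0"
  "\<Psi> p = \<Psi> 0 \<Longrightarrow> \<Psi> (c *f p) = \<Psi> 0"
  by (metis V_add add_0_left, metis V_smult mult_zero_right)

text \<open>The identity minus a linear projection onto the kernel of \<open>\<Psi>\<close>.\<close>

lemma exists_projection: "\<exists>\<pi>. free.lin \<pi> \<and> (\<forall>p. \<Psi> (\<pi> p) = \<Psi> p) \<and> (\<forall>p. \<Psi> p = \<Psi> 0 \<longrightarrow> \<pi> p = 0)"
proof -
  let ?N = "{p. \<Psi> p = \<Psi> 0}"
  interpret vsp: vector_space_pair "(*f)" "(*f)" ..
  have N: "free.subspace ?N" by (auto simp: free.subspace_def \<Psi>_zero_closed)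
  have "\<exists>g. range g \<subseteq> ?N \<and> Vector_Spaces.linear (*f) (*f) g \<and> (\<forall>v\<in>?N. g (id v) = v)"
    by (rule vsp.linear_exists_left_inverse_on[OF free.linear_id N]) simp
  then obtain g where g: "range g \<subseteq> ?N" "Vector_Spaces.linear (*f) (*f) g" "\<And>v. v \<in> ?N \<Longrightarrow> g v = v" by auto
  interpret g: Vector_Spaces.linear "(*f)" "(*f)" g by fact
  have "free.lin (\<lambda>p. p - g p)"
    by (rule free.linI) (simp_all only: g.add g.scale free.scale_right_diff_distrib add_diff_add)
  moreover have "\<Psi> (p - g p) = \<Psi> p" for p
  proof -
    have "\<Psi> (- 1 *f g p) = \<Psi> 0" using g(1) by (intro \<Psi>_zero_closed(2)) auto
    then show ?thesis using \<Psi>_eq_iff_diff[of "p - g p" p] by (simp add: single_uminus mono_Nil_1)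
  qed
  moreover have "p - g p = 0" if "\<Psi> p = \<Psi> 0" for p using g(3)[of p] that by simp
  ultimately show ?thesis by (intro exI[of _ "\<lambda>p. p - g p"]) blast
qed

definition \<pi> :: "(('a, 'u) laff list \<Rightarrow>\<^sub>0 complex) \<Rightarrow> (('a, 'u) laff list \<Rightarrow>\<^sub>0 complex)"
  where "\<pi> = (SOME \<pi>. free.lin \<pi> \<and> (\<forall>p. \<Psi> (\<pi> p) = \<Psi> p) \<and> (\<forall>p. \<Psi> p = \<Psi> 0 \<longrightarrow> \<pi> p = 0))"

lemma \<pi>: "free.lin \<pi>" "\<Psi> (\<pi> p) = \<Psi> p" "\<Psi> p = \<Psi> 0 \<Longrightarrow> \<pi> p = 0"
  using someI_ex[OF exists_projection, folded \<pi>_def] by auto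

lemma \<pi>_eq_iff: "\<pi> p = \<pi> q \<longleftrightarrow> \<Psi> p = \<Psi> q"
proof
  assume "\<pi> p = \<pi> q"
  then show "\<Psi> p = \<Psi> q" by (metis \<pi>(2))
next
  assume "\<Psi> p = \<Psi> q"
  then have "\<pi> (p - q) = 0" using \<pi>(3)[of "p - q"] \<Psi>_eq_iff_diff[of p q] by blast
  then show "\<pi> p = \<pi> q" by (simp add: free.lin_diff[OF \<pi>(1)])
qed

lemma \<pi>_idem [simp]: "\<pi> (\<pi> p) = \<pi> p" by (simp add: \<pi>_eq_iff \<pi>(2))

definition M :: "(('a, 'u) laff list \<Rightarrow>\<^sub>0 complex) set" where "M = range \<pi>"

lemma M_iff: "p \<in> M \<longleftrightarrow> \<pi> p = p" by (auto simp: M_def) (rule range_eqI, erule sym)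

text \<open>The action of \<open>x\<close> on representatives. It is defined on the whole free algebra and factors through
\<open>\<pi>\<close>.\<close>

definition op :: "('a, 'u) laff \<Rightarrow> (('a, 'u) laff list \<Rightarrow>\<^sub>0 complex) \<Rightarrow> (('a, 'u) laff list \<Rightarrow>\<^sub>0 complex)"
  where "op x p = \<pi> (mono [x] 1 * p)"

text \<open>The representative of the vacuum.\<close>

definition one :: "('a, 'u) laff list \<Rightarrow>\<^sub>0 complex" where "one = \<pi> 1"

lemma op_lin: "free.lin (op x)"
  unfolding op_def
proof (rule free.linI)
  fix p q c
  show "\<pi> (mono [x] 1 * (p + q)) = \<pi> (mono [x] 1 * p) + \<pi> (mono [x] 1 * q)"
    by (simp add: distrib_left free.lin_add[OF \<pi>(1)])
  have "mono [x] 1 * (c *f p) = c *f (mono [x] 1 * p)" by (simp flip: mult.assoc)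
  then show "\<pi> (mono [x] 1 * (c *f p)) = c *f \<pi> (mono [x] 1 * p)" by (simp only: free.lin_scale[OF \<pi>(1)])
qed

lemma op_\<pi>: "op x (\<pi> p) = \<pi> (mono [x] 1 * p)"
  unfolding op_def \<pi>_eq_iff lie_act[symmetric] by (simp only: \<pi>(2))

lemma op_projection: "op x (\<pi> p) = op x p"
  by (simp only: op_\<pi> op_def[of x p])

lemma op_M: "op x p \<in> M" by (simp add: op_def M_def)

lemma op_op: "op x (op y p) = \<pi> (mono [x, y] 1 * p)"
  unfolding op_def[of y] op_\<pi> by (simp flip: mult.assoc)

lemma one_M: "one \<in> M" by (simp add: one_def M_def)

lemma \<pi>_relation: "r \<in> enveloping_relations L \<Longrightarrow> \<pi> (r * p) = 0"
  by (rule \<pi>(3)) (use \<Psi>_relation[of r 1 p] in simp)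

lemma op_add_left: "op (x + y) p = op x p + op y p"
proof -
  have "mono [x + y] 1 - mono [x] 1 - mono [y] 1 \<in> enveloping_relations L"
    unfolding enveloping_relations_def L_UNIV by blast
  from \<pi>_relation[OF this, of p] show ?thesis
    by (simp add: op_def left_diff_distrib free.lin_diff[OF \<pi>(1)] distrib_right free.lin_add[OF \<pi>(1)] diff_diff_eq)
qed

lemma op_scale_left: "op (sl_scale L c x) p = c *f op x p"
proof -
  have "mono [sl_scale L c x] 1 - mono [x] c \<in> enveloping_relations L"
    unfolding enveloping_relations_def L_UNIV by blast
  from \<pi>_relation[OF this, of p] have "\<pi> (mono [sl_scale L c x] 1 * p) = \<pi> (mono [x] c * p)"
    by (simp add: left_diff_distrib free.lin_diff[OF \<pi>(1)])
  also have "mono [x] c * p = c *f (mono [x] 1 * p)" by (simp flip: mult.assoc)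
  finally show ?thesis by (simp only: op_def free.lin_scale[OF \<pi>(1)])
qed

lemma op_bracket:
  assumes "x \<in> sl_part L \<alpha>" "y \<in> sl_part L \<beta>"
  shows "op x (op y p) - koszul_sign \<alpha> \<beta> *f op y (op x p) = op (B x y) p"
proof -
  have "mono [x, y] 1 - mono [y, x] (koszul_sign \<alpha> \<beta>) - mono [B x y] 1 \<in> enveloping_relations L"
    unfolding enveloping_relations_def sl_simps(2)[symmetric] using assms by blast
  from \<pi>_relation[OF this, of p]
  have "\<pi> (mono [x, y] 1 * p) - \<pi> (mono [y, x] (koszul_sign \<alpha> \<beta>) * p) = \<pi> (mono [B x y] 1 * p)"
    by (simp add: left_diff_distrib free.lin_diff[OF \<pi>(1)])
  moreover have "mono [y, x] (koszul_sign \<alpha> \<beta>) * p = koszul_sign \<alpha> \<beta> *f (mono [y, x] 1 * p)"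
    by (simp flip: mult.assoc)
  ultimately show ?thesis by (simp only: op_op op_def[of "B x y"] free.lin_scale[OF \<pi>(1)])
qed

lemma op_one: "x \<in> nonneg \<Longrightarrow> op x one = charge x *f one"
proof -
  assume "x \<in> nonneg"
  then have "\<Psi> (1 * mono [x] 1) = \<Psi> (charge x *f 1)" by (intro \<Psi>_P) (simp add: plus_carrier)
  then have "\<pi> (mono [x] 1 * 1) = \<pi> (charge x *f 1)" by (simp add: \<pi>_eq_iff)
  then show ?thesis by (simp only: one_def op_\<pi> free.lin_scale[OF \<pi>(1)])
qed

lemma op_zero_left: "op 0 p = 0" using op_add_left[of 0 0 p] by simp

lemma \<pi>_word: "\<pi> (mono w 1) = foldr op w one"
proof (induction w)
  case Nil
  then show ?case by (simp add: one_def mono_Nil_1)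
next
  case (Cons x w)
  have "\<pi> (mono (x # w) 1) = \<pi> (mono [x] 1 * mono w 1)" by simp
  also have "\<dots> = op x (\<pi> (mono w 1))" by (simp only: op_\<pi>)
  finally show ?case using Cons by simp
qed

lemma M_induct_word [consumes 1, case_names word add scale]:
  assumes "p \<in> M" "\<And>w. R (foldr op w one)" "\<And>p q. R p \<Longrightarrow> R q \<Longrightarrow> R (p + q)" "\<And>c p. R p \<Longrightarrow> R (c *f p)"
  shows "R p"
proof -
  have "R (\<pi> q)" for q
  proof (induction q rule: poly_mapping_additive_induct)
    case (single w c)
    have "mono w c = c *f mono w 1" by simp
    then have "\<pi> (mono w c) = c *f foldr op w one" by (simp only: free.lin_scale[OF \<pi>(1)] \<pi>_word)
    then show ?case using assms(2,4) by simp
  next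
    case (add f g) then show ?case using assms(3) by (simp add: free.lin_add[OF \<pi>(1)])
  qed
  then show ?thesis using assms(1) by (auto simp: M_def)
qed

text \<open>\<open>K\<close> commutes with all letters and acts on the vacuum by \<open>l\<close>, so it acts by \<open>l\<close> on all words.\<close>

lemma central_scalar: "op (0, 0, k) p = (l * k) *f \<pi> p"
proof -
  have c: "(0, 0, k) \<in> sl_part L 0" by (simp add: sl_part_L)
  have comm0: "op (0, 0, k) (op y q) = op y (op (0, 0, k) q)" if "y \<in> sl_part L \<beta>" for y \<beta> q
    using op_bracket[OF c that, of q] by (simp add: bracket_central op_zero_left koszul_sign_zero mono_Nil_1)
  have comm: "op (0, 0, k) (op y q) = op y (op (0, 0, k) q)" for y q
  proof -
    obtain f g k' where y: "y = (f, g, k')" by (cases y) auto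
    have eq: "y = (f, 0, k') + (0, g, 0)" by (simp add: y)
    have "(f, 0, k') \<in> sl_part L 0" "(0, g, 0) \<in> sl_part L 1" by (auto simp: sl_part_L)
    from this[THEN comm0] show ?thesis by (simp only: eq op_add_left free.lin_add[OF op_lin])
  qed
  have "op (0, 0, k) q = (l * k) *f q" if "q \<in> M" for q
    using that
  proof (induction rule: M_induct_word)
    case (word w)
    show "op (0, 0, k) (foldr op w one) = (l * k) *f foldr op w one"
    proof (induction w)
      case Nil
      have "(0, 0, k) \<in> nonneg" by (simp add: nonneg_def)
      from op_one[OF this] show ?case by (simp add: charge_def)
    next
      case (Cons x w) then show ?case by (simp only: foldr.simps o_apply comm free.lin_scale[OF op_lin])
    qed
  next
    case (add p q) then show ?case by (simp only: free.lin_add[OF op_lin] distrib_left)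
  next
    case (scale c p) then show ?case by (simp only: free.lin_scale[OF op_lin] free.scale_left_commute)
  qed
  from this[of "\<pi> p"] show ?thesis by (simp add: op_projection M_def)
qed

text \<open>The space is generated from the vacuum by modes: a letter is a sum of modes and of a multiple of
\<open>K\<close>, which acts by a scalar.\<close>

lemma M_induct [consumes 1, case_names one add scale even odd]:
  assumes "p \<in> M" "R one" "\<And>p q. R p \<Longrightarrow> R q \<Longrightarrow> R (p + q)" "\<And>c p. R p \<Longrightarrow> R (c *f p)"
    and even: "\<And>a n p. p \<in> M \<Longrightarrow> R p \<Longrightarrow> R (op (mode a 0 n) p)"
    and odd: "\<And>u n p. p \<in> M \<Longrightarrow> R p \<Longrightarrow> R (op (mode 0 u n) p)"
  shows "R p"
proof -
  have M: "foldr op w one \<in> M" for w by (cases w) (auto simp: one_M op_M)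
  have op: "R (op x p)" if "R p" "p \<in> M" for x p
  proof (induction x rule: laff_induct)
    case (central k)
    then show ?case using that by (simp add: central_scalar M_iff assms(4))
  qed (use that even odd assms(3) in \<open>auto simp: op_add_left\<close>)
  have "R (foldr op w one)" for w
    by (induction w) (auto simp: assms(2) op M)
  with assms(1) show ?thesis by (rule M_induct_word) (fact assms(3,4))+
qed


section \<open>Parity and translation\<close>

lemma sl_scale_rules:
  "derivation (sl_scale L c x) = sl_scale L c (derivation x)"
  "parity_involution (sl_scale L c x) = sl_scale L c (parity_involution x)"
proof -
  obtain f g k where x: "x = (f, g, k)" by (cases x) auto
  show "derivation (sl_scale L c x) = sl_scale L c (derivation x)"
    by (simp only: x sl_simps derivation_def prod.case A.sum_ext_scale_commute U.sum_ext_scale_commute mult_zero_right)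
  have "Poly_Mapping.map (scaleU c) (- g) = - Poly_Mapping.map (scaleU c) g"
    by (rule poly_mapping_eqI) (simp add: map.rep_eq when_def)
  then show "parity_involution (sl_scale L c x) = sl_scale L c (parity_involution x)"
    by (simp add: x sl_simps parity_involution_def)
qed

lemma even_part_iff: "x \<in> sl_part L 0 \<longleftrightarrow> fst (snd x) = 0" and odd_part_iff: "x \<in> sl_part L 1 \<longleftrightarrow> fst x = 0 \<and> snd (snd x) = 0"
  by (cases x; auto simp: sl_part_L)+

lemma derivation_part: "x \<in> sl_part L \<alpha> \<Longrightarrow> derivation x \<in> sl_part L \<alpha>"
  by (cases \<alpha>; cases x) (auto simp: even_part_iff odd_part_iff derivation_def)

lemma parity_involution_part: "x \<in> sl_part L \<alpha> \<Longrightarrow> parity_involution x \<in> sl_part L \<alpha>"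
  by (cases \<alpha>; cases x) (auto simp: even_part_iff odd_part_iff parity_involution_def)

lemma nonneg_derivation: "x \<in> nonneg \<Longrightarrow> derivation x \<in> nonneg" and charge_derivation: "charge (derivation x) = 0"
proof -
  obtain f g k where x: "x = (f, g, k)" by (cases x) auto
  show "charge (derivation x) = 0" by (simp add: x charge_def derivation_def)
  assume "x \<in> nonneg"
  then have k: "\<And>n. n \<in> Poly_Mapping.keys f \<Longrightarrow> n \<ge> 0" "\<And>n. n \<in> Poly_Mapping.keys g \<Longrightarrow> n \<ge> 0"
    by (auto simp: nonneg_def x)
  have s1: "Poly_Mapping.keys (Poly_Mapping.single (n - 1) (scaleA (- of_int n) a)) \<subseteq> {0..}" if "n \<ge> 0" for n a
    using that by (cases "n = 0") auto
  have 1: "Poly_Mapping.keys (sum_ext (\<lambda>n a. Poly_Mapping.single (n - 1) (scaleA (- of_int n) a)) f) \<subseteq> {0..}"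
    unfolding sum_ext_def by (rule order_trans[OF keys_sum], rule UN_least, rule s1, rule k(1))
  have s2: "Poly_Mapping.keys (Poly_Mapping.single (n - 1) (scaleU (- of_int n) a)) \<subseteq> {0..}" if "n \<ge> 0" for n a
    using that by (cases "n = 0") auto
  have 2: "Poly_Mapping.keys (sum_ext (\<lambda>n a. Poly_Mapping.single (n - 1) (scaleU (- of_int n) a)) g) \<subseteq> {0..}"
    unfolding sum_ext_def by (rule order_trans[OF keys_sum], rule UN_least, rule s2, rule k(2))
  show "derivation x \<in> nonneg" using 1 2 by (simp add: x nonneg_def derivation_def)
qed

lemma nonneg_parity_involution: "x \<in> nonneg \<Longrightarrow> parity_involution x \<in> nonneg"
  and charge_parity_involution: "charge (parity_involution x) = charge x"
  by (cases x; simp add: nonneg_def parity_involution_def charge_def)+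

text \<open>The involution of \<open>\<L>(A, U)\<close> that changes the sign of the odd part, lifted to words.\<close>

definition parity :: "(('a, 'u) laff list \<Rightarrow>\<^sub>0 complex) \<Rightarrow> (('a, 'u) laff list \<Rightarrow>\<^sub>0 complex)"
  where "parity p = free.rep (\<lambda>x. op (parity_involution x)) p one"

text \<open>Twisting the action by an automorphism that fixes the character gives another instance of the
universal property.\<close>

lemma parity_cong: "\<pi> p = \<pi> q \<Longrightarrow> parity p = parity q"
  unfolding parity_def
proof (rule free.induced_universal[OF induced_data_axioms])
  show "free.lin (op (parity_involution x))" for x by (rule op_lin)
  show "op (parity_involution x) one = charge x *f one" if "x \<in> sl_carrier (laff_plus L)" for x
    using op_one[OF nonneg_parity_involution] that by (simp add: plus_carrier charge_parity_involution)
  show "\<pi> p = \<pi> q \<Longrightarrow> \<Psi> p = \<Psi> q" by (simp add: \<pi>_eq_iff)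
  show "free.rep (\<lambda>x. op (parity_involution x)) r v = 0" if "r \<in> enveloping_relations L" for r v
    using that
  proof (cases rule: enveloping_relation_cases)
    case (1 x y)
    then show ?thesis by (simp add: free.rep_diff parity_involution_add op_add_left mono_Nil_1)
  next
    case (2 c x)
    then show ?thesis by (simp add: free.rep_diff sl_scale_rules op_scale_left mono_Nil_1)
  next
    case (3 \<alpha> \<beta> x y)
    show ?thesis
      using op_bracket[OF parity_involution_part[OF 3(2)] parity_involution_part[OF 3(3)], of v]
      by (simp add: 3(1) free.rep_diff sl_simps(2) parity_involution_bracket mono_Nil_1)
  qed
qed

lemma parity_one: "parity one = one"
proof -
  have "parity one = parity (mono [] 1)" by (rule parity_cong) (simp add: one_def mono_Nil_1)
  also have "\<dots> = one" by (simp add: parity_def)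
  finally show ?thesis .
qed

lemma parity_lin: "free.lin parity"
proof (rule free.linI)
  show "parity (p + q) = parity p + parity q" for p q by (simp add: parity_def free.rep_add)
  show "parity (c *f p) = c *f parity p" for c p
    by (simp add: parity_def free.rep_mult[OF op_lin])
qed

lemma parity_op: "parity (op x p) = op (parity_involution x) (parity p)"
proof -
  have "parity (op x p) = parity (mono [x] 1 * p)" by (rule parity_cong) (simp add: op_def)
  then show ?thesis by (simp add: parity_def free.rep_mult[OF op_lin] mono_Nil_1)
qed

definition pscale :: "complex \<Rightarrow> (('a, 'u) laff list \<Rightarrow>\<^sub>0 complex) \<times> (('a, 'u) laff list \<Rightarrow>\<^sub>0 complex) \<Rightarrow> _"
  where "pscale = (\<lambda>c (v, w). (c *f v, c *f w))"

sublocale pair: complex_space pscale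
  unfolding pscale_def by (rule complex_space_prod) (rule free.complex_space_axioms)+

text \<open>An operator \<open>T\<close> with \<open>T x = x T + derivation x\<close> amounts to a homomorphism \<open>v \<mapsto> (v, T v)\<close> into pairs with
this action, which is the action over the dual numbers.\<close>

definition pair_op :: "('a, 'u) laff \<Rightarrow> (('a, 'u) laff list \<Rightarrow>\<^sub>0 complex) \<times> (('a, 'u) laff list \<Rightarrow>\<^sub>0 complex) \<Rightarrow> _"
  where "pair_op = (\<lambda>x (v, w). (op x v, op x w + op (derivation x) v))"

lemma pair_op_lin: "pair.lin (pair_op x)"
proof (rule pair.linI)
  show "pair_op x (v + w) = pair_op x v + pair_op x w" for v w
    by (cases v; cases w) (simp add: pair_op_def free.lin_add[OF op_lin])
  show "pair_op x (pscale c v) = pscale c (pair_op x v)" for c v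
    by (cases v) (simp only: pair_op_def pscale_def prod.case free.lin_scale[OF op_lin] distrib_left)
qed

definition translation :: "(('a, 'u) laff list \<Rightarrow>\<^sub>0 complex) \<Rightarrow> (('a, 'u) laff list \<Rightarrow>\<^sub>0 complex)"
  where "translation p = snd (pair.rep pair_op p (one, 0))"

lemma pair_rep_fst: "fst (pair.rep pair_op p (one, 0)) = \<pi> p"
proof (induction p rule: poly_mapping_additive_induct)
  case (single w c)
  have "fst (foldr pair_op w (one, 0)) = foldr op w one"
    by (induction w) (auto simp: pair_op_def split: prod.split)
  moreover have "fst (pscale c v) = c *f fst v" for v by (cases v) (simp add: pscale_def)
  moreover have "mono w c = c *f mono w 1" by simp
  then have "\<pi> (mono w c) = c *f foldr op w one" by (simp only: free.lin_scale[OF \<pi>(1)] \<pi>_word)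
  ultimately show ?case by simp
qed (simp add: pair.rep_add free.lin_add[OF \<pi>(1)])

text \<open>In the second component the relation for the bracket is the Leibniz rule \<open>derivation_bracket\<close>.\<close>

lemma pair_rep_cong: "\<pi> p = \<pi> q \<Longrightarrow> pair.rep pair_op p (one, 0) = pair.rep pair_op q (one, 0)"
proof (rule pair.induced_universal[OF induced_data_axioms])
  show "pair.lin (pair_op x)" for x by (rule pair_op_lin)
  show "pair_op x (one, 0) = pscale (charge x) (one, 0)" if "x \<in> sl_carrier (laff_plus L)" for x
    using that by (simp add: pair_op_def pscale_def plus_carrier op_one free.lin_zero[OF op_lin]
        nonneg_derivation charge_derivation)
  show "\<pi> p = \<pi> q \<Longrightarrow> \<Psi> p = \<Psi> q" by (simp add: \<pi>_eq_iff)
  have s: "pscale 1 v = v" for v by (rule pair.scale_one)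
  show "pair.rep pair_op r v = 0" if "r \<in> enveloping_relations L" for r v
    using that
  proof (cases rule: enveloping_relation_cases)
    case (1 x y)
    obtain v1 v2 where v: "v = (v1, v2)" by (cases v)
    show ?thesis
      by (simp add: 1 v pair.rep_diff s) (simp add: pair_op_def op_add_left derivation_add zero_prod_def)
  next
    case (2 c x)
    obtain v1 v2 where v: "v = (v1, v2)" by (cases v)
    show ?thesis
      by (simp add: 2 v pair.rep_diff s)
        (simp add: pair_op_def pscale_def op_scale_left sl_scale_rules zero_prod_def distrib_left)
  next
    case (3 \<alpha> \<beta> x y)
    obtain v1 v2 where v: "v = (v1, v2)" by (cases v)
    note p = 3(2) 3(3) derivation_part[OF 3(2)] derivation_part[OF 3(3)]
    have a: "op x (op y u) = koszul_sign \<alpha> \<beta> *f op y (op x u) + op (B x y) u" for u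
      using op_bracket[OF p(1,2), of u] by (simp add: algebra_simps)
    have b: "op (derivation x) (op y u) = koszul_sign \<alpha> \<beta> *f op y (op (derivation x) u) + op (B (derivation x) y) u" for u
      using op_bracket[OF p(3,2), of u] by (simp add: algebra_simps)
    have c: "op x (op (derivation y) u) = koszul_sign \<alpha> \<beta> *f op (derivation y) (op x u) + op (B x (derivation y)) u" for u
      using op_bracket[OF p(1,4), of u] by (simp add: algebra_simps)
    show ?thesis
      by (simp add: 3(1) v pair.rep_diff s sl_simps(2))
        (simp add: pair_op_def pscale_def zero_prod_def free.lin_add[OF op_lin] derivation_bracket op_add_left
          a b c distrib_left)
  qed
qed

lemma translation_op: "translation (op x p) = op x (translation p) + op (derivation x) p"
proof -
  have "translation (op x p) = snd (pair.rep pair_op (mono [x] 1 * p) (one, 0))"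
    unfolding translation_def by (subst pair_rep_cong[of "op x p" "mono [x] 1 * p"]) (simp_all add: op_def)
  also have "\<dots> = snd (pair_op x (pair.rep pair_op p (one, 0)))"
    by (simp add: pair.rep_mult[OF pair_op_lin])
  also have "\<dots> = op x (translation p) + op (derivation x) (\<pi> p)"
    using pair_rep_fst[of p] by (simp add: pair_op_def translation_def split: prod.split) (metis fst_conv)
  finally show ?thesis by (simp only: op_projection)
qed

lemma translation_one: "translation one = 0"
proof -
  have "pair.rep pair_op one (one, 0) = pair.rep pair_op (mono [] 1) (one, 0)"
    by (rule pair_rep_cong) (simp add: one_def mono_Nil_1)
  then show ?thesis by (simp add: translation_def)
qed

lemma translation_lin: "free.lin translation"
proof (rule free.linI)
  have s: "snd (pscale c v) = c *f snd v" for c v by (cases v) (simp add: pscale_def)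
  show "translation (p + q) = translation p + translation q" for p q by (simp add: translation_def pair.rep_add)
  show "translation (c *f p) = c *f translation p" for c p
    by (simp add: translation_def pair.rep_mult[OF pair_op_lin] s)
qed

section \<open>The generating fields\<close>

lemma mode_scale: "mode (scaleA c a) 0 n = sl_scale L c (mode a 0 n)" "mode 0 (scaleU c u) n = sl_scale L c (mode 0 u n)"
  by (simp_all add: mode_def sl_simps map_eq_zero_iff)

lemma op_mode_scale: "op (mode (scaleA c a) 0 n) p = c *f op (mode a 0 n) p"
  "op (mode 0 (scaleU c u) n) p = c *f op (mode 0 u n) p"
  by (simp_all only: mode_scale op_scale_left)

lemma mode_part: "mode a 0 n \<in> sl_part L 0" "mode 0 u n \<in> sl_part L 1"
  by (simp_all add: mode_def even_part_iff odd_part_iff)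

lemma op_even_even:
  "op (mode a 0 m) (op (mode b 0 n) p) = op (mode b 0 n) (op (mode a 0 m) p) +
    (of_int (m - n) / 2) *f op (mode (a * b) 0 (m + n - 1)) p +
    (l * (if m + n - 2 = 0 then (of_int m gchoose 3) * formA a b else 0)) *f \<pi> p"
proof -
  have "B (mode a 0 m) (mode b 0 n) = mode (scaleA (of_int (m - n) / 2) (a * b)) 0 (m + n - 1) +
    (0, 0, if m + n - 2 = 0 then (of_int m gchoose 3) * formA a b else 0)"
    unfolding bracket_even_even by (simp add: mode_def)
  then have "op (B (mode a 0 m) (mode b 0 n)) p = (of_int (m - n) / 2) *f op (mode (a * b) 0 (m + n - 1)) p +
    (l * (if m + n - 2 = 0 then (of_int m gchoose 3) * formA a b else 0)) *f \<pi> p"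
    by (simp only: op_add_left op_mode_scale central_scalar)
  moreover have "op (mode a 0 m) (op (mode b 0 n) p) - op (mode b 0 n) (op (mode a 0 m) p) = op (B (mode a 0 m) (mode b 0 n)) p"
    using op_bracket[OF mode_part(1) mode_part(1), of a m b n p] by (simp only: koszul_sign_zero free.scale_one)
  ultimately show ?thesis by (simp only: diff_eq_eq add.commute add.left_commute)
qed

lemma op_even_odd:
  "op (mode a 0 m) (op (mode 0 u n) p) = op (mode 0 u n) (op (mode a 0 m) p) +
    (of_int (m - 2 * n) / 4) *f op (mode 0 (act a u) (m + n - 1)) p"
proof -
  have "B (mode a 0 m) (mode 0 u n) = mode 0 (scaleU (of_int (m - 2 * n) / 4) (act a u)) (m + n - 1)"
    unfolding bracket_even_odd by (simp add: mode_def)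
  then have "op (B (mode a 0 m) (mode 0 u n)) p = (of_int (m - 2 * n) / 4) *f op (mode 0 (act a u) (m + n - 1)) p"
    by (simp only: op_mode_scale)
  moreover have "op (mode a 0 m) (op (mode 0 u n) p) - op (mode 0 u n) (op (mode a 0 m) p) = op (B (mode a 0 m) (mode 0 u n)) p"
    using op_bracket[OF mode_part(1) mode_part(2), of a m u n p] by (simp only: koszul_sign_zero free.scale_one)
  ultimately show ?thesis by (simp only: diff_eq_eq add.commute add.left_commute)
qed

lemma koszul_sign_11: "koszul_sign 1 1 = - 1" by (simp add: koszul_sign_def)

lemma op_odd_odd:
  "op (mode 0 u m) (op (mode 0 v n) p) = - op (mode 0 v n) (op (mode 0 u m) p) +
    op (mode (circ u v) 0 (m + n)) p +
    (l * (if m + n - 1 = 0 then of_int (m * (m - 1)) / 2 * formU u v else 0)) *f \<pi> p"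
proof -
  have "B (mode 0 u m) (mode 0 v n) = mode (circ u v) 0 (m + n) +
    (0, 0, if m + n - 1 = 0 then of_int (m * (m - 1)) / 2 * formU u v else 0)"
    unfolding bracket_odd_odd by (simp add: mode_def)
  then have "op (B (mode 0 u m) (mode 0 v n)) p = op (mode (circ u v) 0 (m + n)) p +
    (l * (if m + n - 1 = 0 then of_int (m * (m - 1)) / 2 * formU u v else 0)) *f \<pi> p"
    by (simp only: op_add_left central_scalar)
  moreover have "op (mode 0 u m) (op (mode 0 v n) p) + op (mode 0 v n) (op (mode 0 u m) p) = op (B (mode 0 u m) (mode 0 v n)) p"
    using op_bracket[OF mode_part(2) mode_part(2), of u m v n p]
    by (simp only: koszul_sign_11 free.scale_minus_left free.scale_one diff_minus_eq_add)
  moreover have "x = - y + b + c" if "x + y = z" "z = b + c" for x y z b c :: "('a, 'u) laff list \<Rightarrow>\<^sub>0 complex"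
  proof -
    have "x = b + c - y" using that by (simp only: eq_diff_eq)
    then show ?thesis by simp
  qed
  ultimately show ?thesis by blast
qed

lemma eventually_shift_int:
  fixes c :: int
  assumes "eventually P at_top"
  shows "eventually (\<lambda>n. P (n + c)) at_top" "eventually (\<lambda>n. P (c + n)) at_top"
    "eventually (\<lambda>n. P (n + c - 1)) at_top" "eventually (\<lambda>n. P (c + n - 1)) at_top"
proof -
  obtain N where N: "\<And>n. n \<ge> N \<Longrightarrow> P n" using assms by (auto simp: eventually_at_top_linorder)
  show "eventually (\<lambda>n. P (n + c)) at_top" "eventually (\<lambda>n. P (c + n)) at_top"
    "eventually (\<lambda>n. P (n + c - 1)) at_top" "eventually (\<lambda>n. P (c + n - 1)) at_top"
    unfolding eventually_at_top_linorder by (rule exI[of _ "N - c + 1"]; auto intro!: N)+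
qed

text \<open>By induction on generation: a mode of large index is moved past the first letter of a word, and the
commutator is again a mode of large index, apart from a central term at a single index.\<close>

lemma op_truncated:
  assumes "p \<in> M"
  shows "(\<forall>a. eventually (\<lambda>n. op (mode a 0 n) p = 0) at_top) \<and> (\<forall>u. eventually (\<lambda>n. op (mode 0 u n) p = 0) at_top)"
  using assms
proof (induction rule: M_induct)
  case one
  have "op (mode a u n) one = 0" if "n \<ge> 0" for a u n
  proof -
    have "mode a u n \<in> nonneg" using that by (simp add: mode_def nonneg_def)
    from op_one[OF this] show ?thesis by (simp add: charge_def mode_def)
  qed
  then show ?case by (auto simp: eventually_at_top_linorder)
next
  case (add p q)
  have "eventually (\<lambda>n. op (x n) (p + q) = 0) at_top"
    if "eventually (\<lambda>n. op (x n) p = 0) at_top" "eventually (\<lambda>n. op (x n) q = 0) at_top" for x :: "int \<Rightarrow> _"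
    using that by eventually_elim (simp add: free.lin_add[OF op_lin])
  with add show ?case by blast
next
  case (scale c p)
  then show ?case by (auto simp: free.lin_scale[OF op_lin] elim: eventually_mono)
next
  case (even b k p)
  have z: "op x 0 = 0" for x by (rule free.lin_zero[OF op_lin])
  have ne: "eventually (\<lambda>n. n + k - 2 \<noteq> 0) at_top"
    by (auto simp: eventually_at_top_linorder intro!: exI[of _ "3 - k"])
  have "eventually (\<lambda>n. op (mode a 0 n) (op (mode b 0 k) p) = 0) at_top" for a
  proof -
    have "eventually (\<lambda>n. op (mode a 0 n) p = 0) at_top" "eventually (\<lambda>n. op (mode (a * b) 0 (n + k - 1)) p = 0) at_top"
      using even eventually_shift_int(3)[of "\<lambda>n. op (mode (a * b) 0 n) p = 0" k] by auto
    with ne show ?thesis by eventually_elim (simp add: op_even_even z)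
  qed
  moreover have "eventually (\<lambda>n. op (mode 0 u n) (op (mode b 0 k) p) = 0) at_top" for u
  proof -
    have "eventually (\<lambda>n. op (mode 0 u n) p = 0) at_top" "eventually (\<lambda>n. op (mode 0 (act b u) (k + n - 1)) p = 0) at_top"
      using even eventually_shift_int(4)[of "\<lambda>n. op (mode 0 (act b u) n) p = 0" k] by auto
    then show ?thesis
    proof eventually_elim
      case (elim n) then show ?case using op_even_odd[of b k u n p] by (simp add: z)
    qed
  qed
  ultimately show ?case by blast
next
  case (odd v k p)
  have z: "op x 0 = 0" for x by (rule free.lin_zero[OF op_lin])
  have ne: "eventually (\<lambda>n. n + k - 1 \<noteq> 0) at_top"
    by (auto simp: eventually_at_top_linorder intro!: exI[of _ "3 - k"])
  have "eventually (\<lambda>n. op (mode a 0 n) (op (mode 0 v k) p) = 0) at_top" for a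
  proof -
    have "eventually (\<lambda>n. op (mode a 0 n) p = 0) at_top" "eventually (\<lambda>n. op (mode 0 (act a v) (n + k - 1)) p = 0) at_top"
      using odd eventually_shift_int(3)[of "\<lambda>n. op (mode 0 (act a v) n) p = 0" k] by auto
    then show ?thesis by eventually_elim (simp add: op_even_odd z)
  qed
  moreover have "eventually (\<lambda>n. op (mode 0 u n) (op (mode 0 v k) p) = 0) at_top" for u
  proof -
    have "eventually (\<lambda>n. op (mode 0 u n) p = 0) at_top" "eventually (\<lambda>n. op (mode (circ u v) 0 (n + k)) p = 0) at_top"
      using odd eventually_shift_int(1)[of "\<lambda>n. op (mode (circ u v) 0 n) p = 0" k] by auto
    with ne show ?thesis by eventually_elim (simp add: op_odd_odd z)
  qed
  ultimately show ?case by blast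
qed

lemma mode_fields: "free.is_field (\<lambda>n. op (mode a 0 n))" "free.is_field (\<lambda>n. op (mode 0 u n))"
proof -
  have "\<pi> w \<in> M" for w by (simp add: M_def)
  from op_truncated[OF this]
  show "free.is_field (\<lambda>n. op (mode a 0 n))" "free.is_field (\<lambda>n. op (mode 0 u n))"
    unfolding free.is_field_def op_projection eventually_at_top_linorder using op_lin by blast+
qed

lemma mode_fields_covariant:
  "free.translation_covariant translation (\<lambda>n. op (mode a 0 n))"
  "free.translation_covariant translation (\<lambda>n. op (mode 0 u n))"
proof -
  have "op (derivation (mode a 0 n)) w = - (of_int n *f op (mode a 0 (n - 1)) w)" for n w
    unfolding derivation_mode U.scale_zero_right op_mode_scale by (simp only: free.scale_minus_left)
  then show "free.translation_covariant translation (\<lambda>n. op (mode a 0 n))"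
    unfolding free.translation_covariant_def translation_op by simp
  have "op (derivation (mode 0 u n)) w = - (of_int n *f op (mode 0 u (n - 1)) w)" for n w
    unfolding derivation_mode A.scale_zero_right op_mode_scale by (simp only: free.scale_minus_left)
  then show "free.translation_covariant translation (\<lambda>n. op (mode 0 u n))"
    unfolding free.translation_covariant_def translation_op by simp
qed

lemma sum_lessThan_4: "(\<Sum>j<Suc (Suc (Suc (Suc 0))). f j) = f 0 + f 1 + f 2 + f (3 :: nat)"
  by (simp add: numeral_2_eq_2 numeral_3_eq_3)

text \<open>The commutator as a polynomial in \<open>k\<close> with \<open>s = k + n\<close>: here \<open>(k - n) / 2 = k - s / 2\<close>, and the central
term is \<open>k choose 3\<close> times a multiple of the indicator of \<open>s = 2\<close>.\<close>

lemma local_even_even: "free.mutually_local 1 (\<lambda>n. op (mode a 0 n)) (\<lambda>n. op (mode b 0 n))"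
proof (rule free.polynomial_commutator_local[where N = "Suc (Suc (Suc (Suc 0)))" and
    Z = "\<lambda>w j s. if j = 0 then (- of_int s / 2) *f op (mode (a * b) 0 (s - 1)) w
      else if j = 1 then op (mode (a * b) 0 (s - 1)) w
      else if j = 3 then (l * (if s = 2 then formA a b else 0)) *f \<pi> w else 0"])
  fix w and k n :: int
  have c: "of_int (k - n) / 2 = of_int k + - of_int (k + n) / (2 :: complex)"
    by (simp add: add_divide_distrib diff_divide_distrib)
  have e: "l * (if k + n - 2 = 0 then (of_int k gchoose 3) * formA a b else 0) =
    (of_int k gchoose 3) * (l * (if k + n = 2 then formA a b else 0))" by simp
  show "op (mode a 0 k) (op (mode b 0 n) w) - 1 *f op (mode b 0 n) (op (mode a 0 k) w) =
    (\<Sum>j<Suc (Suc (Suc (Suc 0))). (of_int k gchoose j) *f (if j = 0 then (- of_int (k + n) / 2) *f op (mode (a * b) 0 (k + n - 1)) w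
      else if j = 1 then op (mode (a * b) 0 (k + n - 1)) w
      else if j = 3 then (l * (if k + n = 2 then formA a b else 0)) *f \<pi> w else 0))"
    unfolding sum_lessThan_4 op_even_even[of a k b n w] c e free.scale_left_distrib free.scale_one
    by (simp add: add.commute del: of_int_add)
qed

lemma local_even_odd: "free.mutually_local 1 (\<lambda>n. op (mode a 0 n)) (\<lambda>n. op (mode 0 u n))"
proof (rule free.polynomial_commutator_local[where N = "Suc (Suc (Suc (Suc 0)))" and
    Z = "\<lambda>w j s. if j = 0 then (- of_int s / 2) *f op (mode 0 (act a u) (s - 1)) w
      else if j = 1 then (3 / 4) *f op (mode 0 (act a u) (s - 1)) w else 0"])
  fix w and k n :: int
  have c: "of_int (k - 2 * n) / 4 = of_int k * (3 / 4) + - of_int (k + n) / (2 :: complex)"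
    by (simp add: add_divide_distrib diff_divide_distrib)
  show "op (mode a 0 k) (op (mode 0 u n) w) - 1 *f op (mode 0 u n) (op (mode a 0 k) w) =
    (\<Sum>j<Suc (Suc (Suc (Suc 0))). (of_int k gchoose j) *f (if j = 0 then (- of_int (k + n) / 2) *f op (mode 0 (act a u) (k + n - 1)) w
      else if j = 1 then (3 / 4) *f op (mode 0 (act a u) (k + n - 1)) w else 0))"
    unfolding sum_lessThan_4 op_even_odd c free.scale_left_distrib free.scale_one
    by (simp add: add.commute del: of_int_add)
qed

lemma local_odd_odd: "free.mutually_local (- 1) (\<lambda>n. op (mode 0 u n)) (\<lambda>n. op (mode 0 v n))"
proof (rule free.polynomial_commutator_local[where N = "Suc (Suc (Suc (Suc 0)))" and
    Z = "\<lambda>w j s. if j = 0 then op (mode (circ u v) 0 s) w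
      else if j = 2 then (l * (if s = 1 then formU u v else 0)) *f \<pi> w else 0"])
  fix w and k n :: int
  have e: "l * (if k + n - 1 = 0 then of_int (k * (k - 1)) / 2 * formU u v else 0) =
    (of_int k gchoose 2) * (l * (if k + n = 1 then formU u v else 0))" by (simp add: gbinomial_2)
  show "op (mode 0 u k) (op (mode 0 v n) w) - (- 1) *f op (mode 0 v n) (op (mode 0 u k) w) =
    (\<Sum>j<Suc (Suc (Suc (Suc 0))). (of_int k gchoose j) *f (if j = 0 then op (mode (circ u v) 0 (k + n)) w
      else if j = 2 then (l * (if k + n = 1 then formU u v else 0)) *f \<pi> w else 0))"
    unfolding sum_lessThan_4 op_odd_odd[of u k v n w] e free.scale_minus_left free.scale_one
    by simp
qed

definition sgn_of :: "bit \<Rightarrow> complex" where "sgn_of \<alpha> = (if \<alpha> = 0 then 1 else - 1)"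

text \<open>The representatives of the even and of the odd part. Parity has the eigenvalues \<open>\<plusminus>1\<close>, and \<open>prM\<close> is the
projection to an eigenspace.\<close>

definition PM :: "bit \<Rightarrow> (('a, 'u) laff list \<Rightarrow>\<^sub>0 complex) set"
  where "PM \<alpha> = {p \<in> M. parity p = sgn_of \<alpha> *f p}"

definition prM :: "bit \<Rightarrow> (('a, 'u) laff list \<Rightarrow>\<^sub>0 complex) \<Rightarrow> (('a, 'u) laff list \<Rightarrow>\<^sub>0 complex)"
  where "prM \<alpha> p = (1 / 2) *f p + (sgn_of \<alpha> / 2) *f parity p"

definition gens :: "bit \<Rightarrow> (int \<Rightarrow> (('a, 'u) laff list \<Rightarrow>\<^sub>0 complex) \<Rightarrow> (('a, 'u) laff list \<Rightarrow>\<^sub>0 complex)) set"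
  where "gens \<alpha> = (if \<alpha> = 0 then range (\<lambda>a n. op (mode a 0 n)) else range (\<lambda>u n. op (mode 0 u n)))"

lemma gens_cases:
  assumes "g \<in> gens \<alpha>"
  obtains a where "\<alpha> = 0" "g = (\<lambda>n. op (mode a 0 n))" | u where "\<alpha> = 1" "g = (\<lambda>n. op (mode 0 u n))"
  using assms by (cases \<alpha>) (auto simp: gens_def)

lemma M_subspace: "free.subspace M"
  unfolding free.subspace_def
  by (simp add: M_iff free.lin_add[OF \<pi>(1)] free.lin_scale[OF \<pi>(1)] free.lin_zero[OF \<pi>(1)])

lemma PM_subspace: "free.subspace (PM \<alpha>)"
  unfolding free.subspace_def
proof (intro conjI ballI allI)
  show "0 \<in> PM \<alpha>" by (simp add: PM_def free.subspace_0[OF M_subspace] free.lin_zero[OF parity_lin])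
  show "x + y \<in> PM \<alpha>" if "x \<in> PM \<alpha>" "y \<in> PM \<alpha>" for x y
    using that by (simp add: PM_def free.subspace_add[OF M_subspace] free.lin_add[OF parity_lin] distrib_left)
  show "c *f x \<in> PM \<alpha>" if "x \<in> PM \<alpha>" for c x
  proof -
    have "parity (c *f x) = sgn_of \<alpha> *f (c *f x)"
      using that by (simp only: PM_def mem_Collect_eq free.lin_scale[OF parity_lin] free.scale_left_commute)
    then show ?thesis using that free.subspace_scale[OF M_subspace] by (simp add: PM_def)
  qed
qed

lemma op_uminus: "op (- x) p = - op x p"
  using op_add_left[of x "- x" p] op_zero_left[of p] by (simp add: eq_neg_iff_add_eq_0 add.commute)

lemma op_part_PM:
  assumes "x \<in> sl_part L \<alpha>" "p \<in> PM \<beta>"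
  shows "op x p \<in> PM (\<alpha> + \<beta>)"
proof -
  have "op (parity_involution x) q = sgn_of \<alpha> *f op x q" for q
  proof (cases \<alpha>)
    case zero
    then have "parity_involution x = x" using assms(1) by (cases x) (auto simp: even_part_iff parity_involution_def)
    then show ?thesis using zero by (simp add: sgn_of_def mono_Nil_1)
  next
    case one
    then have "parity_involution x = - x" using assms(1) by (cases x) (auto simp: odd_part_iff parity_involution_def)
    then show ?thesis using one by (simp add: sgn_of_def op_uminus single_uminus mono_Nil_1)
  qed
  then have "parity (op x p) = sgn_of \<beta> *f (sgn_of \<alpha> *f op x p)"
    using assms(2) by (simp only: parity_op PM_def mem_Collect_eq free.lin_scale[OF op_lin])
  also have "\<dots> = sgn_of (\<alpha> + \<beta>) *f op x p"
    by (cases \<alpha>; cases \<beta>) (simp_all add: sgn_of_def add_bit_eq_xor)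
  finally show ?thesis by (simp add: PM_def op_M)
qed

lemma one_PM: "one \<in> PM 0" by (simp add: PM_def one_M parity_one sgn_of_def mono_Nil_1)

lemma prM_PM: "w \<in> PM \<beta> \<Longrightarrow> prM \<alpha> w = (if \<alpha> = \<beta> then w else 0)"
proof -
  assume "w \<in> PM \<beta>"
  then have "prM \<alpha> w = (1 / 2 + sgn_of \<alpha> / 2 * sgn_of \<beta>) *f w"
    by (simp only: prM_def PM_def mem_Collect_eq free.scale_scale free.scale_left_distrib)
  then show ?thesis by (cases \<alpha>; cases \<beta>) (simp_all add: sgn_of_def mono_Nil_1)
qed

lemma prM_lin: "free.lin (prM \<alpha>)"
proof (rule free.linI)
  show "prM \<alpha> (v + w) = prM \<alpha> v + prM \<alpha> w" for v w
    by (simp add: prM_def free.lin_add[OF parity_lin] distrib_left)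
  show "prM \<alpha> (c *f v) = c *f prM \<alpha> v" for c v
    by (simp only: prM_def free.lin_scale[OF parity_lin] free.scale_right_distrib free.scale_left_commute[of c])
qed

text \<open>Every vector is a sum \<open>q0 + q1\<close> of vectors in the two parts that lie in \<open>Q\<close>; a vector of one parity is
its own projection.\<close>

lemma PM_generated:
  assumes "\<And>\<beta>. free.subspace (Q \<beta>)" "one \<in> Q 0"
    "\<And>\<beta> \<gamma> g n w. g \<in> gens \<beta> \<Longrightarrow> w \<in> Q \<gamma> \<Longrightarrow> w \<in> PM \<gamma> \<Longrightarrow> g n w \<in> Q (\<beta> + \<gamma>)"
  shows "PM \<alpha> \<subseteq> Q \<alpha>"
proof
  fix p assume p: "p \<in> PM \<alpha>"
  then have "p \<in> M" by (simp add: PM_def)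
  then have "\<exists>q0 q1. p = q0 + q1 \<and> q0 \<in> Q 0 \<inter> PM 0 \<and> q1 \<in> Q 1 \<inter> PM 1"
  proof (induction rule: M_induct)
    case one
    show ?case
      by (rule exI[of _ one], rule exI[of _ 0]) (simp add: assms(2) one_PM free.subspace_0[OF assms(1)] free.subspace_0[OF PM_subspace])
  next
    case (add p q)
    then obtain p0 p1 q0 q1 where "p = p0 + p1" "q = q0 + q1" "p0 \<in> Q 0 \<inter> PM 0" "p1 \<in> Q 1 \<inter> PM 1" "q0 \<in> Q 0 \<inter> PM 0" "q1 \<in> Q 1 \<inter> PM 1"
      by blast
    then show ?case
      by (intro exI[of _ "p0 + q0"] exI[of _ "p1 + q1"])
        (simp add: free.subspace_add[OF assms(1)] free.subspace_add[OF PM_subspace])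
  next
    case (scale c p)
    then obtain p0 p1 where "p = p0 + p1" "p0 \<in> Q 0 \<inter> PM 0" "p1 \<in> Q 1 \<inter> PM 1" by blast
    then show ?case
      by (intro exI[of _ "c *f p0"] exI[of _ "c *f p1"])
        (simp add: free.subspace_scale[OF assms(1)] free.subspace_scale[OF PM_subspace] distrib_left)
  next
    case (even a n p)
    then obtain p0 p1 where "p = p0 + p1" "p0 \<in> Q 0 \<inter> PM 0" "p1 \<in> Q 1 \<inter> PM 1" by blast
    moreover have "(\<lambda>n. op (mode a 0 n)) \<in> gens 0" by (simp add: gens_def)
    ultimately show ?case
      using assms(3)[of "\<lambda>n. op (mode a 0 n)" 0 p0 0 n] assms(3)[of "\<lambda>n. op (mode a 0 n)" 0 p1 1 n]
        op_part_PM[OF mode_part(1), of p0 0 a n] op_part_PM[OF mode_part(1), of p1 1 a n]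
      by (intro exI[of _ "op (mode a 0 n) p0"] exI[of _ "op (mode a 0 n) p1"]) (simp add: free.lin_add[OF op_lin])
  next
    case (odd u n p)
    then obtain p0 p1 where "p = p0 + p1" "p0 \<in> Q 0 \<inter> PM 0" "p1 \<in> Q 1 \<inter> PM 1" by blast
    moreover have "(\<lambda>n. op (mode 0 u n)) \<in> gens 1" by (simp add: gens_def)
    ultimately show ?case
      using assms(3)[of "\<lambda>n. op (mode 0 u n)" 1 p0 0 n] assms(3)[of "\<lambda>n. op (mode 0 u n)" 1 p1 1 n]
        op_part_PM[OF mode_part(2), of p0 0 u n] op_part_PM[OF mode_part(2), of p1 1 u n]
      by (intro exI[of _ "op (mode 0 u n) p1"] exI[of _ "op (mode 0 u n) p0"]) (simp add: free.lin_add[OF op_lin] add.commute)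
  qed
  then obtain q0 q1 where q: "p = q0 + q1" "q0 \<in> Q 0 \<inter> PM 0" "q1 \<in> Q 1 \<inter> PM 1" by blast
  have "p = prM \<alpha> p" using p by (simp add: prM_PM)
  also have "\<dots> = prM \<alpha> q0 + prM \<alpha> q1" unfolding q(1) by (rule free.lin_add[OF prM_lin])
  also have "\<dots> = (if \<alpha> = 0 then q0 else q1)" using q by (cases \<alpha>) (simp_all add: prM_PM[of q0 0] prM_PM[of q1 1])
  finally show "p \<in> Q \<alpha>" using q by (cases \<alpha>) auto
qed

sublocale VOA: generating_fields "\<lambda>c p. mono [] c * p" PM prM one translation gens
proof
  show "free.subspace (PM \<alpha>)" for \<alpha> by (rule PM_subspace)
  show "free.lin (prM \<alpha>)" for \<alpha> by (rule prM_lin)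
  show "prM \<alpha> w = (if \<alpha> = \<beta> then w else 0)" if "w \<in> PM \<beta>" for w \<alpha> \<beta> using that by (rule prM_PM)
  show "one \<in> PM 0" by (rule one_PM)
  show "free.lin translation" by (rule translation_lin)
  show "translation one = 0" by (rule translation_one)
  show "free.is_field g" if "g \<in> gens \<alpha>" for g \<alpha>
    using that by (cases rule: gens_cases) (simp_all add: mode_fields)
  show "free.translation_covariant translation g" if "g \<in> gens \<alpha>" for g \<alpha>
    using that by (cases rule: gens_cases) (simp_all add: mode_fields_covariant)
  show "g n one = 0" if "g \<in> gens \<alpha>" "n \<ge> 0" for g \<alpha> n
  proof -
    have "op (mode a u n) one = 0" for a u
    proof -
      have "mode a u n \<in> nonneg" using that by (simp add: mode_def nonneg_def)
      from op_one[OF this] show ?thesis by (simp add: charge_def mode_def)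
    qed
    with that show ?thesis by (cases rule: gens_cases) simp_all
  qed
  show "g n w \<in> PM (\<alpha> + \<beta>)" if "g \<in> gens \<alpha>" "w \<in> PM \<beta>" for g \<alpha> \<beta> n w
    using that by (cases rule: gens_cases) (simp_all only: op_part_PM mode_part)
  show "free.mutually_local (koszul_sign \<alpha> \<beta>) g h" if "g \<in> gens \<alpha>" "h \<in> gens \<beta>" for g h \<alpha> \<beta>
    using that(1)
  proof (cases rule: gens_cases)
    case (1 a)
    from that(2) show ?thesis
      by (cases rule: gens_cases) (simp_all add: 1 koszul_sign_zero local_even_even local_even_odd)
  next
    case (2 u)
    from that(2) show ?thesis
    proof (cases rule: gens_cases)
      case (1 a)
      show ?thesis using free.mutually_local_sym[OF local_even_odd]
        by (simp add: 1 2 koszul_sign_zero koszul_sign_sym[of 1 0])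
    next
      case (2 v)
      then show ?thesis using \<open>\<alpha> = 1\<close> \<open>g = _\<close> by (simp add: koszul_sign_11 local_odd_odd)
    qed
  qed
  show "PM \<alpha> \<subseteq> Q \<alpha>" if "\<And>\<beta>. free.subspace (Q \<beta>)" "one \<in> Q 0"
    "\<And>\<beta> \<gamma> g n w. g \<in> gens \<beta> \<Longrightarrow> w \<in> Q \<gamma> \<Longrightarrow> w \<in> PM \<gamma> \<Longrightarrow> g n w \<in> Q (\<beta> + \<gamma>)" for Q \<alpha>
    using that by (rule PM_generated)
qed

end

section \<open>The vacuum module and its parts\<close>

lemma gfinprod_additive_image:
  fixes h :: "'i \<Rightarrow> 'b::comm_monoid_add"
  assumes "Group.comm_monoid G" "\<And>x. \<phi> x \<in> carrier G" "\<And>x y. \<phi> (x + y) = \<phi> x \<otimes>\<^bsub>G\<^esub> \<phi> y" "\<phi> 0 = \<one>\<^bsub>G\<^esub>"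
    and fin: "finite {i. h i \<noteq> 0}"
  shows "gfinprod G (\<lambda>i. \<phi> (h i)) UNIV = \<phi> (Sum_any h)"
proof -
  interpret Group.comm_monoid G by fact
  have sum: "finite K \<Longrightarrow> finprod G (\<lambda>i. \<phi> (h i)) K = \<phi> (sum h K)" for K
    by (induction K rule: finite_induct) (simp_all add: assms)
  let ?S = "{i \<in> UNIV. \<phi> (h i) \<noteq> \<one>\<^bsub>G\<^esub>}"
  have S: "?S \<subseteq> {i. h i \<noteq> 0}" by (auto simp: assms(4))
  then have fin': "finite ?S" using fin finite_subset by blast
  have "gfinprod G (\<lambda>i. \<phi> (h i)) UNIV = finprod G (\<lambda>i. \<phi> (h i)) ?S"
    unfolding gfinprod_def using fin' by simp
  also have "\<dots> = finprod G (\<lambda>i. \<phi> (h i)) {i. h i \<noteq> 0}"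
    by (rule finprod_mono_neutral_cong_left) (use fin S assms(2) in auto)
  also have "\<dots> = \<phi> (Sum_any h)" by (simp only: sum[OF fin] Sum_any.expand_set)
  finally show ?thesis .
qed

context vacuum_module
begin

text \<open>The inverse of \<open>\<Psi>\<close> on representatives.\<close>

definition coord :: "('a, 'u) laff ind \<Rightarrow> (('a, 'u) laff list \<Rightarrow>\<^sub>0 complex)"
  where "coord X = \<pi> (SOME p. \<Psi> p = X)"

lemma coord_\<Psi>: "coord (\<Psi> p) = \<pi> p"
  unfolding coord_def \<pi>_eq_iff by (rule someI[of "\<lambda>q. \<Psi> q = \<Psi> p" p]) (rule refl)

lemma coord_\<Psi>_M: "p \<in> M \<Longrightarrow> coord (\<Psi> p) = p"
  by (simp add: coord_\<Psi> M_iff)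

lemma V_cases: "X \<in> carrier V \<Longrightarrow> \<exists>p\<in>M. X = \<Psi> p"
  by (auto simp: V_carrier M_def \<pi>(2))

lemma \<Psi>_carrier: "\<Psi> p \<in> carrier V" by (simp add: V_carrier)

lemma vac_module_eq: "vac_module L l = V" by (simp add: vac_module_def)

lemma vac_act_\<Psi>: "vac_act L l x (\<Psi> p) = \<Psi> (op x p)"
  by (simp add: vac_act_def lie_act op_def \<pi>(2))

lemma vac_one_eq: "vac_one L l = \<Psi> one"
  by (simp add: vac_one_def tensor_one one_def \<pi>(2))

lemma vac_gen_eq: "vac_gen L l a u = \<Psi> (op (mode a u (- 1)) one)"
  by (simp add: vac_gen_def vac_one_eq vac_act_\<Psi>)

lemma carrier_space_eq: "VOA.carrier_space = M"
proof
  show "VOA.carrier_space \<subseteq> M"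
    unfolding VOA.carrier_space_def using free.subspace_add[OF M_subspace] by (auto simp: PM_def)
  show "M \<subseteq> VOA.carrier_space"
  proof
    fix p assume "p \<in> M"
    then show "p \<in> VOA.carrier_space"
    proof (induction rule: M_induct)
      case one show ?case by (rule VOA.vac_carrier)
    next
      case (add p q) then show ?case by (rule free.subspace_add[OF VOA.carrier_subspace])
    next
      case (scale c p) then show ?case by (intro free.subspace_scale[OF VOA.carrier_subspace])
    next
      case (even a n p)
      have "(\<lambda>n. op (mode a 0 n)) \<in> gens 0" by (simp add: gens_def)
      from VOA.good_closed[OF VOA.gen_good[OF this] even(2)] show ?case by simp
    next
      case (odd u n p)
      have "(\<lambda>n. op (mode 0 u n)) \<in> gens 1" by (simp add: gens_def)
      from VOA.good_closed[OF VOA.gen_good[OF this] odd(2)] show ?case by simp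
    qed
  qed
qed

lemma V_module: "Module.module complex_ring V"
proof (rule Module.moduleI)
  show "cring complex_ring"
  proof (rule cringI)
    show "abelian_group complex_ring"
    proof (rule abelian_groupI)
      show "\<exists>y\<in>carrier complex_ring. y \<oplus>\<^bsub>complex_ring\<^esub> x = \<zero>\<^bsub>complex_ring\<^esub>" for x
        by (rule bexI[of _ "- x"]) simp_all
    qed (simp_all add: add.assoc add.commute)
    show "Group.comm_monoid complex_ring" by (rule comm_monoidI) (simp_all add: mult.assoc mult.commute)
  qed (simp add: distrib_right)
  show "abelian_group V"
  proof (rule abelian_groupI)
    show "\<zero>\<^bsub>V\<^esub> \<in> carrier V" by (simp add: V_zero \<Psi>_carrier)
    fix x y z assume xyz: "x \<in> carrier V" "y \<in> carrier V" "z \<in> carrier V"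
    obtain p q r where [simp]: "x = \<Psi> p" "y = \<Psi> q" "z = \<Psi> r" using xyz[THEN V_cases] by blast
    show "x \<oplus>\<^bsub>V\<^esub> y \<in> carrier V" "x \<oplus>\<^bsub>V\<^esub> y \<oplus>\<^bsub>V\<^esub> z = x \<oplus>\<^bsub>V\<^esub> (y \<oplus>\<^bsub>V\<^esub> z)" "x \<oplus>\<^bsub>V\<^esub> y = y \<oplus>\<^bsub>V\<^esub> x"
      "\<zero>\<^bsub>V\<^esub> \<oplus>\<^bsub>V\<^esub> x = x"
      by (simp_all add: V_add V_zero \<Psi>_carrier add.assoc add.commute add.left_commute)
    show "\<exists>y\<in>carrier V. y \<oplus>\<^bsub>V\<^esub> x = \<zero>\<^bsub>V\<^esub>"
      by (rule bexI[of _ "\<Psi> (- p)"]) (simp_all add: V_add V_zero \<Psi>_carrier)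
  qed
  fix a b x y assume xy: "x \<in> carrier V" "y \<in> carrier V"
  obtain p q where [simp]: "x = \<Psi> p" "y = \<Psi> q" using xy[THEN V_cases] by blast
  show "a \<odot>\<^bsub>V\<^esub> x \<in> carrier V" "(a \<oplus>\<^bsub>complex_ring\<^esub> b) \<odot>\<^bsub>V\<^esub> x = a \<odot>\<^bsub>V\<^esub> x \<oplus>\<^bsub>V\<^esub> b \<odot>\<^bsub>V\<^esub> x"
    "a \<odot>\<^bsub>V\<^esub> (x \<oplus>\<^bsub>V\<^esub> y) = a \<odot>\<^bsub>V\<^esub> x \<oplus>\<^bsub>V\<^esub> a \<odot>\<^bsub>V\<^esub> y"
    "(a \<otimes>\<^bsub>complex_ring\<^esub> b) \<odot>\<^bsub>V\<^esub> x = a \<odot>\<^bsub>V\<^esub> (b \<odot>\<^bsub>V\<^esub> x)" "\<one>\<^bsub>complex_ring\<^esub> \<odot>\<^bsub>V\<^esub> x = x"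
    by (simp_all add: V_smult V_add \<Psi>_carrier distrib_left free.scale_left_distrib)
qed

sublocale V: Module.module complex_ring V by (rule V_module)

lemma V_a_inv: "\<ominus>\<^bsub>V\<^esub> \<Psi> p = \<Psi> (- p)"
  by (rule V.minus_equality) (simp_all add: V_add V_zero \<Psi>_carrier)

lemma V_minus: "\<Psi> p \<ominus>\<^bsub>V\<^esub> \<Psi> q = \<Psi> (p - q)"
  by (simp add: a_minus_def V_a_inv V_add)

lemma image_submodule: "free.subspace S \<Longrightarrow> submodule (\<Psi> ` S) complex_ring V"
proof (rule V.submoduleI)
  assume S: "free.subspace S"
  show "\<Psi> ` S \<subseteq> carrier V" by (auto simp: \<Psi>_carrier)
  show "\<zero>\<^bsub>V\<^esub> \<in> \<Psi> ` S" unfolding V_zero by (rule imageI) (rule free.subspace_0[OF S])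
  show "\<ominus>\<^bsub>V\<^esub> a \<in> \<Psi> ` S" if "a \<in> \<Psi> ` S" for a
    using that free.subspace_neg[OF S] by (auto simp: V_a_inv)
  show "a \<oplus>\<^bsub>V\<^esub> b \<in> \<Psi> ` S" if "a \<in> \<Psi> ` S" "b \<in> \<Psi> ` S" for a b
    using that free.subspace_add[OF S] by (auto simp: V_add)
  show "a \<odot>\<^bsub>V\<^esub> x \<in> \<Psi> ` S" if "x \<in> \<Psi> ` S" for a x
    using that free.subspace_scale[OF S] by (auto simp: V_smult)
qed

lemma preimage_subspace: "submodule t complex_ring V \<Longrightarrow> free.subspace {p. \<Psi> p \<in> t}"
proof -
  assume t: "submodule t complex_ring V"
  have "\<zero>\<^bsub>V\<^esub> \<in> t" using subgroup.one_closed[OF submodule.axioms(1)[OF t]] by simp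
  then show ?thesis
    using V.submoduleE[OF t] by (auto simp: free.subspace_def V_zero[symmetric] simp flip: V_add V_smult)
qed

text \<open>The degrees of vectors of parity \<open>\<alpha>\<close>.\<close>

definition degrees :: "bit \<Rightarrow> rat set"
  where "degrees \<alpha> = (if \<alpha> = 0 then \<int> else {n + 1 / 2 |n. n \<in> \<int>})"

text \<open>Doubling turns the two cases into a statement about the parity of an integer.\<close>

lemma degrees_iff: "d \<in> degrees \<alpha> \<longleftrightarrow> (\<exists>n. 2 * d = of_int n \<and> (even n \<longleftrightarrow> \<alpha> = 0))"
proof
  assume d: "d \<in> degrees \<alpha>"
  show "\<exists>n. 2 * d = of_int n \<and> (even n \<longleftrightarrow> \<alpha> = 0)"
  proof (cases "\<alpha> = 0")
    case True
    then obtain m where "d = of_int m" using d by (auto simp: degrees_def elim: Ints_cases)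
    then show ?thesis using True by (intro exI[of _ "2 * m"]) simp
  next
    case False
    then obtain m where "d = of_int m + 1 / 2" using d by (auto simp: degrees_def elim!: Ints_cases)
    then show ?thesis using False by (intro exI[of _ "2 * m + 1"]) simp
  qed
next
  assume "\<exists>n. 2 * d = of_int n \<and> (even n \<longleftrightarrow> \<alpha> = 0)"
  then obtain n where n: "2 * d = of_int n" "even n \<longleftrightarrow> \<alpha> = 0" by blast
  show "d \<in> degrees \<alpha>"
  proof (cases "\<alpha> = 0")
    case True
    then obtain m where "n = 2 * m" using n by (auto elim: evenE)
    then have "d = of_int m" using n by simp
    then show ?thesis using True by (simp add: degrees_def)
  next
    case False
    then obtain m where "n = 2 * m + 1" using n by (auto elim: oddE)
    then have "d = of_int m + 1 / 2" using n by simp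
    then show ?thesis using False by (auto simp: degrees_def)
  qed
qed

lemma degrees_add: "d \<in> degrees \<alpha> \<Longrightarrow> e \<in> degrees \<beta> \<Longrightarrow> d + e \<in> degrees (\<alpha> + \<beta>)"
proof -
  assume "d \<in> degrees \<alpha>" "e \<in> degrees \<beta>"
  then obtain m n where mn: "2 * d = of_int m" "even m \<longleftrightarrow> \<alpha> = 0" "2 * e = of_int n" "even n \<longleftrightarrow> \<beta> = 0"
    by (auto simp: degrees_iff)
  then have "2 * (d + e) = of_int (m + n)" by (simp add: distrib_left)
  moreover have "even (m + n) \<longleftrightarrow> \<alpha> + \<beta> = 0" using mn by (cases \<alpha>; cases \<beta>) (auto simp: add_bit_eq_xor)
  ultimately show ?thesis unfolding degrees_iff by blast
qed

lemma degrees_uminus: "d \<in> degrees \<alpha> \<Longrightarrow> - d \<in> degrees \<alpha>"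
  unfolding degrees_iff by (metis even_minus mult_minus_right of_int_minus)

lemma degrees_disjoint: "d \<in> degrees \<alpha> \<Longrightarrow> d \<in> degrees \<beta> \<Longrightarrow> \<alpha> = \<beta>"
proof -
  assume "d \<in> degrees \<alpha>" "d \<in> degrees \<beta>"
  then obtain m n :: int where "2 * d = of_int m" "even m \<longleftrightarrow> \<alpha> = 0" "2 * d = of_int n" "even n \<longleftrightarrow> \<beta> = 0"
    by (auto simp: degrees_iff)
  moreover from this have "m = n" by simp
  ultimately show "\<alpha> = \<beta>" by (cases \<alpha>; cases \<beta>) auto
qed

lemma int_degrees: "1 - of_int n \<in> degrees 0" "0 \<in> degrees 0" "1 / 2 - of_int n \<in> degrees 1"
proof -
  show "1 - of_int n \<in> degrees 0" "0 \<in> degrees 0" by (simp_all add: degrees_def)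
  show "1 / 2 - of_int n \<in> degrees 1" unfolding degrees_iff by (rule exI[of _ "1 - 2 * n"]) simp
qed

text \<open>Even letters have integral degrees and odd letters half-odd-integral ones. The zero letter is
homogeneous of every degree.\<close>

lemma laff_deg_cases:
  assumes "x \<in> laff_deg e" "x \<noteq> 0"
  shows "\<exists>\<beta>. e \<in> degrees \<beta> \<and> x \<in> sl_part L \<beta>"
proof -
  obtain f g k where x: "x = (f, g, k)" by (cases x) auto
  have f: "e \<in> degrees 0" if nz: "f \<noteq> 0"
  proof -
    have "Poly_Mapping.keys f \<noteq> {}" using nz by simp
    then obtain n where "n \<in> Poly_Mapping.keys f" by blast
    then have "e = 1 - of_int n" using assms(1) by (auto simp: x laff_deg_def)
    then show ?thesis by (simp add: int_degrees)
  qed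
  have k: "e \<in> degrees 0" if "k \<noteq> 0" using that assms(1) by (auto simp: x laff_deg_def int_degrees)
  have g: "e \<in> degrees 1" if nz: "g \<noteq> 0"
  proof -
    have "Poly_Mapping.keys g \<noteq> {}" using nz by simp
    then obtain n where "n \<in> Poly_Mapping.keys g" by blast
    then have "e = 1 / 2 - of_int n" using assms(1) by (auto simp: x laff_deg_def)
    then show ?thesis by (simp only: int_degrees)
  qed
  show ?thesis
  proof (cases "g = 0")
    case True
    then have "f \<noteq> 0 \<or> k \<noteq> 0" using assms(2) by (auto simp: x zero_prod_def)
    then have "e \<in> degrees 0" using f k by blast
    moreover have "x \<in> sl_part L 0" by (simp add: x even_part_iff True)
    ultimately show ?thesis by blast
  next
    case False
    then have e: "e \<in> degrees 1" by (rule g)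
    then have "f = 0" "k = 0" using f k degrees_disjoint[of e 0 1] by auto
    then have "x \<in> sl_part L 1" by (simp add: x odd_part_iff)
    then show ?thesis using e by blast
  qed
qed

lemma word_PM:
  "\<forall>(e, x)\<in>set xs. x \<in> laff_deg e \<Longrightarrow> sum_list (map fst xs) \<in> degrees \<alpha> \<Longrightarrow> foldr op (map snd xs) one \<in> PM \<alpha>"
proof (induction xs arbitrary: \<alpha>)
  case Nil
  then have "\<alpha> = 0" using degrees_disjoint[of 0 \<alpha> 0] int_degrees(2) by simp
  then show ?case by (simp add: one_PM)
next
  case (Cons y xs)
  obtain e x where y: "y = (e, x)" by (cases y)
  show ?case
  proof (cases "x = 0")
    case True
    then show ?thesis by (simp add: y op_zero_left free.subspace_0[OF PM_subspace])
  next
    case False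
    then obtain \<beta> where \<beta>: "e \<in> degrees \<beta>" "x \<in> sl_part L \<beta>" using laff_deg_cases[of x e] Cons.prems(1) by (auto simp: y)
    have "(e + sum_list (map fst xs)) + - e \<in> degrees (\<alpha> + \<beta>)"
      by (rule degrees_add) (use Cons.prems(2) degrees_uminus[OF \<beta>(1)] in \<open>simp_all add: y\<close>)
    then have "foldr op (map snd xs) one \<in> PM (\<alpha> + \<beta>)" using Cons by simp
    from op_part_PM[OF \<beta>(2) this] have "op x (foldr op (map snd xs) one) \<in> PM (\<beta> + (\<alpha> + \<beta>))" .
    moreover have "\<beta> + (\<alpha> + \<beta>) = \<alpha>" by (cases \<alpha>; cases \<beta>) (simp_all add: add_bit_eq_xor)
    ultimately show ?thesis by (simp add: y)
  qed
qed

lemma word_\<Psi>: "foldr (vac_act L l) w (vac_one L l) = \<Psi> (foldr op w one)"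
  by (induction w) (simp_all add: vac_one_eq vac_act_\<Psi>)

text \<open>A word of homogeneous letters has the parity given by its degree. Conversely the span of such words
contains the vacuum and is stable under modes, so it is all of the part by \<open>PM_generated\<close>.\<close>

lemma vac_part_eq: "vac_part L l \<alpha> = \<Psi> ` PM \<alpha>"
proof
  have sub: "submodule (\<Psi> ` PM \<alpha>) complex_ring V" by (rule image_submodule[OF PM_subspace])
  have "vac_deg L l d \<subseteq> \<Psi> ` PM \<alpha>" if "d \<in> degrees \<alpha>" for d
    unfolding vac_deg_def module_span_def vac_module_eq
  proof (rule hull_minimal)
    show "submodule (\<Psi> ` PM \<alpha>) complex_ring V" by (rule sub)
    show "{foldr (vac_act L l) (map snd xs) (vac_one L l) |xs.
      (\<forall>(e, x)\<in>set xs. x \<in> sl_carrier L \<and> x \<in> laff_deg e) \<and> sum_list (map fst xs) = d} \<subseteq> \<Psi> ` PM \<alpha>"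
    proof
    fix X assume "X \<in> {foldr (vac_act L l) (map snd xs) (vac_one L l) |xs.
      (\<forall>(e, x)\<in>set xs. x \<in> sl_carrier L \<and> x \<in> laff_deg e) \<and> sum_list (map fst xs) = d}"
    then obtain xs where "X = foldr (vac_act L l) (map snd xs) (vac_one L l)"
      "\<forall>(e, x)\<in>set xs. x \<in> laff_deg e" "sum_list (map fst xs) = d" by fastforce
    then show "X \<in> \<Psi> ` PM \<alpha>" using word_PM[of xs \<alpha>] that by (simp add: word_\<Psi>)
    qed
  qed
  then show "vac_part L l \<alpha> \<subseteq> \<Psi> ` PM \<alpha>"
    unfolding vac_part_def module_span_def vac_module_eq degrees_def[symmetric]
    by (intro hull_minimal UN_least sub)
  show "\<Psi> ` PM \<alpha> \<subseteq> vac_part L l \<alpha>"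
  proof
    fix X assume X: "X \<in> \<Psi> ` PM \<alpha>"
    define words where "words \<gamma> = {foldr op (map snd xs) one |xs.
      (\<forall>(e, x)\<in>set xs. x \<in> laff_deg e) \<and> sum_list (map fst xs) \<in> degrees \<gamma>}" for \<gamma>
    have "PM \<alpha> \<subseteq> free.span (words \<alpha>)"
    proof (rule PM_generated)
      show "free.subspace (free.span (words \<gamma>))" for \<gamma> by (rule free.subspace_span)
      have "one \<in> words 0" unfolding words_def by (rule CollectI, rule exI[of _ "[]"]) (simp add: int_degrees)
      then show "one \<in> free.span (words 0)" by (rule free.span_base)
      show "g n w \<in> free.span (words (\<beta> + \<gamma>))" if g: "g \<in> gens \<beta>" and w: "w \<in> free.span (words \<gamma>)" for \<beta> \<gamma> g n w
      proof -
        obtain x e where x: "g n = op x" "x \<in> laff_deg e" "e \<in> degrees \<beta>"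
          using g
        proof (cases rule: gens_cases)
          case (1 a)
          have "mode a 0 n \<in> laff_deg (1 - of_int n)" by (auto simp: mode_def laff_deg_def)
          then show ?thesis using 1 int_degrees(1)[of n] by (intro that[of "mode a 0 n" "1 - of_int n"]) simp_all
        next
          case (2 u)
          have "mode 0 u n \<in> laff_deg (1 / 2 - of_int n)" by (auto simp: mode_def laff_deg_def)
          then show ?thesis using 2 int_degrees(3)[of n] by (intro that[of "mode 0 u n" "1 / 2 - of_int n"]) simp_all
        qed
        have "op x w' \<in> words (\<beta> + \<gamma>)" if w': "w' \<in> words \<gamma>" for w'
        proof -
          obtain xs where xs: "w' = foldr op (map snd xs) one" "\<forall>(e, x)\<in>set xs. x \<in> laff_deg e" "sum_list (map fst xs) \<in> degrees \<gamma>"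
            using w' unfolding words_def by blast
          show ?thesis unfolding words_def
            by (rule CollectI, rule exI[of _ "(e, x) # xs"]) (use xs x degrees_add[OF x(3) xs(3)] in simp)
        qed
        then have "words \<gamma> \<subseteq> {w. op x w \<in> free.span (words (\<beta> + \<gamma>))}" using free.span_base by blast
        moreover have "free.subspace {w. op x w \<in> free.span (words (\<beta> + \<gamma>))}"
          unfolding free.subspace_def
          by (simp add: free.lin_zero[OF op_lin] free.lin_add[OF op_lin] free.lin_scale[OF op_lin]
              free.span_zero free.span_add free.span_scale)
        ultimately have "free.span (words \<gamma>) \<subseteq> {w. op x w \<in> free.span (words (\<beta> + \<gamma>))}" by (rule free.span_minimal)
        then show ?thesis using w x(1) by auto
      qed
    qed
    then have span: "\<exists>p\<in>free.span (words \<alpha>). X = \<Psi> p" using X by blast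
    have "X \<in> t" if t: "submodule t complex_ring V" "(\<Union>d\<in>degrees \<alpha>. vac_deg L l d) \<subseteq> t" for t
    proof -
      have "words \<alpha> \<subseteq> {p. \<Psi> p \<in> t}"
      proof
        fix p assume "p \<in> words \<alpha>"
        then obtain xs where xs: "p = foldr op (map snd xs) one" "\<forall>(e, x)\<in>set xs. x \<in> laff_deg e" "sum_list (map fst xs) \<in> degrees \<alpha>"
          unfolding words_def by blast
        have "\<Psi> p \<in> {foldr (vac_act L l) (map snd ys) (vac_one L l) |ys.
          (\<forall>(e, x)\<in>set ys. x \<in> sl_carrier L \<and> x \<in> laff_deg e) \<and> sum_list (map fst ys) = sum_list (map fst xs)}"
          using xs by (intro CollectI exI[of _ xs]) (auto simp: word_\<Psi> L_UNIV)
        then have "\<Psi> p \<in> vac_deg L l (sum_list (map fst xs))"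
          unfolding vac_deg_def module_span_def by (rule subsetD[OF hull_subset])
        then show "p \<in> {p. \<Psi> p \<in> t}" using t(2) xs(3) by blast
      qed
      then have "free.span (words \<alpha>) \<subseteq> {p. \<Psi> p \<in> t}" by (rule free.span_minimal) (rule preimage_subspace[OF t(1)])
      then show ?thesis using span by blast
    qed
    then show "X \<in> vac_part L l \<alpha>"
      unfolding vac_part_def module_span_def hull_def vac_module_eq degrees_def by blast
  qed
qed

lemma nat_sum_\<Psi>:
  assumes "finite {i. h i \<noteq> 0}"
  shows "nat_sum V (\<lambda>i. \<Psi> (h i)) = \<Psi> (Sum_any h)"
  by (rule gfinprod_additive_image[OF V.a_comm_monoid _ _ _ assms]) (simp_all add: \<Psi>_carrier V_add V_zero)

section \<open>The vertex superalgebra structure\<close>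

definition vertex_map :: "('a, 'u) laff ind \<Rightarrow> int \<Rightarrow> ('a, 'u) laff ind \<Rightarrow> ('a, 'u) laff ind"
  where "vertex_map u n w = \<Psi> (VOA.Y (coord u) n (coord w))"

lemma vertex_map_\<Psi>: "p \<in> M \<Longrightarrow> q \<in> M \<Longrightarrow> vertex_map (\<Psi> p) n (\<Psi> q) = \<Psi> (VOA.Y p n q)"
  by (simp add: vertex_map_def coord_\<Psi>_M)

lemmas VOA_facts =
  VOA.Y_closed[unfolded carrier_space_eq] VOA.Y_add_left[unfolded carrier_space_eq]
  VOA.Y_scale_left[unfolded carrier_space_eq] VOA.Y_add_right[unfolded carrier_space_eq]
  VOA.Y_scale_right[unfolded carrier_space_eq] VOA.Y_vac[unfolded carrier_space_eq]
  VOA.Y_creation[unfolded carrier_space_eq] VOA.Y_vacuum[unfolded carrier_space_eq]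

lemma PM_M: "p \<in> PM \<alpha> \<Longrightarrow> p \<in> M" by (simp add: PM_def)

lemma V_cases_PM: "X \<in> vac_part L l \<alpha> \<Longrightarrow> \<exists>p\<in>PM \<alpha>. X = \<Psi> p"
  by (auto simp: vac_part_eq)

theorem vertex_superalgebra_vac: "vertex_superalgebra V (vac_part L l) vertex_map (vac_one L l)"
proof (intro vertex_superalgebra.intro vertex_superalgebra_axioms.intro)
  note M_add = free.subspace_add[OF M_subspace] and M_scale = free.subspace_scale[OF M_subspace]
  show "Module.module complex_ring V" by (rule V_module)
  show "submodule (vac_part L l \<alpha>) complex_ring V" for \<alpha>
    unfolding vac_part_eq by (rule image_submodule[OF PM_subspace])
  show "carrier V = vac_part L l 0 <+>\<^bsub>V\<^esub> vac_part L l 1"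
  proof (intro equalityI subsetI)
    fix X assume "X \<in> carrier V"
    from V_cases[OF this] obtain p where p: "p \<in> VOA.carrier_space" "X = \<Psi> p" unfolding carrier_space_eq by blast
    then obtain x y where "p = x + y" "x \<in> PM 0" "y \<in> PM 1" unfolding VOA.carrier_space_def by blast
    then show "X \<in> vac_part L l 0 <+>\<^bsub>V\<^esub> vac_part L l 1"
      unfolding vac_part_eq set_add_def' p(2) by (auto simp flip: V_add)
  next
    fix X assume "X \<in> vac_part L l 0 <+>\<^bsub>V\<^esub> vac_part L l 1"
    then show "X \<in> carrier V" unfolding vac_part_eq set_add_def' by (auto simp: V_add \<Psi>_carrier)
  qed
  show "vac_part L l 0 \<inter> vac_part L l 1 = {\<zero>\<^bsub>V\<^esub>}"
  proof (intro equalityI subsetI)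
    fix X assume "X \<in> vac_part L l 0 \<inter> vac_part L l 1"
    then obtain p q where pq: "X = \<Psi> p" "p \<in> PM 0" "X = \<Psi> q" "q \<in> PM 1" by (auto simp: vac_part_eq)
    then have "p = q" using coord_\<Psi>_M PM_M by metis
    then have "p = 0" using prM_PM[of p 0 0] prM_PM[of p 1 0] pq by simp
    then show "X \<in> {\<zero>\<^bsub>V\<^esub>}" by (simp add: pq V_zero)
  next
    fix X assume "X \<in> {\<zero>\<^bsub>V\<^esub>}"
    then show "X \<in> vac_part L l 0 \<inter> vac_part L l 1"
      by (auto simp: vac_part_eq V_zero free.subspace_0[OF PM_subspace])
  qed
  show "vac_one L l \<in> vac_part L l 0" by (auto simp: vac_part_eq vac_one_eq one_PM)
  show "vertex_map u n v \<in> carrier V" for u n v by (simp add: vertex_map_def \<Psi>_carrier)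
  show "vertex_map (u \<oplus>\<^bsub>V\<^esub> u') n v = vertex_map u n v \<oplus>\<^bsub>V\<^esub> vertex_map u' n v"
    if "u \<in> carrier V" "u' \<in> carrier V" "v \<in> carrier V" for u u' n v
    using that[THEN V_cases] by (auto simp: V_add vertex_map_\<Psi> M_add VOA_facts)
  show "vertex_map (c \<odot>\<^bsub>V\<^esub> u) n v = c \<odot>\<^bsub>V\<^esub> vertex_map u n v"
    if "u \<in> carrier V" "v \<in> carrier V" for c u n v
    using that[THEN V_cases] by (auto simp: V_smult vertex_map_\<Psi> M_scale VOA_facts)
  show "vertex_map u n (v \<oplus>\<^bsub>V\<^esub> v') = vertex_map u n v \<oplus>\<^bsub>V\<^esub> vertex_map u n v'"
    if "u \<in> carrier V" "v \<in> carrier V" "v' \<in> carrier V" for u v v' n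
    using that[THEN V_cases] by (auto simp: V_add vertex_map_\<Psi> M_add VOA_facts)
  show "vertex_map u n (c \<odot>\<^bsub>V\<^esub> v) = c \<odot>\<^bsub>V\<^esub> vertex_map u n v"
    if "u \<in> carrier V" "v \<in> carrier V" for c u n v
    using that[THEN V_cases] by (auto simp: V_smult vertex_map_\<Psi> M_scale VOA_facts)
  show "vertex_map u n v \<in> vac_part L l (\<alpha> + \<beta>)" if uv: "u \<in> vac_part L l \<alpha>" "v \<in> vac_part L l \<beta>" for u v n \<alpha> \<beta>
  proof -
    obtain p q where pq: "p \<in> PM \<alpha>" "q \<in> PM \<beta>" "u = \<Psi> p" "v = \<Psi> q" using uv[THEN V_cases_PM] by blast
    then show ?thesis using VOA.Y_parity[OF pq(1,2), of n] by (simp add: vac_part_eq vertex_map_\<Psi> PM_M)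
  qed
  show "\<exists>N. \<forall>n\<ge>N. vertex_map u n v = \<zero>\<^bsub>V\<^esub>" if uv: "u \<in> carrier V" "v \<in> carrier V" for u v
  proof -
    obtain p q where pq: "p \<in> M" "q \<in> M" "u = \<Psi> p" "v = \<Psi> q" using uv[THEN V_cases] by blast
    obtain N where "\<forall>n\<ge>N. VOA.Y p n q = 0" using VOA.Y_truncation[unfolded carrier_space_eq, OF pq(1)] by blast
    then show ?thesis using pq by (intro exI[of _ N]) (simp add: vertex_map_\<Psi> V_zero)
  qed
  show "vertex_map (vac_one L l) n v = (if n = - 1 then v else \<zero>\<^bsub>V\<^esub>)" if "v \<in> carrier V" for n v
    using that[THEN V_cases] by (auto simp: vac_one_eq vertex_map_\<Psi> one_M VOA_facts V_zero)
  show "vertex_map v (- 1) (vac_one L l) = v" if "v \<in> carrier V" for v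
    using that[THEN V_cases] by (auto simp: vac_one_eq vertex_map_\<Psi> one_M VOA_facts)
  show "vertex_map v n (vac_one L l) = \<zero>\<^bsub>V\<^esub>" if "v \<in> carrier V" "0 \<le> n" for v n
    using that(1)[THEN V_cases] that(2) by (auto simp: vac_one_eq vertex_map_\<Psi> one_M VOA_facts V_zero)
  fix u v w \<alpha> \<beta> and m n k :: int
  assume uvw: "u \<in> vac_part L l \<alpha>" "v \<in> vac_part L l \<beta>" "w \<in> carrier V"
  obtain p q r where pqr: "p \<in> PM \<alpha>" "q \<in> PM \<beta>" "r \<in> M" "u = \<Psi> p" "v = \<Psi> q" "w = \<Psi> r"
    using V_cases_PM[OF uvw(1)] V_cases_PM[OF uvw(2)] V_cases[OF uvw(3)] by blast
  note J = VOA.Y_jacobi[unfolded carrier_space_eq, OF pqr(1-3), where m = m and n = n and k = k]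
  show "nat_sum V (\<lambda>i. ((- 1) ^ i * (of_int m gchoose i)) \<odot>\<^bsub>V\<^esub>
      (vertex_map u (m + k - int i) (vertex_map v (n + int i) w) \<ominus>\<^bsub>V\<^esub>
       (koszul_sign \<alpha> \<beta> * (- 1) powi m) \<odot>\<^bsub>V\<^esub> vertex_map v (m + n - int i) (vertex_map u (k + int i) w))) =
    nat_sum V (\<lambda>i. (of_int k gchoose i) \<odot>\<^bsub>V\<^esub> vertex_map (vertex_map u (m + int i) v) (n + k - int i) w)"
    using PM_M[OF pqr(1)] PM_M[OF pqr(2)] pqr(3)
    by (simp only: pqr(4-6) vertex_map_\<Psi> VOA_facts V_smult V_minus nat_sum_\<Psi>[OF J(1)] nat_sum_\<Psi>[OF J(2)] J(3))
qed

lemma vertex_map_gen: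
  assumes "w \<in> carrier V"
  shows "vertex_map (vac_gen L l a u) n w = vac_act L l (mode a u n) w"
proof -
  obtain p where p: "p \<in> M" "w = \<Psi> p" using V_cases[OF assms] by blast
  have mode: "mode a u n = mode a 0 n + mode 0 u n" for n by (simp add: mode_def)
  have g: "(\<lambda>n. op (mode a 0 n)) \<in> gens 0" "(\<lambda>n. op (mode 0 u n)) \<in> gens 1" by (simp_all add: gens_def)
  have "VOA.Y (op (mode a u (- 1)) one) n p = op (mode a 0 n) p + op (mode 0 u n) p"
    using VOA.Y_gen[OF g(1), unfolded carrier_space_eq, OF p(1), of n] VOA.Y_gen[OF g(2), unfolded carrier_space_eq, OF p(1), of n]
    by (simp add: mode[of "- 1"] op_add_left VOA_facts op_M p(1))
  then show ?thesis by (simp add: p vac_gen_eq vertex_map_\<Psi> op_M vac_act_\<Psi> mode[of n] op_add_left)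
qed

text \<open>A second structure is transported to representatives as \<open>Z\<close>. For \<open>k = 0\<close> only the term \<open>i = 0\<close> of the
right-hand side of the Jacobi identity survives, which is the assumption \<open>iterate\<close> of \<open>VOA.Y_unique\<close>.\<close>

theorem vertex_map_unique:
  assumes Y': "vertex_superalgebra V (vac_part L l) Y' (vac_one L l)"
    and gen: "\<And>a u n w. w \<in> carrier V \<Longrightarrow> Y' (vac_gen L l a u) n w = vac_act L l (mode a u n) w"
    and "v \<in> carrier V" "w \<in> carrier V"
  shows "Y' v n w = vertex_map v n w"
proof -
  interpret Y': vertex_superalgebra V "vac_part L l" Y' "vac_one L l" by fact
  define Z where "Z u n w = coord (Y' (\<Psi> u) n (\<Psi> w))" for u n w
  have Z_M: "Z u n w \<in> M" for u n w by (simp add: Z_def coord_def M_def)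
  have Z: "Y' (\<Psi> u) n (\<Psi> w) = \<Psi> (Z u n w)" for u n w
  proof -
    obtain p where "p \<in> M" "Y' (\<Psi> u) n (\<Psi> w) = \<Psi> p" using V_cases[OF Y'.Y_closed[OF \<Psi>_carrier \<Psi>_carrier]] by blast
    then show ?thesis by (simp add: Z_def coord_\<Psi>_M)
  qed
  have Z_eqI: "Z u n w = q" if "Y' (\<Psi> u) n (\<Psi> w) = \<Psi> q" "q \<in> M" for u n w q
    by (simp add: Z_def that coord_\<Psi>_M)
  obtain p q where pq: "p \<in> M" "q \<in> M" "v = \<Psi> p" "w = \<Psi> q" using assms(3,4)[THEN V_cases] by blast
  have "Z p n q = VOA.Y p n q"
  proof (rule VOA.Y_unique[unfolded carrier_space_eq, OF _ _ _ _ pq(1,2)])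
    show "Z (u + v) n w = Z u n w + Z v n w" if "u \<in> M" "v \<in> M" "w \<in> M" for u v n w
      by (rule Z_eqI) (simp_all add: V_add[symmetric] Y'.Y_add_left \<Psi>_carrier Z[symmetric] free.subspace_add[OF M_subspace] Z_M)
    show "Z (c *f u) n w = c *f Z u n w" if "u \<in> M" "w \<in> M" for c u n w
      by (rule Z_eqI) (simp_all add: V_smult[symmetric] Y'.Y_smult_left \<Psi>_carrier Z[symmetric] free.subspace_scale[OF M_subspace] Z_M)
    show "Z one n w = (if n = - 1 then w else 0)" if "w \<in> M" for n w
      by (rule Z_eqI) (use that in \<open>simp_all add: vac_one_eq[symmetric] Y'.Y_vac \<Psi>_carrier V_zero free.subspace_0[OF M_subspace]\<close>)
    fix \<alpha> \<beta> g m x n w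
    assume g: "g \<in> gens \<alpha>" and x: "x \<in> PM \<beta>" and w: "w \<in> M"
    have gY: "Y' (\<Psi> (g (- 1) one)) j (\<Psi> y) = \<Psi> (g j y)" for j y
      using g
    proof (cases rule: gens_cases)
      case (1 a) then show ?thesis using gen[OF \<Psi>_carrier, of a 0 j y] by (simp add: vac_gen_eq vac_act_\<Psi>)
    next
      case (2 u) then show ?thesis using gen[OF \<Psi>_carrier, of 0 u j y] by (simp add: vac_gen_eq vac_act_\<Psi>)
    qed
    have gM: "g j y \<in> M" for j y
      using g by (cases rule: gens_cases) (simp_all add: op_M)
    have gZ: "Z (g (- 1) one) j y = g j y" for j y
      by (rule Z_eqI[OF gY gM])
    define h where "h i = ((- 1) ^ i * (of_int m gchoose i)) *f (g (m - int i) (Z x (n + int i) w) -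
        (koszul_sign \<alpha> \<beta> * (- 1) powi m) *f Z x (m + n - int i) (g (int i) w))" for i
    have z: "g j 0 = 0" for j by (rule free.lin_zero[OF free.is_field_lin[OF VOA.gen_field[OF g]]])
    have Z0: "Z x j 0 = 0" for j
      using Y'.Y_smult_right[OF \<Psi>_carrier \<Psi>_carrier, of x j 0 0] 
      by (intro Z_eqI) (simp_all add: V_smult[of 0] Z[of x j 0] free.subspace_0[OF M_subspace])
    have fin: "finite {i. h i \<noteq> 0}"
    proof -
      obtain N1 where N1: "\<And>j. j \<ge> N1 \<Longrightarrow> g j w = 0"
        using VOA.gen_field[OF g] unfolding free.is_field_def by meson
      obtain N2 where N2: "\<And>j. j \<ge> N2 \<Longrightarrow> Y' (\<Psi> x) j (\<Psi> w) = \<zero>\<^bsub>V\<^esub>"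
        using Y'.Y_truncation[OF \<Psi>_carrier \<Psi>_carrier] by meson
      have Zx: "Z x j w = 0" if "j \<ge> N2" for j
        by (rule Z_eqI) (simp_all add: N2[OF that] V_zero free.subspace_0[OF M_subspace])
      have "h i = 0" if "\<not> i \<le> nat (max N1 (N2 - n))" for i
        using N1[of "int i"] Zx[of "n + int i"] that by (simp add: h_def z Z0)
      then have "{i. h i \<noteq> 0} \<subseteq> {..nat (max N1 (N2 - n))}" by blast
      then show ?thesis by (rule finite_subset) simp
    qed
    have part: "\<Psi> (g (- 1) one) \<in> vac_part L l \<alpha>" "\<Psi> x \<in> vac_part L l \<beta>"
      using VOA.gen_parity[OF g one_PM, of "- 1"] x by (auto simp: vac_part_eq)
    have b: "(0 gchoose i) = (if i = 0 then 1 else 0 :: complex)" for i by (cases i) auto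
    have "\<Psi> (Sum_any h) = nat_sum V (\<lambda>i. \<Psi> (h i))" by (rule nat_sum_\<Psi>[OF fin, symmetric])
    also have "\<dots> = nat_sum V (\<lambda>i. (of_int 0 gchoose i) \<odot>\<^bsub>V\<^esub> Y' (Y' (\<Psi> (g (- 1) one)) (m + int i) (\<Psi> x)) (n + 0 - int i) (\<Psi> w))"
      using Y'.Y_jacobi[OF part \<Psi>_carrier[of w], of m 0 n]
      by (simp only: Z gZ V_smult V_minus h_def add_0_left add_0_right)
    also have "\<dots> = nat_sum V (\<lambda>i. \<Psi> (if i = 0 then Z (g m x) n w else 0))"
    proof (rule arg_cong[where f = "nat_sum V"], rule ext)
      fix i show "(of_int 0 gchoose i) \<odot>\<^bsub>V\<^esub> Y' (Y' (\<Psi> (g (- 1) one)) (m + int i) (\<Psi> x)) (n + 0 - int i) (\<Psi> w) =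
        \<Psi> (if i = 0 then Z (g m x) n w else 0)"
        by (simp add: Z gZ V_smult b mono_Nil_1)
    qed
    also have "\<dots> = \<Psi> (Z (g m x) n w)" by (subst nat_sum_\<Psi>) simp_all
    finally have eq: "\<Psi> (Sum_any h) = \<Psi> (Z (g m x) n w)" .
    have mem: "Sum_any h \<in> M"
    proof (rule free.Sum_any_in_subspace[OF M_subspace])
      fix i show "h i \<in> M"
        unfolding h_def by (rule free.subspace_scale[OF M_subspace], rule free.subspace_diff[OF M_subspace],
            rule gM, rule free.subspace_scale[OF M_subspace], rule Z_M)
    qed
    have "Z (g m x) n w = coord (\<Psi> (Z (g m x) n w))" by (rule coord_\<Psi>_M[OF Z_M, symmetric])
    also have "\<dots> = coord (\<Psi> (Sum_any h))" by (simp only: eq)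
    also have "\<dots> = Sum_any h" by (rule coord_\<Psi>_M[OF mem])
    finally show "Z (g m x) n w = Sum_any (\<lambda>i. ((- 1) ^ i * (of_int m gchoose i)) *f (g (m - int i) (Z x (n + int i) w) -
        (koszul_sign \<alpha> \<beta> * (- 1) powi m) *f Z x (m + n - int i) (g (int i) w)))"
      unfolding h_def[abs_def] .
  qed
  then show ?thesis unfolding pq(3,4) vertex_map_\<Psi>[OF pq(1,2)] Z by (simp only:)
qed

end

theorem proposition5p1:
  fixes scaleA :: "complex \<Rightarrow> 'a::comm_ring \<Rightarrow> 'a"
    and scaleU :: "complex \<Rightarrow> 'u::ab_group_add \<Rightarrow> 'u"
    and act :: "'a \<Rightarrow> 'u \<Rightarrow> 'u"
    and formA :: "'a \<Rightarrow> 'a \<Rightarrow> complex"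
    and formU :: "'u \<Rightarrow> 'u \<Rightarrow> complex"
    and circ :: "'u \<Rightarrow> 'u \<Rightarrow> 'a"
    and l :: complex
  assumes "compatible_pair scaleA scaleU act formA formU circ"
  shows "let L = laff scaleA scaleU act formA formU circ;
             V = vac_module L l;
             is_structure = (\<lambda>Y. vertex_superalgebra V (vac_part L l) Y (vac_one L l) \<and>
               (\<forall>a u n. \<forall>w\<in>carrier V. Y (vac_gen L l a u) n w = vac_act L l (mode a u n) w))
         in \<exists>Y. is_structure Y \<and>
              (\<forall>Y'. is_structure Y' \<longrightarrow>
                (\<forall>v\<in>carrier V. \<forall>n. \<forall>w\<in>carrier V. Y' v n w = Y v n w))"
proof -
  interpret vacuum_module scaleA scaleU act formA formU circ l
    using assms by (rule vacuum_module.intro)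
  show ?thesis
    unfolding Let_def vac_module_eq
  proof (rule exI[of _ vertex_map], intro conjI allI ballI impI)
    show "vertex_superalgebra V (vac_part L l) vertex_map (vac_one L l)"
      by (rule vertex_superalgebra_vac)
    show "vertex_map (vac_gen L l a u) n w = vac_act L l (mode a u n) w" if "w \<in> carrier V" for a u n w
      using that by (rule vertex_map_gen)
  next
    fix Y' v n w
    assume Y': "vertex_superalgebra V (vac_part L l) Y' (vac_one L l) \<and>
        (\<forall>a u n. \<forall>w\<in>carrier V. Y' (vac_gen L l a u) n w = vac_act L l (mode a u n) w)"
      and "v \<in> carrier V" "w \<in> carrier V"
    then show "Y' v n w = vertex_map v n w"
      by (intro vertex_map_unique) simp_all
  qed
qed

end
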